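(* Let $\mathbb{D}\subset\mathbb{C}$ be a simply connected domain with coordinate $z$. (i) Let $f_{max}:\mathbb{D}\to\mathbb{H}^3_1$ be a conformal spacelike maximal surface with unit normal $N$, metric $2e^{\hat u}\,\mathrm{d}z\,\mathrm{d}\bar z$ and Hopf differential $\mathcal{Q}\,\mathrm{d}z^2$. Then $f=[f_{max}+iN]\in Q_2^*$ is a minimal Lagrangian surface whose holomorphic differential is $-i\mathcal{Q}\,\mathrm{d}z^2$ and whose metric is $$2e^u\,\mathrm{d}z\,\mathrm{d}\bar z=\bigl(e^{\hat u}+|\mathcal{Q}|^2e^{-\hat u}\bigr)\,\mathrm{d}z\,\mathrm{d}\bar z .$$ (ii) Conversely, let $f:\mathbb{D}\to Q_2^*$ be a minimal Lagrangian surface with holomorphic differential $\hat\alpha\,\mathrm{d}z^2$ and metric $2e^u\,\mathrm{d}z\,\mathrm{d}\bar z$. After choosing a normalized horizontal lift of $f$ (locally if necessary), there exists a pair $g=(f_{max},N)$ with values in $T_1^-\mathbb{H}^3_1$, where $f_{max}$ is a spacelike maximal surface in $\mathbb{H}^3_1$ with unit normal $N$. Moreover, both projections $f_{max}$ and $N$ have the same Hopf differential $i\hat\alpha\,\mathrm{d}z^2$, and the metrics $2e^{\hat u}\,\mathrm{d}z\,\mathrm{d}\bar z$ of $f_{max}$ and $2e^{\tilde u}\,\mathrm{d}z\,\mathrm{d}\bar z$ of $N$ are given by $$e^{\hat u}=e^u+\sqrt{e^{2u}-|\hat\alpha|^2},\qquad e^{\tilde u}=e^u-\sqrt{e^{2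u}-|\hat\alpha|^2}.$$
   Context: On $\mathbb{C}^4_2=\mathbb{C}^4$ let $\langle \boldsymbol z,\boldsymbol w\rangle=-z_1w_1-z_2w_2+z_3w_3+z_4w_4$ (complex bilinear), $(\boldsymbol z,\boldsymbol w)=\langle \boldsymbol z,\overline{\boldsymbol w}\rangle$; $\mathbb{R}^4_2\subset\mathbb{C}^4_2$ is the real part. Put $\mathbb{H}^7_3(-1)=\{\boldsymbol z : (\boldsymbol z,\boldsymbol z)=-1\}$ and $\mathbb{CH}^3_1=\{[\boldsymbol z]\in\mathbb{C}P^3 : (\boldsymbol z,\boldsymbol z)<0\}$, with $\pi:\mathbb{H}^7_3(-1)\to\mathbb{CH}^3_1$ the indefinite Hopf fibration, a pseudo-Riemannian submersion (with respect to $\mathrm{Re}(\cdot,\cdot)$) defining the indefinite Kähler structure of $\mathbb{CH}^3_1$. $Q_2^*$ is a connected component of $\{[\boldsymbol z]\in\mathbb{CH}^3_1 : \langle \boldsymbol z,\boldsymbol z\rangle=0\}$ with the induced Kähler structure (positive definite metric); in (i) it is the component containing $[f_{max}+iN]$ (changing $N$ to $-N$ exchanges the two components). An immersion of a surface into $Q_2^*$ is Lagrangian if the Kähler form pulls back to $0$, minimal if its mean curvature vector vanishes; all surfaces are conformally parametrized. A horizontal lift of a Lagrangian $f$ is a smooth $\mathfrak{f}:\mathbb{D}\to\mathbb{H}^7_3(-1)$ with $\pi\circ\mathfrak{f}=f$ and $\langle \mathfrak{f}_z,\overline{\mathfrak{f}}\rangle=\langle \mathfrak{f}_{\bar z},\overline{\mathfrak{f}}\rangle=0$;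 it is unique up to a constant unitary factor. For minimal $f$ the argument $\varphi$ of $\beta=\langle\mathfrak f_z,\mathfrak f_{\bar z}\rangle$ is constant ($\beta=e^{i\varphi}|\beta|$ on the domain considered), and the normalized horizontal lift is $\hat{\mathfrak f}=e^{-i\varphi/2}\mathfrak f$, for which $\langle\hat{\mathfrak f}_z,\hat{\mathfrak f}_{\bar z}\rangle=|\beta|\ge0$. In (ii) the holomorphic differential of $f$ is $\hat\alpha\,\mathrm{d}z^2$ with $\hat\alpha=\langle\hat{\mathfrak f}_z,\hat{\mathfrak f}_z\rangle$; in (i) the holomorphic differential is $\langle\hat{\mathfrak f}_z,\hat{\mathfrak f}_z\rangle\,\mathrm{d}z^2$ computed with the horizontal lift $\hat{\mathfrak f}=\frac{1}{\sqrt2}(f_{max}+iN)$. Anti-de Sitter space is $\mathbb{H}^3_1=\{p\in\mathbb{R}^4_2:\langle p,p\rangle=-1\}$, with the induced Lorentzian metric of curvature $-1$. A surface $f_{max}$ in $\mathbb{H}^3_1$ is spacelike maximal if its induced metric is positive definite and its mean curvature vanishes; its unit normal $N$ is tangent to $\mathbb{H}^3_1$, orthogonal to the surface, with $\langle N,N\rangle=-1$, and its Hopf differential is $\langle (f_{max})_{zz},N\rangle\,\mathrm{d}z^2$. The timelike unit tangent bundle is $T_1^-\mathbb{H}^3_1=\{(p,v): p\in\mathbb{H}^3_1,\ v\in T_p\mathbb{H}^3_1,\ \langle v,v\rangle=-1\}$. In (ii), $N$ is regarded as a map into $\mathbb{H}^3_1$ with normal $f_{max}$ (so its Hopf differential is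 $\langle N_{zz},f_{max}\rangle\,\mathrm{d}z^2$); its metric is the pull-back of the metric of $\mathbb{H}^3_1$, which degenerates where $\hat\alpha=0$ (there $e^{\tilde u}$ stands for $0$). *)

theory Defs
  imports "HOL-Analysis.Analysis"
begin

section \<open>Calculus on open subsets of the complex plane\<close>

primrec Ck_on :: "nat \<Rightarrow> 'a::real_normed_vector set \<Rightarrow> ('a \<Rightarrow> 'b::real_normed_vector) \<Rightarrow> bool" where
  "Ck_on 0 S f \<longleftrightarrow> continuous_on S f"
| "Ck_on (Suc k) S f \<longleftrightarrow> (\<forall>x\<in>S. f differentiable (at x)) \<and>
     (\<forall>v. Ck_on k S (\<lambda>x. frechet_derivative f (at x) v))"

definition smooth_on :: "'a::real_normed_vector set \<Rightarrow> ('a \<Rightarrow> 'b::real_normed_vector) \<Rightarrow> bool" where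
  "smooth_on S f \<longleftrightarrow> (\<forall>k. Ck_on k S f)"

text \<open>Real tangent vectors of the plane are complex numbers: \<open>\<partial>/\<partial>x\<close> is \<open>1\<close> and \<open>\<partial>/\<partial>y\<close> is \<open>\<i>\<close>.\<close>

definition dir :: "(complex \<Rightarrow> 'b::real_normed_vector) \<Rightarrow> complex \<Rightarrow> complex \<Rightarrow> 'b" where
  "dir F X z = frechet_derivative F (at z) X"

definition dz :: "(complex \<Rightarrow> complex^4) \<Rightarrow> complex \<Rightarrow> complex^4" where
  "dz F z = (1/2) *s (dir F 1 z - \<i> *s dir F \<i> z)"

definition dzbar :: "(complex \<Rightarrow> complex^4) \<Rightarrow> complex \<Rightarrow> complex^4" where
  "dzbar F z = (1/2) *s (dir F 1 z + \<i> *s dir F \<i> z)"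

section \<open>The pseudo-Euclidean spaces\<close>

definition bil :: "'a::comm_ring_1^4 \<Rightarrow> 'a^4 \<Rightarrow> 'a" where
  "bil z w = - z$1 * w$1 - z$2 * w$2 + z$3 * w$3 + z$4 * w$4"

definition vcnj :: "complex^4 \<Rightarrow> complex^4" where
  "vcnj z = (\<chi> i. cnj (z$i))"

definition herm :: "complex^4 \<Rightarrow> complex^4 \<Rightarrow> complex" where
  "herm z w = bil z (vcnj w)"

definition cvec :: "real^4 \<Rightarrow> complex^4" where
  "cvec v = (\<chi> i. complex_of_real (v$i))"

section \<open>Complex projective space and the dual quadric\<close>

definition cline :: "complex^4 \<Rightarrow> (complex^4) set" where
  "cline z = {c *s z |c. True}"

definition CP3 :: "(complex^4) set set" where
  "CP3 = cline ` (- {0})"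

definition CP3_top :: "(complex^4) set topology" where
  "CP3_top = topology (\<lambda>U. U \<subseteq> CP3 \<and> open {z. z \<noteq> 0 \<and> cline z \<in> U})"

lemma openin_CP3_top: "openin CP3_top U \<longleftrightarrow> U \<subseteq> CP3 \<and> open {z. z \<noteq> 0 \<and> cline z \<in> U}"
proof -
  have "istopology (\<lambda>U. U \<subseteq> CP3 \<and> open {z. z \<noteq> 0 \<and> cline z \<in> U})"
    unfolding istopology_def
  proof (intro conjI allI impI)
    fix U V :: "(complex^4) set set"
    assume *: "U \<subseteq> CP3 \<and> open {z. z \<noteq> 0 \<and> cline z \<in> U}" "V \<subseteq> CP3 \<and> open {z. z \<noteq> 0 \<and> cline z \<in> V}"
    show "U \<inter> V \<subseteq> CP3" using * by blast
    have "{z. z \<noteq> 0 \<and> cline z \<in> U \<inter> V} = {z. z \<noteq> 0 \<and> cline z \<in> U} \<inter> {z. z \<noteq> 0 \<and> cline z \<in> V}" by auto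
    then show "open {z. z \<noteq> 0 \<and> cline z \<in> U \<inter> V}" using * by (simp add: open_Int)
  next
    fix K :: "(complex^4) set set set"
    assume *: "\<forall>U\<in>K. U \<subseteq> CP3 \<and> open {z. z \<noteq> 0 \<and> cline z \<in> U}"
    show "\<Union> K \<subseteq> CP3" using * by blast
    have "{z. z \<noteq> 0 \<and> cline z \<in> \<Union> K} = (\<Union>U\<in>K. {z. z \<noteq> 0 \<and> cline z \<in> U})" by auto
    then show "open {z. z \<noteq> 0 \<and> cline z \<in> \<Union> K}" using * by (simp add: open_UN)
  qed
  then show ?thesis by (simp add: CP3_top_def)
qed

definition CH31 :: "(complex^4) set set" where
  "CH31 = cline ` {z. Re (herm z z) < 0}"

definition quadric_dual :: "(complex^4) set set" where
  "quadric_dual = {cline z |z. cline z \<in> CH31 \<and> bil z z = 0}"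

definition Q2star_components :: "(complex^4) set set set" where
  "Q2star_components = connected_components_of (subtopology CP3_top quadric_dual)"

section \<open>Surfaces in the dual quadric\<close>

text \<open>A map \<open>f\<close> into projective space is handled through its local lifts \<open>F\<close> to the hyperquadric
  \<open>herm p p = - 1\<close>; all the objects below are independent of the choice of \<open>F\<close>, up to
  the unitary factor by which two lifts differ.\<close>

definition local_lift :: "complex set \<Rightarrow> (complex \<Rightarrow> (complex^4) set) \<Rightarrow> complex set \<Rightarrow>
    (complex \<Rightarrow> complex^4) \<Rightarrow> bool" where
  "local_lift S f U F \<longleftrightarrow> open U \<and> U \<subseteq> S \<and> smooth_on U F \<and>
     (\<forall>z\<in>U. herm (F z) (F z) = -1 \<and> f z = cline (F z))"

text \<open>Since the Hopf fibration is a submersion, a map to its base is smooth iff it has smooth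
  local lifts.\<close>

definition smooth_map :: "complex set \<Rightarrow> (complex \<Rightarrow> (complex^4) set) \<Rightarrow> bool" where
  "smooth_map S f \<longleftrightarrow> (\<forall>z\<in>S. \<exists>U F. z \<in> U \<and> local_lift S f U F)"

text \<open>The tangent space of the base at the line of \<open>p\<close> is represented by the horizontal space
  \<open>{v. herm v p = 0}\<close>, with metric \<open>Re (herm v w)\<close> and complex structure \<open>\<i>\<close>; \<open>hor p\<close> is the
  orthogonal projection onto it. Thus \<open>tangent F X z\<close> represents the differential of \<open>f\<close>
  applied to \<open>X\<close>.\<close>

definition hor :: "complex^4 \<Rightarrow> complex^4 \<Rightarrow> complex^4" where
  "hor p v = v + herm v p *s p"

definition tangent :: "(complex \<Rightarrow> complex^4) \<Rightarrow> complex \<Rightarrow> complex \<Rightarrow> complex^4" where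
  "tangent F X z = hor (F z) (dir F X z)"

definition ind_metric :: "(complex \<Rightarrow> complex^4) \<Rightarrow> complex \<Rightarrow> complex \<Rightarrow> complex \<Rightarrow> real" where
  "ind_metric F X Y z = Re (herm (tangent F X z) (tangent F Y z))"

definition kaehler_pullback :: "(complex \<Rightarrow> complex^4) \<Rightarrow> complex \<Rightarrow> complex \<Rightarrow> complex \<Rightarrow> real" where
  "kaehler_pullback F X Y z = Re (herm (\<i> *s tangent F X z) (tangent F Y z))"

text \<open>For \<open>bil p p = 0\<close> and \<open>herm p p = - 1\<close>, the tangent space of the quadric is the subspace
  \<open>{v. herm v p = 0 \<and> herm v (vcnj p) = 0}\<close> of the horizontal space;
  \<open>proj_quadric p\<close> is the orthogonal projection onto it.\<close>

definition proj_quadric :: "complex^4 \<Rightarrow> complex^4 \<Rightarrow> complex^4" where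
  "proj_quadric p v = v + herm v p *s p + herm v (vcnj p) *s vcnj p"

text \<open>Levi-Civita derivative of the quadric in the direction \<open>X\<close>, for a vector field along \<open>f\<close>
  that is represented by \<open>W\<close>. Along a horizontal lift it is the tangential part of the flat
  derivative of \<open>W\<close> (submersion formula, then Gauss formula). If
  \<open>F = exp (\<i> \<theta>) F\<^sub>0\<close> with \<open>F\<^sub>0\<close> horizontal in the direction \<open>X\<close>, then \<open>herm (dir F X) F = - \<i> d\<theta>(X)\<close>,
  and the second summand removes the derivative of the unitary factor.\<close>

definition cov_deriv :: "(complex \<Rightarrow> complex^4) \<Rightarrow> complex \<Rightarrow> (complex \<Rightarrow> complex^4) \<Rightarrow> complex \<Rightarrow> complex^4" where
  "cov_deriv F X W z = proj_quadric (F z) (dir W X z) + herm (dir F X z) (F z) *s W z"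

text \<open>In the next two definitions \<open>1\<close> and \<open>\<i>\<close> are an orthogonal frame for the induced metric,
  because surfaces are conformally parametrized.\<close>

definition normal_part :: "(complex \<Rightarrow> complex^4) \<Rightarrow> complex^4 \<Rightarrow> complex \<Rightarrow> complex^4" where
  "normal_part F v z =
     v - (\<Sum>X\<in>{1, \<i>}. (Re (herm v (tangent F X z)) / ind_metric F X X z) *\<^sub>R tangent F X z)"

definition second_ff :: "(complex \<Rightarrow> complex^4) \<Rightarrow> complex \<Rightarrow> complex \<Rightarrow> complex \<Rightarrow> complex^4" where
  "second_ff F X Y z = normal_part F (cov_deriv F X (tangent F Y) z) z"

definition mean_curvature_vector :: "(complex \<Rightarrow> complex^4) \<Rightarrow> complex \<Rightarrow> complex^4" where
  "mean_curvature_vector F z =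
     (1/2) *\<^sub>R (\<Sum>X\<in>{1, \<i>}. (1 / ind_metric F X X z) *\<^sub>R second_ff F X X z)"

text \<open>A conformally parametrized minimal Lagrangian immersion into the component \<open>Q\<close> of the quadric.\<close>

definition minimal_lagrangian :: "complex set \<Rightarrow> (complex^4) set set \<Rightarrow> (complex \<Rightarrow> (complex^4) set) \<Rightarrow> bool" where
  "minimal_lagrangian S Q f \<longleftrightarrow> smooth_map S f \<and> f ` S \<subseteq> Q \<and>
     (\<forall>U F. local_lift S f U F \<longrightarrow> (\<forall>z\<in>U.
        (\<forall>X. X \<noteq> 0 \<longrightarrow> tangent F X z \<noteq> 0) \<and>
        ind_metric F 1 1 z = ind_metric F \<i> \<i> z \<and> ind_metric F 1 \<i> z = 0 \<and>
        (\<forall>X Y. kaehler_pullback F X Y z = 0) \<and>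
        mean_curvature_vector F z = 0))"

text \<open>The induced metric is \<open>\<rho> (dx\<^sup>2 + dy\<^sup>2)\<close>, and \<open>dx\<^sup>2 + dy\<^sup>2\<close> is the Euclidean
  inner product of the plane.\<close>

definition has_metric :: "complex set \<Rightarrow> (complex \<Rightarrow> (complex^4) set) \<Rightarrow> (complex \<Rightarrow> real) \<Rightarrow> bool" where
  "has_metric S f \<rho> \<longleftrightarrow> (\<forall>U F. local_lift S f U F \<longrightarrow>
     (\<forall>z\<in>U. \<forall>X Y. ind_metric F X Y z = \<rho> z * (X \<bullet> Y)))"

definition horizontal_lift :: "complex set \<Rightarrow> (complex \<Rightarrow> (complex^4) set) \<Rightarrow> (complex \<Rightarrow> complex^4) \<Rightarrow> bool" where
  "horizontal_lift S f F \<longleftrightarrow> smooth_on S F \<and>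
     (\<forall>z\<in>S. herm (F z) (F z) = -1 \<and> f z = cline (F z) \<and>
        bil (dz F z) (vcnj (F z)) = 0 \<and> bil (dzbar F z) (vcnj (F z)) = 0)"

definition alpha :: "(complex \<Rightarrow> complex^4) \<Rightarrow> complex \<Rightarrow> complex" where
  "alpha F z = bil (dz F z) (dz F z)"

definition beta :: "(complex \<Rightarrow> complex^4) \<Rightarrow> complex \<Rightarrow> complex" where
  "beta F z = bil (dz F z) (dzbar F z)"

definition normalized_lift :: "complex set \<Rightarrow> (complex \<Rightarrow> (complex^4) set) \<Rightarrow> (complex \<Rightarrow> complex^4) \<Rightarrow> bool" where
  "normalized_lift S f G \<longleftrightarrow> (\<exists>F \<phi>. horizontal_lift S f F \<and>
     (\<forall>z\<in>S. beta F z = cis \<phi> * complex_of_real (cmod (beta F z))) \<and>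
     G = (\<lambda>z. cis (- \<phi> / 2) *s F z))"

section \<open>Surfaces in anti-de Sitter space\<close>

definition AdS :: "(real^4) set" where
  "AdS = {p. bil p p = -1}"

definition AdS_tangent :: "real^4 \<Rightarrow> (real^4) set" where
  "AdS_tangent p = {v. bil p v = 0}"

definition T1minus :: "((real^4) \<times> (real^4)) set" where
  "T1minus = {(p, v). p \<in> AdS \<and> v \<in> AdS_tangent p \<and> bil v v = -1}"

definition unit_normal :: "complex set \<Rightarrow> (complex \<Rightarrow> real^4) \<Rightarrow> (complex \<Rightarrow> real^4) \<Rightarrow> bool" where
  "unit_normal S g N \<longleftrightarrow> smooth_on S N \<and>
     (\<forall>z\<in>S. N z \<in> AdS_tangent (g z) \<and> (\<forall>X. bil (dir g X z) (N z) = 0) \<and> bil (N z) (N z) = -1)"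

definition AdS_has_metric :: "complex set \<Rightarrow> (complex \<Rightarrow> real^4) \<Rightarrow> (complex \<Rightarrow> real) \<Rightarrow> bool" where
  "AdS_has_metric S g \<rho> \<longleftrightarrow>
     (\<forall>z\<in>S. \<forall>X Y. bil (dir g X z) (dir g Y z) = \<rho> z * (X \<bullet> Y))"

text \<open>Half the trace, in the orthogonal frame \<open>1\<close>, \<open>\<i>\<close>, of the second fundamental form
  \<open>bil (dir (dir g Y) X) N\<close>. The Levi-Civita derivative of anti-de Sitter space may be replaced by the
  flat one since \<open>N\<close> is orthogonal to the position vector; the sign for the timelike normal is omitted.\<close>

definition AdS_mean_curvature :: "(complex \<Rightarrow> real^4) \<Rightarrow> (complex \<Rightarrow> real^4) \<Rightarrow> complex \<Rightarrow> real" where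
  "AdS_mean_curvature g N z =
     (1/2) * (\<Sum>X\<in>{1, \<i>}. bil (dir (dir g X) X z) (N z) / bil (dir g X z) (dir g X z))"

definition maximal_surface :: "complex set \<Rightarrow> (complex \<Rightarrow> real^4) \<Rightarrow> (complex \<Rightarrow> real^4) \<Rightarrow> bool" where
  "maximal_surface S g N \<longleftrightarrow> smooth_on S g \<and> g ` S \<subseteq> AdS \<and> unit_normal S g N \<and>
     (\<forall>z\<in>S. (\<forall>X. X \<noteq> 0 \<longrightarrow> bil (dir g X z) (dir g X z) > 0) \<and>
        bil (dir g 1 z) (dir g 1 z) = bil (dir g \<i> z) (dir g \<i> z) \<and>
        bil (dir g 1 z) (dir g \<i> z) = 0 \<and>
        AdS_mean_curvature g N z = 0)"

definition hopf :: "(complex \<Rightarrow> real^4) \<Rightarrow> (complex \<Rightarrow> real^4) \<Rightarrow> complex \<Rightarrow> complex" where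
  "hopf g N z = bil (dz (dz (\<lambda>w. cvec (g w))) z) (cvec (N z))"

text \<open>\<open>(g, N)\<close> is a pair associated with the surface \<open>f\<close>, where \<open>f\<close> has metric \<open>2 exp u (dx\<^sup>2 + dy\<^sup>2)\<close> and
  holomorphic differential \<open>a dz\<^sup>2\<close>.\<close>

definition maximal_pair :: "complex set \<Rightarrow> (complex \<Rightarrow> (complex^4) set) \<Rightarrow> (complex \<Rightarrow> real) \<Rightarrow>
    (complex \<Rightarrow> complex) \<Rightarrow> (complex \<Rightarrow> real^4) \<Rightarrow> (complex \<Rightarrow> real^4) \<Rightarrow> bool" where
  "maximal_pair S f u a g N \<longleftrightarrow>
     (\<forall>z\<in>S. (g z, N z) \<in> T1minus \<and> f z = cline (cvec (g z) + \<i> *s cvec (N z))) \<and>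
     maximal_surface S g N \<and>
     (\<forall>z\<in>S. hopf g N z = \<i> * a z \<and> hopf N g z = \<i> * a z) \<and>
     AdS_has_metric S g (\<lambda>z. 2 * (exp (u z) + sqrt (exp (2 * u z) - (cmod (a z))\<^sup>2))) \<and>
     AdS_has_metric S N (\<lambda>z. 2 * (exp (u z) - sqrt (exp (2 * u z) - (cmod (a z))\<^sup>2)))"

end

theory Submission
  imports Defs "HOL-Complex_Analysis.Riemann_Mapping"
begin

text \<open>
  Along a horizontal lift \<open>F\<close> of a surface in the quadric, the vectors \<open>F\<close>, its conjugate, \<open>dz F\<close> and
  \<open>dzbar F\<close> form a frame of \<open>\<complex>\<^sup>4\<close> that is unitary up to scale exactly when the surface is conformal and
  Lagrangian; minimality says that \<open>dz (dzbar F)\<close> lies in the span of \<open>F\<close> and its conjugate. For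
  \<open>F = (f_max + \<i> N) / \<surd>2\<close> this holds because both \<open>f_max\<close> and \<open>N\<close> are conformal, with
  \<open>dz (dzbar f_max)\<close> and \<open>dz (dzbar N)\<close> proportional to \<open>f_max\<close> and \<open>N\<close>.

  Conversely, expanding the conjugates of \<open>dz F\<close> and \<open>dzbar F\<close> in the frame yields
  \<open>|alpha|\<^sup>2 + |beta|\<^sup>2 = e\<^sup>2\<^sup>u\<close> and a linear relation between \<open>alpha\<close> and the conjugate of
  \<open>gam = bil (dzbar F) (dzbar F)\<close>, which are both holomorphic. Once the phase of the lift is chosen such that
  \<open>beta \<ge> 0\<close> and \<open>alpha + cnj gam = 0\<close>, the real and imaginary parts of \<open>\<surd>2 F\<close> are conformal and harmonic.
  If \<open>beta\<close> does not vanish identically, the second condition follows from the first by the identity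
  theorem; otherwise \<open>cnj gam / alpha\<close> is a unimodular constant that a rotation of the lift adjusts.

  A horizontal lift exists on the simply connected domain since the Lagrangian condition makes the
  connection form of any global lift closed.
\<close>

section \<open>Smooth functions\<close>

text \<open>Minimality, the Lagrangian condition and the metric are stated for all local lifts,
  whereas computations are easy only along a horizontal one. Hence the invariance under unitary
  factors, which reduces everything to flat derivatives of a single lift. Before a lift can be made
  horizontal it has to exist globally: on each component of the quadric one of the functions v1 + i
  v2 and v1 - i v2 has no zeros and trivializes the circle bundle. Unlike \<open>alpha\<close> and
  \<open>cnj gam\<close>, \<open>beta\<close> need not be holomorphic; its phase is constant on
  connected regions without zeros because the derivative of \<open>beta / cnj beta\<close> vanishes,
  and possible zeros of \<open>beta\<close> are the reason for working on subregions. The sign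
  condition \<open>beta \<ge> 0\<close> also decides which part of the lift is the surface and which
  is its normal: their conformal factors are e^u + beta and e^u - beta, so the real part is always
  immersed, while the imaginary part degenerates where \<open>alpha = 0\<close>.\<close>

lemma Ck_on_cong:
  assumes "open S" "\<And>x. x \<in> S \<Longrightarrow> f x = g x"
  shows "Ck_on k S f \<longleftrightarrow> Ck_on k S g"
  using assms(2)
proof (induction k arbitrary: f g)
  case 0
  then show ?case by (auto intro: continuous_on_cong)
next
  case (Suc k)
  have diff: "f differentiable (at x) \<longleftrightarrow> g differentiable (at x)" if "x \<in> S" for x
  proof -
    have "(f has_derivative h) (at x) \<longleftrightarrow> (g has_derivative h) (at x)" for h
      using has_derivative_transform_within_open[OF _ \<open>open S\<close> that] Suc.prems by metis
    then show ?thesis unfolding differentiable_def by simp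
  qed
  have fd: "frechet_derivative f (at x) = frechet_derivative g (at x)" if "x \<in> S" for x
  proof -
    have "(f has_derivative h) (at x) \<longleftrightarrow> (g has_derivative h) (at x)" for h
      using has_derivative_transform_within_open[OF _ \<open>open S\<close> that] Suc.prems by metis
    then show ?thesis unfolding frechet_derivative_def by simp
  qed
  have "Ck_on k S (\<lambda>x. frechet_derivative f (at x) v) \<longleftrightarrow> Ck_on k S (\<lambda>x. frechet_derivative g (at x) v)" for v
    by (rule Suc.IH) (simp add: fd)
  with diff show ?case by simp
qed

lemma Ck_on_SucD: "Ck_on (Suc k) S f \<Longrightarrow> Ck_on k S f"
proof (induction k arbitrary: f)
  case 0
  then show ?case
    by (auto intro!: continuous_at_imp_continuous_on differentiable_imp_continuous_within)
next
  case (Suc k)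
  have "f differentiable (at x)" if "x \<in> S" for x using Suc.prems that by simp
  moreover have "Ck_on k S (\<lambda>x. frechet_derivative f (at x) v)" for v
    using Suc.prems by (intro Suc.IH) simp
  ultimately show ?case by simp
qed

lemma Ck_on_subset: "Ck_on k S f \<Longrightarrow> T \<subseteq> S \<Longrightarrow> Ck_on k T f"
  by (induction k arbitrary: f) (auto intro: continuous_on_subset)

text \<open>Any explicit derivative can stand in for the chosen \<open>frechet_derivative\<close>,
  so that the inductions below can differentiate by the usual rules.\<close>

lemma Ck_on_SucI:
  assumes "open S" "\<And>x. x \<in> S \<Longrightarrow> (f has_derivative f' x) (at x)" "\<And>v. Ck_on k S (\<lambda>x. f' x v)"
  shows "Ck_on (Suc k) S f"
proof -
  have "Ck_on k S (\<lambda>x. frechet_derivative f (at x) v) \<longleftrightarrow> Ck_on k S (\<lambda>x. f' x v)" for v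
    by (rule Ck_on_cong[OF \<open>open S\<close>]) (metis assms(2) frechet_derivative_at)
  with assms(2,3) show ?thesis by (auto simp: differentiable_def)
qed

lemma Ck_on_SucE:
  assumes "Ck_on (Suc k) S f" "x \<in> S"
  shows "(f has_derivative frechet_derivative f (at x)) (at x)"
  using assms by (simp add: frechet_derivative_works)

lemma Ck_on_linear:
  assumes "open S" "bounded_linear L" "Ck_on k S f"
  shows "Ck_on k S (\<lambda>x. L (f x))"
  using assms(3)
proof (induction k arbitrary: f)
  case 0
  then show ?case using bounded_linear.continuous_on[OF assms(2)] by simp
next
  case (Suc k)
  show ?case
  proof (rule Ck_on_SucI[OF \<open>open S\<close>])
    show "((\<lambda>x. L (f x)) has_derivative (\<lambda>v. L (frechet_derivative f (at x) v))) (at x)" if "x \<in> S" for x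
      using bounded_linear.has_derivative[OF assms(2) Ck_on_SucE[OF Suc.prems that]] .
    show "Ck_on k S (\<lambda>x. L (frechet_derivative f (at x) v))" for v
      using Suc by auto
  qed
qed

lemma Ck_on_add:
  assumes "open S" "Ck_on k S f" "Ck_on k S g"
  shows "Ck_on k S (\<lambda>x. f x + g x)"
  using assms(2,3)
proof (induction k arbitrary: f g)
  case 0
  then show ?case by (simp add: continuous_on_add)
next
  case (Suc k)
  show ?case
  proof (rule Ck_on_SucI[OF \<open>open S\<close>])
    show "((\<lambda>x. f x + g x) has_derivative (\<lambda>v. frechet_derivative f (at x) v + frechet_derivative g (at x) v)) (at x)"
      if "x \<in> S" for x
      using has_derivative_add[OF Ck_on_SucE[OF Suc.prems(1) that] Ck_on_SucE[OF Suc.prems(2) that]] .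
    show "Ck_on k S (\<lambda>x. frechet_derivative f (at x) v + frechet_derivative g (at x) v)" for v
      using Suc by auto
  qed
qed

lemma Ck_on_bilinear:
  assumes "open S" "bounded_bilinear p" "Ck_on k S f" "Ck_on k S g"
  shows "Ck_on k S (\<lambda>x. p (f x) (g x))"
  using assms(3,4)
proof (induction k arbitrary: f g)
  case 0
  then show ?case using bounded_bilinear.continuous_on[OF assms(2)] by simp
next
  case (Suc k)
  show ?case
  proof (rule Ck_on_SucI[OF \<open>open S\<close>])
    show "((\<lambda>x. p (f x) (g x)) has_derivative (\<lambda>v. p (f x) (frechet_derivative g (at x) v)
        + p (frechet_derivative f (at x) v) (g x))) (at x)"
      if "x \<in> S" for x
      using bounded_bilinear.FDERIV[OF assms(2) Ck_on_SucE[OF Suc.prems(1) that] Ck_on_SucE[OF Suc.prems(2) that]] .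
    show "Ck_on k S (\<lambda>x. p (f x) (frechet_derivative g (at x) v)
        + p (frechet_derivative f (at x) v) (g x))" for v
    proof (rule Ck_on_add[OF \<open>open S\<close>])
      show "Ck_on k S (\<lambda>x. p (f x) (frechet_derivative g (at x) v))"
        using Ck_on_SucD[OF Suc.prems(1)] Suc.prems(2) by (intro Suc.IH) auto
      show "Ck_on k S (\<lambda>x. p (frechet_derivative f (at x) v) (g x))"
        using Ck_on_SucD[OF Suc.prems(2)] Suc.prems(1) by (intro Suc.IH) auto
    qed
  qed
qed

text \<open>The induction is over all \<phi>, since the chain rule replaces \<phi> by
  \<open>deriv \<phi>\<close>, which is again holomorphic on \<open>T\<close>; only \<open>f\<close>
  loses an order of differentiability.\<close>

lemma Ck_on_holomorphic:
  assumes "open S" "open T" "\<phi> holomorphic_on T" "Ck_on k S f" "f ` S \<subseteq> T"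
  shows "Ck_on k S (\<lambda>x. \<phi> (f x))"
  using assms(3,4)
proof (induction k arbitrary: \<phi>)
  case 0
  then show ?case
    using continuous_on_compose2[OF holomorphic_on_imp_continuous_on, of \<phi> T S f] assms(5) by simp
next
  case (Suc k)
  show ?case
  proof (rule Ck_on_SucI[OF \<open>open S\<close>])
    show "((\<lambda>x. \<phi> (f x)) has_derivative (\<lambda>v. deriv \<phi> (f x) * frechet_derivative f (at x) v)) (at x)"
      if "x \<in> S" for x
    proof (rule has_derivative_compose[OF Ck_on_SucE[OF Suc.prems(2) that]])
      show "(\<phi> has_derivative (*) (deriv \<phi> (f x))) (at (f x))"
        using holomorphic_derivI[OF Suc.prems(1) \<open>open T\<close>] assms(5) that
        by (auto simp: has_field_derivative_def)
    qed
    show "Ck_on k S (\<lambda>x. deriv \<phi> (f x) * frechet_derivative f (at x) v)" for v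
    proof (rule Ck_on_bilinear[OF \<open>open S\<close> bounded_bilinear_mult])
      show "Ck_on k S (\<lambda>x. deriv \<phi> (f x))"
        using holomorphic_deriv[OF Suc.prems(1) \<open>open T\<close>] Ck_on_SucD[OF Suc.prems(2)] by (rule Suc.IH)
      show "Ck_on k S (\<lambda>x. frechet_derivative f (at x) v)" using Suc.prems(2) by simp
    qed
  qed
qed

lemma smooth_on_cong: "open S \<Longrightarrow> (\<And>x. x \<in> S \<Longrightarrow> f x = g x) \<Longrightarrow> smooth_on S f \<longleftrightarrow> smooth_on S g"
  unfolding smooth_on_def using Ck_on_cong by blast

lemma smooth_on_subset: "smooth_on S f \<Longrightarrow> T \<subseteq> S \<Longrightarrow> smooth_on T f"
  unfolding smooth_on_def using Ck_on_subset by blast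

lemma smooth_on_linear: "open S \<Longrightarrow> bounded_linear L \<Longrightarrow> smooth_on S f \<Longrightarrow> smooth_on S (\<lambda>x. L (f x))"
  by (simp add: smooth_on_def Ck_on_linear)

lemma smooth_on_add: "open S \<Longrightarrow> smooth_on S f \<Longrightarrow> smooth_on S g \<Longrightarrow> smooth_on S (\<lambda>x. f x + g x)"
  by (simp add: smooth_on_def Ck_on_add)

lemma smooth_on_bilinear:
  "open S \<Longrightarrow> bounded_bilinear p \<Longrightarrow> smooth_on S f \<Longrightarrow> smooth_on S g \<Longrightarrow> smooth_on S (\<lambda>x. p (f x) (g x))"
  by (simp add: smooth_on_def Ck_on_bilinear)

lemma smooth_on_holomorphic:
  "open S \<Longrightarrow> open T \<Longrightarrow> \<phi> holomorphic_on T \<Longrightarrow> smooth_on S f \<Longrightarrow> f ` S \<subseteq> T \<Longrightarrow> smooth_on S (\<lambda>x. \<phi> (f x))"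
  by (simp add: smooth_on_def Ck_on_holomorphic)

lemma smooth_onI:
  assumes "open S" "\<And>x. x \<in> S \<Longrightarrow> (f has_derivative f' x) (at x)" "\<And>v. smooth_on S (\<lambda>x. f' x v)"
  shows "smooth_on S f"
  unfolding smooth_on_def
proof
  fix k
  have "Ck_on k S (\<lambda>x. f' x v)" for v using assms(3) by (simp add: smooth_on_def)
  from Ck_on_SucI[OF assms(1,2) this] show "Ck_on k S f" by (rule Ck_on_SucD)
qed

lemma smooth_on_local:
  assumes "\<And>x. x \<in> S \<Longrightarrow> \<exists>U. open U \<and> x \<in> U \<and> smooth_on U f"
  shows "smooth_on S f"
proof -
  have "Ck_on k S f" if "\<And>x. x \<in> S \<Longrightarrow> \<exists>U. open U \<and> x \<in> U \<and> Ck_on k U f" for k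
    using that
  proof (induction k arbitrary: f)
    case 0
    then show ?case
      by (metis Ck_on.simps(1) continuous_at_imp_continuous_on continuous_on_eq_continuous_at)
  next
    case (Suc k)
    have "f differentiable (at x)" if "x \<in> S" for x
      using Suc.prems[OF that] by auto
    moreover have "Ck_on k S (\<lambda>x. frechet_derivative f (at x) v)" for v
    proof (rule Suc.IH)
      fix x assume "x \<in> S"
      from Suc.prems[OF this] show "\<exists>U. open U \<and> x \<in> U \<and> Ck_on k U (\<lambda>x. frechet_derivative f (at x) v)"
        by auto
    qed
    ultimately show ?case by simp
  qed
  then show ?thesis using assms unfolding smooth_on_def by blast
qed

section \<open>Directional derivatives of smooth maps and symmetry of second derivatives\<close>

lemma smooth_on_has_derivative:
  "smooth_on S F \<Longrightarrow> z \<in> S \<Longrightarrow> (F has_derivative (\<lambda>X. dir F X z)) (at z)"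
  unfolding smooth_on_def dir_def by (rule Ck_on_SucE[of 0]) simp_all

lemma smooth_on_dir: "smooth_on S F \<Longrightarrow> smooth_on S (dir F X)"
  unfolding smooth_on_def dir_def
proof
  fix k assume "\<forall>k. Ck_on k S F"
  then have "Ck_on (Suc k) S F" by blast
  then show "Ck_on k S (\<lambda>z. frechet_derivative F (at z) X)" by simp
qed

lemma smooth_on_continuous: "smooth_on S F \<Longrightarrow> continuous_on S F"
  unfolding smooth_on_def by (drule spec[of _ 0]) simp

lemma dir_eq: "(F has_derivative F') (at z) \<Longrightarrow> dir F X z = F' X"
  unfolding dir_def by (metis frechet_derivative_at)

lemma dir_cong:
  assumes "open S" "z \<in> S" "\<And>x. x \<in> S \<Longrightarrow> f x = g x"
  shows "dir f X z = dir g X z"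
proof -
  have "(f has_derivative h) (at z) \<longleftrightarrow> (g has_derivative h) (at z)" for h
    using has_derivative_transform_within_open[OF _ assms(1,2)] assms(3) by metis
  then show ?thesis unfolding dir_def frechet_derivative_def by simp
qed

text \<open>The second difference \<open>F (z + s X + s Y) - F (z + s X) - F (z + s Y) + F z\<close> is
  \<open>s\<^sup>2\<close> times either of the mixed derivatives, up to \<open>o(s\<^sup>2)\<close>.\<close>

lemma second_difference_limit:
  fixes F :: "complex \<Rightarrow> 'b::real_normed_vector"
  assumes "open S" "z \<in> S" "\<And>w. w \<in> S \<Longrightarrow> (F has_derivative (\<lambda>X. dir F X w)) (at w)"
    and D: "(dir F X has_derivative D) (at z)"
  shows "((\<lambda>s. (F (z + s *\<^sub>R X + s *\<^sub>R Y) - F (z + s *\<^sub>R X) - F (z + s *\<^sub>R Y) + F z) /\<^sub>R s\<^sup>2) \<longlongrightarrow> D Y) (at_right 0)"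
proof (rule tendstoI)
  fix e :: real assume "e > 0"
  \<comment> \<open>\<open>K\<close> bounds the two displacements \<open>t X + s Y\<close> and
    \<open>t X\<close> together, in units of \<open>s\<close>; the summand 1 keeps it positive. The
    factor 1/3 in \<open>e'\<close> leaves room for a strict inequality at the end.\<close>
  define K where "K = 2 * norm X + norm Y + 1"
  have "K > 0" by (simp add: K_def add_nonneg_pos)
  define e' where "e' = e / (3 * K)"
  have "e' > 0" using \<open>e > 0\<close> \<open>K > 0\<close> by (simp add: e'_def)
  obtain d1 where d1: "d1 > 0" "\<And>w. norm (w - z) < d1 \<Longrightarrow> norm (dir F X w - dir F X z - D (w - z)) \<le> e' * norm (w - z)"
    using D \<open>e' > 0\<close> unfolding has_derivative_at_alt by meson
  obtain d2 where d2: "d2 > 0" "ball z d2 \<subseteq> S" using assms(1,2) openE by blast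
  define d where "d = min d1 d2 / K"
  have "d > 0" using d1 d2 \<open>K > 0\<close> by (simp add: d_def)
  interpret D: bounded_linear D using D by (rule has_derivative_bounded_linear)
  have "dist ((F (z + s *\<^sub>R X + s *\<^sub>R Y) - F (z + s *\<^sub>R X) - F (z + s *\<^sub>R Y) + F z) /\<^sub>R s\<^sup>2) (D Y) < e"
    if s: "0 < s" "s < d" for s
  proof -
    have near: "norm (w - z) < min d1 d2" if "norm (w - z) \<le> s * K" for w
      using that s \<open>K > 0\<close> by (simp add: d_def field_simps)
    \<comment> \<open>With the linear term \<open>(t * s) D Y\<close> subtracted, the increment of
      \<phi> from 0 to \<open>s\<close> is the second difference minus \<open>s\<^sup>2 D Y\<close>,
      so the mean value inequality needs only a bound of order \<open>s\<close> on the derivative of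
      \<phi>.\<close>
    define \<phi> where "\<phi> t = F (z + t *\<^sub>R X + s *\<^sub>R Y) - F (z + t *\<^sub>R X) - (t * s) *\<^sub>R D Y" for t
    have b1: "norm (z + t *\<^sub>R X + s *\<^sub>R Y - z) \<le> s * K" "norm (z + t *\<^sub>R X - z) \<le> s * K"
      "norm (t *\<^sub>R X + s *\<^sub>R Y) + norm (t *\<^sub>R X) \<le> s * K" if "t \<in> {0..s}" for t
    proof -
      have 1: "norm (t *\<^sub>R X) \<le> s * norm X" using that by (simp add: mult_right_mono)
      have 2: "norm (t *\<^sub>R X + s *\<^sub>R Y) \<le> norm (t *\<^sub>R X) + s * norm Y"
        using norm_triangle_ineq[of "t *\<^sub>R X" "s *\<^sub>R Y"] s by simp
      have 3: "0 \<le> s * norm X" "0 \<le> s * norm Y" "0 \<le> s" using s by auto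
      have 4: "z + t *\<^sub>R X + s *\<^sub>R Y - z = t *\<^sub>R X + s *\<^sub>R Y" "z + t *\<^sub>R X - z = t *\<^sub>R X" by auto
      have 5: "s * K = 2 * (s * norm X) + s * norm Y + s" by (simp add: K_def algebra_simps)
      show "norm (z + t *\<^sub>R X + s *\<^sub>R Y - z) \<le> s * K" unfolding 4 using 1 2 3 5 by linarith
      show "norm (z + t *\<^sub>R X - z) \<le> s * K" unfolding 4 using 1 2 3 5 by linarith
      show "norm (t *\<^sub>R X + s *\<^sub>R Y) + norm (t *\<^sub>R X) \<le> s * K" using 1 2 3 5 by linarith
    qed
    have inS: "w \<in> S" if "norm (w - z) \<le> s * K" for w
      using near[OF that] d2 by (auto simp: dist_norm norm_minus_commute subset_iff)
    have der: "(\<phi> has_vector_derivative (dir F X (z + t *\<^sub>R X + s *\<^sub>R Y) - dir F X (z + t *\<^sub>R X) - s *\<^sub>R D Y)) (at t within {0..s})"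
      if "t \<in> {0..s}" for t
    proof -
      have "((\<lambda>t. F (z + t *\<^sub>R X + s *\<^sub>R Y)) has_derivative (\<lambda>h. dir F (h *\<^sub>R X) (z + t *\<^sub>R X + s *\<^sub>R Y))) (at t within {0..s})"
        by (rule has_derivative_compose[where f="\<lambda>t. z + t *\<^sub>R X + s *\<^sub>R Y" and g=F, OF _ assms(3)[OF inS[OF b1(1)[OF that]]]])
          (auto intro!: derivative_eq_intros)
      moreover have "((\<lambda>t. F (z + t *\<^sub>R X)) has_derivative (\<lambda>h. dir F (h *\<^sub>R X) (z + t *\<^sub>R X))) (at t within {0..s})"
        by (rule has_derivative_compose[where f="\<lambda>t. z + t *\<^sub>R X" and g=F, OF _ assms(3)[OF inS[OF b1(2)[OF that]]]])
          (auto intro!: derivative_eq_intros)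
      moreover have "dir F (h *\<^sub>R X) w = h *\<^sub>R dir F X w" if "w \<in> S" for h w
        using linear_scale[OF has_derivative_linear[OF assms(3)[OF that]]] .
      moreover have "((\<lambda>t. (t * s) *\<^sub>R D Y) has_derivative (\<lambda>h. (h * s) *\<^sub>R D Y)) (at t within {0..s})"
        by (auto intro!: derivative_eq_intros)
      ultimately have "(\<phi> has_derivative (\<lambda>h. h *\<^sub>R dir F X (z + t *\<^sub>R X + s *\<^sub>R Y) - h *\<^sub>R dir F X (z + t *\<^sub>R X) - (h * s) *\<^sub>R D Y)) (at t within {0..s})"
        unfolding \<phi>_def using inS[OF b1(1)[OF that]] inS[OF b1(2)[OF that]]
        by (auto intro!: has_derivative_diff)
      then show ?thesis by (simp add: has_vector_derivative_def scaleR_diff_right)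
    qed
    have bnd: "norm (dir F X (z + t *\<^sub>R X + s *\<^sub>R Y) - dir F X (z + t *\<^sub>R X) - s *\<^sub>R D Y) \<le> e' * (s * K)"
      if "t \<in> {0..s}" for t
    proof -
      have 1: "norm (dir F X (z + t *\<^sub>R X + s *\<^sub>R Y) - dir F X z - D (t *\<^sub>R X + s *\<^sub>R Y)) \<le> e' * norm (t *\<^sub>R X + s *\<^sub>R Y)"
        using d1(2)[of "z + t *\<^sub>R X + s *\<^sub>R Y"] near[OF b1(1)[OF that]] by (simp add: add.assoc)
      have 2: "norm (dir F X (z + t *\<^sub>R X) - dir F X z - D (t *\<^sub>R X)) \<le> e' * norm (t *\<^sub>R X)"
        using d1(2)[of "z + t *\<^sub>R X"] near[OF b1(2)[OF that]] by simp
      have "dir F X (z + t *\<^sub>R X + s *\<^sub>R Y) - dir F X (z + t *\<^sub>R X) - s *\<^sub>R D Y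
          = (dir F X (z + t *\<^sub>R X + s *\<^sub>R Y) - dir F X z - D (t *\<^sub>R X + s *\<^sub>R Y)) - (dir F X (z + t *\<^sub>R X) - dir F X z - D (t *\<^sub>R X))"
        by (simp add: D.add D.scaleR)
      then have "norm (dir F X (z + t *\<^sub>R X + s *\<^sub>R Y) - dir F X (z + t *\<^sub>R X) - s *\<^sub>R D Y)
          \<le> e' * norm (t *\<^sub>R X + s *\<^sub>R Y) + e' * norm (t *\<^sub>R X)"
        using norm_triangle_ineq4 1 2 by (smt (verit, best))
      also have "\<dots> = e' * (norm (t *\<^sub>R X + s *\<^sub>R Y) + norm (t *\<^sub>R X))" by (simp add: algebra_simps)
      also have "\<dots> \<le> e' * (s * K)" using b1(3)[OF that] \<open>e' > 0\<close> by (intro mult_left_mono) auto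
      finally show ?thesis .
    qed
    have "norm (\<phi> s - \<phi> 0) \<le> e' * (s * K) * norm (s - 0)"
    proof (rule differentiable_bound[of "{0..s}"])
      show "(\<phi> has_derivative (\<lambda>h. h *\<^sub>R (dir F X (z + t *\<^sub>R X + s *\<^sub>R Y) - dir F X (z + t *\<^sub>R X) - s *\<^sub>R D Y))) (at t within {0..s})"
        if "t \<in> {0..s}" for t using der[OF that] by (simp add: has_vector_derivative_def)
      show "onorm (\<lambda>h. h *\<^sub>R (dir F X (z + t *\<^sub>R X + s *\<^sub>R Y) - dir F X (z + t *\<^sub>R X) - s *\<^sub>R D Y)) \<le> e' * (s * K)"
        if "t \<in> {0..s}" for t
      proof -
        have "onorm (\<lambda>h. h *\<^sub>R v) = norm v" for v :: 'b
          using onorm_scaleR_left[OF bounded_linear_ident, of v] onorm_id[where 'a=real]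
          by (simp add: id_def)
        then show ?thesis using bnd[OF that] by presburger
      qed
    qed (use s in auto)
    also have "\<dots> = (e / 3) * s\<^sup>2" using s \<open>K > 0\<close> by (simp add: e'_def power2_eq_square)
    finally have *: "norm (\<phi> s - \<phi> 0) \<le> (e / 3) * s\<^sup>2" .
    have "(F (z + s *\<^sub>R X + s *\<^sub>R Y) - F (z + s *\<^sub>R X) - F (z + s *\<^sub>R Y) + F z) /\<^sub>R s\<^sup>2 - D Y = (\<phi> s - \<phi> 0) /\<^sub>R s\<^sup>2"
    proof -
      have "\<phi> s - \<phi> 0 = (F (z + s *\<^sub>R X + s *\<^sub>R Y) - F (z + s *\<^sub>R X) - F (z + s *\<^sub>R Y) + F z) - s\<^sup>2 *\<^sub>R D Y"
        by (simp add: \<phi>_def power2_eq_square)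
      then show ?thesis using s by (simp add: scaleR_diff_right)
    qed
    then have "dist ((F (z + s *\<^sub>R X + s *\<^sub>R Y) - F (z + s *\<^sub>R X) - F (z + s *\<^sub>R Y) + F z) /\<^sub>R s\<^sup>2) (D Y) = norm (\<phi> s - \<phi> 0) / s\<^sup>2"
      by (simp add: dist_norm divide_inverse)
    also have "\<dots> \<le> e / 3" using * s by (simp add: divide_le_eq)
    finally show ?thesis using \<open>e > 0\<close> by simp
  qed
  then show "\<forall>\<^sub>F s in at_right 0. dist ((F (z + s *\<^sub>R X + s *\<^sub>R Y) - F (z + s *\<^sub>R X) - F (z + s *\<^sub>R Y) + F z) /\<^sub>R s\<^sup>2) (D Y) < e"
    using \<open>d > 0\<close> by (auto simp: eventually_at_right_field)
qed

text \<open>The second difference is symmetric in the two directions, so the limits computed in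
  either order coincide.\<close>

lemma dir_commute:
  assumes "open S" "smooth_on S F" "z \<in> S"
  shows "dir (dir F X) Y z = dir (dir F Y) X z"
proof -
  have D: "(dir F V has_derivative (\<lambda>W. dir (dir F V) W z)) (at z)" for V
    using smooth_on_has_derivative[OF smooth_on_dir[OF assms(2)] assms(3)] .
  note lim = second_difference_limit[OF assms(1,3) smooth_on_has_derivative[OF assms(2)] D]
  have "((\<lambda>s. (F (z + s *\<^sub>R X + s *\<^sub>R Y) - F (z + s *\<^sub>R X) - F (z + s *\<^sub>R Y) + F z) /\<^sub>R s\<^sup>2) \<longlongrightarrow> dir (dir F Y) X z) (at_right 0)"
    using lim[of Y X] by (simp add: algebra_simps)
  from tendsto_unique[OF trivial_limit_at_right_real lim this] show ?thesis .
qed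

section \<open>The bilinear and Hermitian forms\<close>

lemma bil_commute: "bil x y = bil y x"
  by (simp add: bil_def mult.commute)

lemma bil_simps [simp]:
  "bil (x + y) z = bil x z + bil y z" "bil z (x + y) = bil z x + bil z y"
  "bil (x - y) z = bil x z - bil y z" "bil z (x - y) = bil z x - bil z y"
  "bil (c *s x) z = c * bil x z" "bil z (c *s x) = c * bil z x"
  "bil (- x) z = - bil x z" "bil z (- x) = - bil z x"
  "bil 0 z = 0" "bil z 0 = 0"
  by (simp_all add: bil_def algebra_simps)

lemma bil_scaleR [simp]:
  fixes x y :: "('a::real_normed_field)^4"
  shows "bil (r *\<^sub>R x) y = r *\<^sub>R bil x y" "bil x (r *\<^sub>R y) = r *\<^sub>R bil x y"
  by (simp_all add: bil_def algebra_simps)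

lemma vcnj_simps [simp]:
  "vcnj (x + y) = vcnj x + vcnj y" "vcnj (x - y) = vcnj x - vcnj y" "vcnj (- x) = - vcnj x"
  "vcnj (c *s x) = cnj c *s vcnj x" "vcnj (vcnj x) = x" "vcnj 0 = 0" "vcnj (r *\<^sub>R x) = r *\<^sub>R vcnj x"
  by (simp_all add: vcnj_def vec_eq_iff)

lemma bil_vcnj_vcnj [simp]: "bil (vcnj x) (vcnj y) = cnj (bil x y)"
  by (simp add: bil_def vcnj_def)

lemma herm_simps [simp]:
  "herm (x + y) z = herm x z + herm y z" "herm z (x + y) = herm z x + herm z y"
  "herm (x - y) z = herm x z - herm y z" "herm z (x - y) = herm z x - herm z y"
  "herm (c *s x) z = c * herm x z" "herm z (c *s x) = cnj c * herm z x"
  "herm (r *\<^sub>R x) z = r *\<^sub>R herm x z" "herm z (r *\<^sub>R x) = r *\<^sub>R herm z x"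
  "herm (- x) z = - herm x z" "herm z (- x) = - herm z x"
  "herm 0 z = 0" "herm z 0 = 0"
  by (simp_all add: herm_def)

lemma cnj_herm: "cnj (herm x y) = herm y x"
  unfolding herm_def by (metis bil_vcnj_vcnj vcnj_simps(5) bil_commute)

lemma bounded_linear_vcnj: "bounded_linear vcnj"
  by (simp add: linear_conv_bounded_linear[symmetric] linear_iff)

lemma bounded_linear_cvec: "bounded_linear cvec"
  by (simp add: linear_conv_bounded_linear[symmetric] linear_iff cvec_def vec_eq_iff)
     (simp add: scaleR_conv_of_real)

lemma bounded_bilinear_bil:
  "bounded_bilinear (bil :: ('a::{euclidean_space,real_normed_field})^4 \<Rightarrow> 'a^4 \<Rightarrow> 'a)"
  by (simp add: bilinear_conv_bounded_bilinear[symmetric] bilinear_def linear_iff)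

lemma scaleR_vector_smult: "r *\<^sub>R (x :: complex^'n) = complex_of_real r *s x"
  by (simp add: vec_eq_iff scaleR_conv_of_real[where 'a=complex])

lemma bounded_bilinear_vector_smult: "bounded_bilinear ((*s) :: complex \<Rightarrow> complex^4 \<Rightarrow> complex^4)"
  by (simp add: bilinear_conv_bounded_bilinear[symmetric] bilinear_def linear_iff vec_eq_iff algebra_simps)

lemma bounded_linear_vector_smult: "bounded_linear ((*s) c :: complex^4 \<Rightarrow> complex^4)"
  using bounded_bilinear.bounded_linear_right[OF bounded_bilinear_vector_smult] .

lemma cvec_simps [simp]: "vcnj (cvec x) = cvec x" "bil (cvec x) (cvec y) = complex_of_real (bil x y)"
  by (simp_all add: cvec_def vcnj_def bil_def)

text \<open>The matrix with rows \<open>e i\<close> is a left inverse of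
  the one built from \<open>d j\<close>, hence also a right inverse.\<close>

lemma bil_dual_basis:
  fixes e d :: "4 \<Rightarrow> complex^4"
  assumes "\<And>i j. bil (e i) (d j) = (if i = j then 1 else 0)"
  shows "v = (\<Sum>j\<in>UNIV. bil v (d j) *s e j)"
proof -
  define J :: "4 \<Rightarrow> complex" where "J k = (if k = 1 \<or> k = 2 then -1 else 1)" for k
  have bil: "bil x y = (\<Sum>k\<in>UNIV. x $ k * (J k * y $ k))" for x y :: "complex^4"
    by (simp add: bil_def sum_4 J_def)
  define A :: "complex^4^4" where "A = (\<chi> i j. e i $ j)"
  define B :: "complex^4^4" where "B = (\<chi> k j. J k * d j $ k)"
  have "A ** B = mat 1"
    using assms by (simp add: A_def B_def matrix_matrix_mult_def mat_def vec_eq_iff bil)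
  then have "B ** A = mat 1" by (simp add: matrix_left_right_inverse)
  then have "v v* B v* A = v" by (simp add: vector_matrix_mul_assoc)
  moreover have "v v* B = (\<chi> j. bil v (d j))"
    by (simp add: vector_matrix_mult_def B_def bil vec_eq_iff mult.commute)
  ultimately have "v = (\<chi> i. \<Sum>j\<in>UNIV. bil v (d j) * (e j $ i))"
    by (simp add: vector_matrix_mult_def A_def vec_eq_iff mult.commute)
  then show ?thesis by (simp add: vec_eq_iff)
qed

lemma bil_dual_basis4:
  fixes v :: "complex^4"
  assumes "bil e1 d1 = 1" "bil e1 d2 = 0" "bil e1 d3 = 0" "bil e1 d4 = 0"
    "bil e2 d1 = 0" "bil e2 d2 = 1" "bil e2 d3 = 0" "bil e2 d4 = 0"
    "bil e3 d1 = 0" "bil e3 d2 = 0" "bil e3 d3 = 1" "bil e3 d4 = 0"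
    "bil e4 d1 = 0" "bil e4 d2 = 0" "bil e4 d3 = 0" "bil e4 d4 = 1"
  shows "v = bil v d1 *s e1 + bil v d2 *s e2 + bil v d3 *s e3 + bil v d4 *s e4"
proof -
  define e where "e i = (if i = 1 then e1 else if i = 2 then e2 else if i = 3 then e3 else e4)" for i :: 4
  define d where "d i = (if i = 1 then d1 else if i = 2 then d2 else if i = 3 then d3 else d4)" for i :: 4
  have [simp]: "e 1 = e1" "e 2 = e2" "e 3 = e3" "e 4 = e4" "d 1 = d1" "d 2 = d2" "d 3 = d3" "d 4 = d4"
    by (simp_all add: e_def d_def)
  have "\<forall>i j. bil (e i) (d j) = (if i = j then 1 else 0)"
    by (simp add: forall_4 assms)
  then show ?thesis using bil_dual_basis[of e d v] by (simp add: sum_4)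
qed

section \<open>Wirtinger derivatives\<close>

definition wz :: "(complex \<Rightarrow> complex) \<Rightarrow> complex \<Rightarrow> complex" where
  "wz f z = (dir f 1 z - \<i> * dir f \<i> z) / 2"

definition wzbar :: "(complex \<Rightarrow> complex) \<Rightarrow> complex \<Rightarrow> complex" where
  "wzbar f z = (dir f 1 z + \<i> * dir f \<i> z) / 2"

lemma real_linear_complex:
  assumes "linear L"
  shows "L X = Re X *\<^sub>R L 1 + Im X *\<^sub>R L \<i>"
proof -
  have "X = Re X *\<^sub>R 1 + Im X *\<^sub>R \<i>" by (simp add: complex_eq_iff)
  then have "L X = L (Re X *\<^sub>R 1 + Im X *\<^sub>R \<i>)" by simp
  then show ?thesis by (simp only: linear_add[OF assms] linear_scale[OF assms])
qed

lemma dir_wirtinger: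
  assumes "smooth_on S F" "z \<in> S"
  shows "dir F X z = X *s dz F z + cnj X *s dzbar F z"
proof -
  have "dir F X z = Re X *\<^sub>R dir F 1 z + Im X *\<^sub>R dir F \<i> z"
    using real_linear_complex[OF has_derivative_linear[OF smooth_on_has_derivative[OF assms]]] .
  then show ?thesis
    by (simp add: dz_def dzbar_def vec_eq_iff complex_eq_iff field_simps)
qed

lemma dir_wirtinger_scalar:
  assumes "smooth_on S f" "z \<in> S"
  shows "dir f X z = X * wz f z + cnj X * wzbar f z"
proof -
  have "dir f X z = Re X *\<^sub>R dir f 1 z + Im X *\<^sub>R dir f \<i> z"
    using real_linear_complex[OF has_derivative_linear[OF smooth_on_has_derivative[OF assms]]] .
  then show ?thesis
    by (simp add: wz_def wzbar_def complex_eq_iff field_simps)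
qed

lemma has_derivative_wirtinger:
  assumes "smooth_on S F" "z \<in> S"
  shows "(F has_derivative (\<lambda>X. X *s dz F z + cnj X *s dzbar F z)) (at z)"
  using smooth_on_has_derivative[OF assms] by (simp add: dir_wirtinger[OF assms])

lemma has_derivative_wirtinger_scalar:
  assumes "smooth_on S f" "z \<in> S"
  shows "(f has_derivative (\<lambda>X. X * wz f z + cnj X * wzbar f z)) (at z)"
  using smooth_on_has_derivative[OF assms] by (simp add: dir_wirtinger_scalar[OF assms])

text \<open>The coefficients of \<open>X\<close> and \<open>cnj X\<close> in a real-linear map are
  unique; each calculus rule below is read off from a derivative brought into this form.\<close>

lemma wirtinger_eqI:
  assumes "(F has_derivative (\<lambda>X. X *s A + cnj X *s B)) (at z)"
  shows "dz F z = A" "dzbar F z = B"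
  by (simp_all add: dz_def dzbar_def dir_eq[OF assms] vec_eq_iff complex_eq_iff)

lemma wirtinger_scalar_eqI:
  assumes "(f has_derivative (\<lambda>X. X * a + cnj X * b)) (at z)"
  shows "wz f z = a" "wzbar f z = b"
  by (simp_all add: wz_def wzbar_def dir_eq[OF assms] complex_eq_iff)

lemma wirtinger_cong:
  assumes "open S" "z \<in> S" "\<And>w. w \<in> S \<Longrightarrow> F w = G w"
  shows "dz F z = dz G z" "dzbar F z = dzbar G z"
  by (simp_all add: dz_def dzbar_def dir_cong[OF assms])

lemma wirtinger_scalar_cong:
  assumes "open S" "z \<in> S" "\<And>w. w \<in> S \<Longrightarrow> f w = g w"
  shows "wz f z = wz g z" "wzbar f z = wzbar g z"
  by (simp_all add: wz_def wzbar_def dir_cong[OF assms])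

lemma wirtinger_vcnj:
  assumes "smooth_on S F" "z \<in> S"
  shows "dz (\<lambda>w. vcnj (F w)) z = vcnj (dzbar F z)" "dzbar (\<lambda>w. vcnj (F w)) z = vcnj (dz F z)"
proof -
  have "((\<lambda>w. vcnj (F w)) has_derivative (\<lambda>X. X *s vcnj (dzbar F z) + cnj X *s vcnj (dz F z))) (at z)"
    using bounded_linear.has_derivative[OF bounded_linear_vcnj has_derivative_wirtinger[OF assms]]
    by (simp add: add.commute)
  from wirtinger_eqI[OF this] show "dz (\<lambda>w. vcnj (F w)) z = vcnj (dzbar F z)"
    "dzbar (\<lambda>w. vcnj (F w)) z = vcnj (dz F z)" by simp_all
qed

lemma wirtinger_cnj:
  assumes "smooth_on S f" "z \<in> S"
  shows "wz (\<lambda>w. cnj (f w)) z = cnj (wzbar f z)" "wzbar (\<lambda>w. cnj (f w)) z = cnj (wz f z)"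
proof -
  have "((\<lambda>w. cnj (f w)) has_derivative (\<lambda>X. X * cnj (wzbar f z) + cnj X * cnj (wz f z))) (at z)"
    using bounded_linear.has_derivative[OF bounded_linear_cnj has_derivative_wirtinger_scalar[OF assms]]
    by (simp add: add.commute)
  from wirtinger_scalar_eqI[OF this] show "wz (\<lambda>w. cnj (f w)) z = cnj (wzbar f z)"
    "wzbar (\<lambda>w. cnj (f w)) z = cnj (wz f z)" by simp_all
qed

lemma wirtinger_bil:
  assumes "smooth_on S F" "smooth_on S G" "z \<in> S"
  shows "wz (\<lambda>w. bil (F w) (G w)) z = bil (dz F z) (G z) + bil (F z) (dz G z)"
    "wzbar (\<lambda>w. bil (F w) (G w)) z = bil (dzbar F z) (G z) + bil (F z) (dzbar G z)"
proof -
  have "((\<lambda>w. bil (F w) (G w)) has_derivative (\<lambda>X. X * (bil (dz F z) (G z) + bil (F z) (dz G z))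
      + cnj X * (bil (dzbar F z) (G z) + bil (F z) (dzbar G z)))) (at z)"
    using bounded_bilinear.FDERIV[OF bounded_bilinear_bil
        has_derivative_wirtinger[OF assms(1,3)] has_derivative_wirtinger[OF assms(2,3)]]
    by (simp add: algebra_simps)
  from wirtinger_scalar_eqI[OF this]
  show "wz (\<lambda>w. bil (F w) (G w)) z = bil (dz F z) (G z) + bil (F z) (dz G z)"
    "wzbar (\<lambda>w. bil (F w) (G w)) z = bil (dzbar F z) (G z) + bil (F z) (dzbar G z)" by simp_all
qed

lemma wirtinger_smult:
  assumes "smooth_on S f" "smooth_on S G" "z \<in> S"
  shows "dz (\<lambda>w. f w *s G w) z = wz f z *s G z + f z *s dz G z"
    "dzbar (\<lambda>w. f w *s G w) z = wzbar f z *s G z + f z *s dzbar G z"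
proof -
  have "((\<lambda>w. f w *s G w) has_derivative (\<lambda>X. X *s (wz f z *s G z + f z *s dz G z)
      + cnj X *s (wzbar f z *s G z + f z *s dzbar G z))) (at z)"
    by (rule has_derivative_eq_rhs[OF bounded_bilinear.FDERIV[OF bounded_bilinear_vector_smult
        has_derivative_wirtinger_scalar[OF assms(1,3)] has_derivative_wirtinger[OF assms(2,3)]]])
      (simp add: fun_eq_iff vec_eq_iff algebra_simps)
  from wirtinger_eqI[OF this]
  show "dz (\<lambda>w. f w *s G w) z = wz f z *s G z + f z *s dz G z"
    "dzbar (\<lambda>w. f w *s G w) z = wzbar f z *s G z + f z *s dzbar G z" by simp_all
qed

lemma wirtinger_const_smult:
  assumes "smooth_on S G" "z \<in> S"
  shows "dz (\<lambda>w. c *s G w) z = c *s dz G z" "dzbar (\<lambda>w. c *s G w) z = c *s dzbar G z"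
proof -
  have "((\<lambda>w. c *s G w) has_derivative (\<lambda>X. X *s (c *s dz G z) + cnj X *s (c *s dzbar G z))) (at z)"
    by (rule has_derivative_eq_rhs[OF bounded_linear.has_derivative[OF bounded_linear_vector_smult
        has_derivative_wirtinger[OF assms]]])
      (simp add: fun_eq_iff vec_eq_iff algebra_simps)
  from wirtinger_eqI[OF this] show "dz (\<lambda>w. c *s G w) z = c *s dz G z" "dzbar (\<lambda>w. c *s G w) z = c *s dzbar G z"
    by simp_all
qed

lemma wirtinger_add:
  assumes "smooth_on S F" "smooth_on S G" "z \<in> S"
  shows "dz (\<lambda>w. F w + G w) z = dz F z + dz G z" "dzbar (\<lambda>w. F w + G w) z = dzbar F z + dzbar G z"
proof -
  have "((\<lambda>w. F w + G w) has_derivative (\<lambda>X. X *s (dz F z + dz G z) + cnj X *s (dzbar F z + dzbar G z))) (at z)"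
    by (rule has_derivative_eq_rhs[OF has_derivative_add[OF
        has_derivative_wirtinger[OF assms(1,3)] has_derivative_wirtinger[OF assms(2,3)]]])
      (simp add: fun_eq_iff vec_eq_iff algebra_simps)
  from wirtinger_eqI[OF this] show "dz (\<lambda>w. F w + G w) z = dz F z + dz G z"
    "dzbar (\<lambda>w. F w + G w) z = dzbar F z + dzbar G z" by simp_all
qed

lemma wirtinger_const: "wz (\<lambda>_. c) z = 0" "wzbar (\<lambda>_. c) z = 0"
  by (simp_all add: wz_def wzbar_def dir_def)

lemma smooth_on_vcnj: "open S \<Longrightarrow> smooth_on S F \<Longrightarrow> smooth_on S (\<lambda>w. vcnj (F w))"
  by (rule smooth_on_linear[OF _ bounded_linear_vcnj])

lemma smooth_on_cvec: "open S \<Longrightarrow> smooth_on S g \<Longrightarrow> smooth_on S (\<lambda>w. cvec (g w))"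
  by (rule smooth_on_linear[OF _ bounded_linear_cvec])

lemma smooth_on_bil:
  fixes F G :: "complex \<Rightarrow> complex^4"
  shows "open S \<Longrightarrow> smooth_on S F \<Longrightarrow> smooth_on S G \<Longrightarrow> smooth_on S (\<lambda>w. bil (F w) (G w))"
  by (rule smooth_on_bilinear[OF _ bounded_bilinear_bil])

lemma smooth_on_herm:
  fixes F G :: "complex \<Rightarrow> complex^4"
  shows "open S \<Longrightarrow> smooth_on S F \<Longrightarrow> smooth_on S G \<Longrightarrow> smooth_on S (\<lambda>w. herm (F w) (G w))"
  unfolding herm_def by (intro smooth_on_bil smooth_on_vcnj)

lemma smooth_on_smult:
  fixes G :: "complex \<Rightarrow> complex^4"
  shows "open S \<Longrightarrow> smooth_on S f \<Longrightarrow> smooth_on S G \<Longrightarrow> smooth_on S (\<lambda>w. f w *s G w)"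
  by (rule smooth_on_bilinear[OF _ bounded_bilinear_vector_smult])

lemma smooth_on_const_smult:
  fixes G :: "complex \<Rightarrow> complex^4"
  shows "open S \<Longrightarrow> smooth_on S G \<Longrightarrow> smooth_on S (\<lambda>w. c *s G w)"
  by (rule smooth_on_linear[OF _ bounded_linear_vector_smult])

lemma smooth_on_wirtinger:
  assumes "open S" "smooth_on S F"
  shows "smooth_on S (dz F)" "smooth_on S (dzbar F)"
proof -
  have d: "smooth_on S (dir F X)" for X using assms(2) by (rule smooth_on_dir)
  have "smooth_on S (\<lambda>z. (1/2) *s (dir F 1 z + (- \<i>) *s dir F \<i> z))"
    "smooth_on S (\<lambda>z. (1/2) *s (dir F 1 z + \<i> *s dir F \<i> z))"
    by (intro smooth_on_const_smult smooth_on_add assms(1) d)+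
  then show "smooth_on S (dz F)" "smooth_on S (dzbar F)"
    by (simp_all add: dz_def[abs_def] dzbar_def[abs_def])
qed

lemma wirtinger_commute:
  assumes "open S" "smooth_on S F" "z \<in> S"
  shows "dz (dzbar F) z = dzbar (dz F) z"
proof -
  have d: "smooth_on S (dir F X)" for X using assms(2) by (rule smooth_on_dir)
  have d': "smooth_on S (\<lambda>w. c *s dir F X w)" for c X by (intro smooth_on_const_smult assms(1) d)
  have dd: "smooth_on S (\<lambda>w. dir F 1 w + c *s dir F \<i> w)" for c by (intro smooth_on_add assms(1) d d')
  note w = wirtinger_const_smult[OF dd assms(3)] wirtinger_add[OF d d' assms(3)] wirtinger_const_smult[OF d assms(3)]
  have 1: "dz F = (\<lambda>z. (1/2) *s (dir F 1 z + (- \<i>) *s dir F \<i> z))"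
    "dzbar F = (\<lambda>z. (1/2) *s (dir F 1 z + \<i> *s dir F \<i> z))"
    by (simp_all add: dz_def[abs_def] dzbar_def[abs_def])
  show ?thesis
    unfolding 1 w unfolding dz_def dzbar_def
    by (simp add: dir_commute[OF assms, of \<i> 1] vec_eq_iff algebra_simps)
qed

lemma dir_laplacian:
  assumes "open S" "smooth_on S F" "z \<in> S"
  shows "dir (dir F 1) 1 z + dir (dir F \<i>) \<i> z = 4 *s dz (dzbar F) z"
proof -
  have dirs: "smooth_on S (dir F X)" for X using assms(2) by (rule smooth_on_dir)
  note sm = smooth_on_wirtinger[OF assms(1,2)]
  have sm': "smooth_on S (\<lambda>w. c *s dz F w)" "smooth_on S (\<lambda>w. c *s dzbar F w)" for c
    by (intro smooth_on_const_smult assms(1) sm)+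
  have "dir (dir F X) X z = X *s (X *s dz (dz F) z + cnj X *s dz (dzbar F) z)
      + cnj X *s (X *s dzbar (dz F) z + cnj X *s dzbar (dzbar F) z)" for X
  proof -
    have "dz (dir F X) z = dz (\<lambda>w. X *s dz F w + cnj X *s dzbar F w) z"
      "dzbar (dir F X) z = dzbar (\<lambda>w. X *s dz F w + cnj X *s dzbar F w) z"
      by (rule wirtinger_cong[OF assms(1,3)]; simp add: dir_wirtinger[OF assms(2)])+
    then show ?thesis
      by (simp add: dir_wirtinger[OF dirs assms(3)] wirtinger_add[OF sm' assms(3)]
          wirtinger_const_smult[OF sm(1) assms(3)] wirtinger_const_smult[OF sm(2) assms(3)])
  qed
  then show ?thesis
    by (simp add: wirtinger_commute[OF assms] vec_eq_iff algebra_simps)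
qed

section \<open>Differentiation of Hermitian and of constant products\<close>

lemma wirtinger_herm:
  assumes "open S" "smooth_on S F" "smooth_on S G" "z \<in> S"
  shows "wz (\<lambda>w. herm (F w) (G w)) z = herm (dz F z) (G z) + herm (F z) (dzbar G z)"
    "wzbar (\<lambda>w. herm (F w) (G w)) z = herm (dzbar F z) (G z) + herm (F z) (dz G z)"
  unfolding herm_def
  by (simp_all add: wirtinger_bil[OF assms(2) smooth_on_vcnj[OF assms(1,3)] assms(4)] wirtinger_vcnj[OF assms(3,4)])

text \<open>Differentiating a constant product moves the derivative to the other factor with a sign.
  Applied to the orthogonality relations of a frame, this yields the components of the derivatives
  of the frame.\<close>

lemma wirtinger_bil_const:
  assumes "open S" "smooth_on S F" "smooth_on S G" "z \<in> S" "\<And>w. w \<in> S \<Longrightarrow> bil (F w) (G w) = c"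
  shows "bil (dz F z) (G z) = - bil (F z) (dz G z)" "bil (dzbar F z) (G z) = - bil (F z) (dzbar G z)"
  using wirtinger_bil[OF assms(2-4)] wirtinger_scalar_cong[OF assms(1,4,5)]
  by (simp_all add: wirtinger_const eq_neg_iff_add_eq_0)

text \<open>The conjugation in the second slot of \<open>herm\<close> exchanges \<open>dz\<close>
  and \<open>dzbar\<close>, so a derivative changes type when it is moved.\<close>

lemma wirtinger_herm_const:
  assumes "open S" "smooth_on S F" "smooth_on S G" "z \<in> S" "\<And>w. w \<in> S \<Longrightarrow> herm (F w) (G w) = c"
  shows "herm (dz F z) (G z) = - herm (F z) (dzbar G z)" "herm (dzbar F z) (G z) = - herm (F z) (dz G z)"
  using wirtinger_herm[OF assms(1-4)] wirtinger_scalar_cong[OF assms(1,4,5)]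
  by (simp_all add: wirtinger_const eq_neg_iff_add_eq_0)

section \<open>Primitives of closed real one-forms\<close>

text \<open>A real one-form is \<open>v \<mapsto> Re (W z * v)\<close>; it is closed iff \<open>wzbar W\<close> is real.\<close>

lemma closed_form_primitive_convex:
  fixes W P :: "complex \<Rightarrow> complex" and R :: "complex \<Rightarrow> real"
  assumes "open S" "convex S" "0 \<in> S"
    and W: "\<And>z. z \<in> S \<Longrightarrow> (W has_derivative (\<lambda>v. P z * v + of_real (R z) * cnj v)) (at z)"
    and P: "continuous_on S P" and R: "continuous_on S R"
  shows "\<exists>\<theta>. \<forall>z\<in>S. (\<theta> has_derivative (\<lambda>v. Re (W z * v))) (at z)"
proof -
  \<comment> \<open>\<open>E z t\<close> is the \<open>t\<close>-derivative of
    \<open>t W (t z)\<close>, so its integral over [0,1] is \<open>W z\<close>. The primitive is the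
    line integral of the form along the segment from 0 to \<open>z\<close>, whose integrand is
    \<open>f z t\<close> below.\<close>
  define E where "E z t = of_real t * (P (of_real t * z) * z + of_real (R (of_real t * z)) * cnj z) + W (of_real t * z)"
    for z t
  have inS: "of_real t * z \<in> S" if "z \<in> S" "t \<in> {0..1}" for z and t :: real
    using convexD_alt[OF assms(2,3) that(1), of t] that(2) by (simp add: scaleR_conv_of_real)
  have contW: "continuous_on S W"
    using W by (meson continuous_at_imp_continuous_on has_derivative_continuous)
  have comp: "continuous_on (S \<times> {0..1}) (\<lambda>x. h (of_real (snd x) * fst x))"
    if "continuous_on S h" for h :: "complex \<Rightarrow> 'c::topological_space"
    by (rule continuous_on_compose2[OF that]) (auto intro!: continuous_intros inS)
  have contE: "continuous_on (S \<times> {0..1}) (\<lambda>x. E (fst x) (snd x))"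
    unfolding E_def by (intro continuous_intros comp contW P R)
  define f where "f z t = Re (W (of_real t * z) * z)" for z t
  have derW: "((\<lambda>t. of_real t * W (of_real t * z)) has_vector_derivative E z t) (at t within {0..1})"
    if "z \<in> S" "t \<in> {0..1}" for z t
  proof -
    have "((\<lambda>t. W (of_real t * z)) has_derivative (\<lambda>h. P (of_real t * z) * (of_real h * z)
        + of_real (R (of_real t * z)) * cnj (of_real h * z))) (at t within {0..1})"
      by (rule has_derivative_compose[where g=W and f="\<lambda>t. of_real t * z", OF _ W[OF inS[OF that]]])
        (auto intro!: derivative_eq_intros)
    from has_derivative_mult[OF bounded_linear.has_derivative[OF bounded_linear_of_real has_derivative_ident] this]
    show ?thesis
      unfolding has_vector_derivative_def
      by (rule has_derivative_eq_rhs) (simp add: fun_eq_iff E_def scaleR_conv_of_real algebra_simps)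
  qed
  \<comment> \<open>This is where closedness enters: since \<open>R\<close> is real,
    \<open>Re (R * cnj h * z) = Re (R * cnj z * h)\<close>, and the \<open>z\<close>-derivative of
    the integrand in the direction \<open>h\<close> becomes \<open>Re (E z t * h)\<close>.\<close>
  have derf: "((\<lambda>z. f z t) has_derivative blinfun_apply (blinfun_inner_left (cnj (E z t)))) (at z within S)"
    if "z \<in> S" "t \<in> cbox 0 1" for z t
  proof -
    have t: "t \<in> {0..1}" using that by simp
    have "((\<lambda>z. W (of_real t * z)) has_derivative (\<lambda>h. P (of_real t * z) * (of_real t * h)
        + of_real (R (of_real t * z)) * cnj (of_real t * h))) (at z within S)"
      by (rule has_derivative_compose[where g=W and f="\<lambda>z. of_real t * z", OF _ W[OF inS[OF that(1) t]]])
        (auto intro!: derivative_eq_intros)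
    from bounded_linear.has_derivative[OF bounded_linear_Re has_derivative_mult[OF this has_derivative_ident]]
    show ?thesis
      unfolding f_def
      by (rule has_derivative_eq_rhs) (simp add: fun_eq_iff E_def inner_complex_def algebra_simps)
  qed
  have int_f: "f z integrable_on cbox 0 1" if "z \<in> S" for z
    unfolding f_def
    by (intro integrable_continuous continuous_intros continuous_on_compose2[OF contW]) (use that in \<open>auto intro: inS\<close>)
  have cont: "continuous_on (S \<times> cbox 0 1) (\<lambda>(z, t). blinfun_inner_left (cnj (E z t)))"
    using contE unfolding split_beta by (auto intro!: continuous_intros)
  have "((\<lambda>z. integral (cbox 0 1) (f z)) has_derivative (\<lambda>v. Re (W z * v))) (at z)" if "z \<in> S" for z
  proof -
    have "continuous_on (cbox 0 1) (\<lambda>t. (z, t))" by (intro continuous_intros)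
    from continuous_on_compose2[OF contE this] that have Ez: "continuous_on (cbox 0 1) (\<lambda>t. E z t)" by auto
    then have "continuous_on (cbox 0 1) (\<lambda>t. blinfun_inner_left (cnj (E z t)))"
      by (auto intro!: continuous_intros)
    then have integ: "(\<lambda>t. blinfun_inner_left (cnj (E z t))) integrable_on cbox 0 1" by (rule integrable_continuous)
    have "blinfun_apply (integral (cbox 0 1) (\<lambda>t. blinfun_inner_left (cnj (E z t)))) v = Re (W z * v)" for v
    proof -
      have "(E z has_integral (of_real 1 * W (of_real 1 * z) - of_real 0 * W (of_real 0 * z))) {0..1}"
        by (rule fundamental_theorem_of_calculus) (use derW[OF that] in auto)
      then have "(E z has_integral W z) {0..1}" by simp
      from has_integral_linear[OF this bounded_linear_compose[OF bounded_linear_Re bounded_linear_mult_left[of v]]]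
      have "((\<lambda>t. Re (E z t * v)) has_integral Re (W z * v)) {0..1}" by (simp add: o_def)
      moreover have "blinfun_apply (blinfun_inner_left (cnj (E z t))) v = Re (E z t * v)" for t
        by (simp add: inner_complex_def)
      ultimately show ?thesis
        using blinfun_apply_integral[OF integ, of v] by (simp add: integral_unique)
    qed
    then have "blinfun_apply (integral (cbox 0 1) (\<lambda>t. blinfun_inner_left (cnj (E z t)))) = (\<lambda>v. Re (W z * v))"
      by blast
    with leibniz_rule[OF derf int_f cont that assms(2)] show ?thesis
      using at_within_open[OF that assms(1)] by simp
  qed
  then show ?thesis by blast
qed

text \<open>The Riemann mapping theorem reduces the claim to the disc or the plane, which are
  convex. Pulling back by the holomorphic \<open>g\<close> turns \<open>W\<close> into
  \<open>W (g z) * g' z\<close> and the real coefficient \<open>R\<close> into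
  \<open>R (g z)\<close> times the squared modulus of \<open>g' z\<close>, so closedness is
  preserved.\<close>

lemma closed_form_primitive:
  fixes W P :: "complex \<Rightarrow> complex" and R :: "complex \<Rightarrow> real"
  assumes "open D" "simply_connected D"
    and W: "\<And>z. z \<in> D \<Longrightarrow> (W has_derivative (\<lambda>v. P z * v + of_real (R z) * cnj v)) (at z)"
    and P: "continuous_on D P" and R: "continuous_on D R"
  shows "\<exists>\<theta>. \<forall>z\<in>D. (\<theta> has_derivative (\<lambda>v. Re (W z * v))) (at z)"
proof -
  consider "D = {}" | "D = UNIV"
    | f g where "f holomorphic_on D" "g holomorphic_on ball 0 1"
      "\<And>z. z \<in> D \<Longrightarrow> f z \<in> ball 0 1 \<and> g (f z) = z" "\<And>z. z \<in> ball 0 1 \<Longrightarrow> g z \<in> D \<and> f (g z) = z"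
    using Riemann_mapping_theorem[of D] assms(1,2) by blast
  then show ?thesis
  proof cases
    case 1
    then show ?thesis by simp
  next
    case 2
    then show ?thesis using closed_form_primitive_convex[of UNIV W P R] W P R by simp
  next
    case 3
    define B where "B = ball (0::complex) 1"
    define g' where "g' = deriv g"
    have g: "(g has_derivative (*) (g' z)) (at z)" if "z \<in> B" for z
      using holomorphic_derivI[OF 3(2)] that by (auto simp: has_field_derivative_def B_def g'_def)
    have g'hol: "g' holomorphic_on B" unfolding g'_def B_def using 3(2) by (auto intro: holomorphic_deriv)
    have g': "(g' has_derivative (*) (deriv g' z)) (at z)" if "z \<in> B" for z
      using holomorphic_derivI[OF g'hol] that by (auto simp: has_field_derivative_def B_def)
    have gD: "g z \<in> D" if "z \<in> B" for z using 3(4) that by (simp add: B_def)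
    have cg: "continuous_on B g" "continuous_on B g'" "continuous_on B (deriv g')"
      using 3(2) g'hol holomorphic_deriv[OF g'hol]
      by (auto intro!: holomorphic_on_imp_continuous_on simp: B_def)
    have contW: "continuous_on D W"
      using W by (meson continuous_at_imp_continuous_on has_derivative_continuous)
    have comp: "continuous_on B (\<lambda>z. h (g z))" if "continuous_on D h" for h :: "complex \<Rightarrow> 'c::topological_space"
      by (rule continuous_on_compose2[OF that cg(1)]) (auto intro: gD)
    have norm_sq: "(complex_of_real (cmod c))\<^sup>2 = c * cnj c" for c
      by (metis complex_norm_square of_real_power)
    have "\<exists>\<theta>. \<forall>z\<in>B. (\<theta> has_derivative (\<lambda>v. Re (W (g z) * g' z * v))) (at z)"
    proof (rule closed_form_primitive_convex)
      show "((\<lambda>z. W (g z) * g' z) has_derivative (\<lambda>v. (P (g z) * (g' z)\<^sup>2 + W (g z) * deriv g' z) * v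
          + of_real (R (g z) * (cmod (g' z))\<^sup>2) * cnj v)) (at z)" if "z \<in> B" for z
        by (rule has_derivative_eq_rhs[OF has_derivative_mult[OF
              has_derivative_compose[OF g[OF that] W[OF gD[OF that]]] g'[OF that]]])
          (simp add: fun_eq_iff norm_sq, simp add: power2_eq_square algebra_simps)
      show "continuous_on B (\<lambda>z. P (g z) * (g' z)\<^sup>2 + W (g z) * deriv g' z)"
        by (intro continuous_intros comp contW P cg)
      show "continuous_on B (\<lambda>z. R (g z) * (cmod (g' z))\<^sup>2)"
        by (intro continuous_intros comp R cg)
    qed (simp_all add: B_def)
    then obtain \<theta> where \<theta>: "\<And>z. z \<in> B \<Longrightarrow> (\<theta> has_derivative (\<lambda>v. Re (W (g z) * g' z * v))) (at z)" by blast
    have "((\<lambda>z. \<theta> (f z)) has_derivative (\<lambda>v. Re (W z * v))) (at z)" if "z \<in> D" for z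
    proof -
      have fz: "f z \<in> B" "g (f z) = z" using 3(3) that by (auto simp: B_def)
      have f: "(f has_derivative (*) (deriv f z)) (at z)"
        using holomorphic_derivI[OF 3(1) assms(1) that] by (simp add: has_field_derivative_def)
      have "((\<lambda>z. g (f z)) has_derivative (\<lambda>v. g' (f z) * (deriv f z * v))) (at z)"
        using has_derivative_compose[OF f g[OF fz(1)]] .
      moreover have "((\<lambda>z. g (f z)) has_derivative (\<lambda>v. v)) (at z)"
        by (rule has_derivative_transform_within_open[OF has_derivative_ident assms(1) that]) (use 3(3) in auto)
      ultimately have "(\<lambda>v. g' (f z) * (deriv f z * v)) = (\<lambda>v. v)" by (rule has_derivative_unique)
      from fun_cong[OF this, of 1] have 1: "g' (f z) * deriv f z = 1" by simp
      show ?thesis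
        by (rule has_derivative_eq_rhs[OF has_derivative_compose[OF f \<theta>[OF fz(1)]]])
          (simp add: fun_eq_iff fz 1 mult.assoc[symmetric] mult.assoc[of _ "g' (f z)"])
    qed
    then show ?thesis by blast
  qed
qed

section \<open>Horizontal lifts of surfaces in the quadric\<close>

lemma dir_smult:
  fixes G :: "complex \<Rightarrow> complex^4"
  assumes "smooth_on S f" "smooth_on S G" "z \<in> S"
  shows "dir (\<lambda>w. f w *s G w) X z = dir f X z *s G z + f z *s dir G X z"
  using dir_eq[OF bounded_bilinear.FDERIV[OF bounded_bilinear_vector_smult
      smooth_on_has_derivative[OF assms(1,3)] smooth_on_has_derivative[OF assms(2,3)]]]
  by (simp add: add.commute)

lemma normal_part_simps [simp]:
  "normal_part F (v + w) z = normal_part F v z + normal_part F w z"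
  "normal_part F (r *\<^sub>R v) z = r *\<^sub>R normal_part F v z"
  by (simp_all add: normal_part_def algebra_simps add_divide_distrib)

lemma proj_quadric_simps [simp]:
  "proj_quadric p (v + w) = proj_quadric p v + proj_quadric p w"
  "proj_quadric p (r *\<^sub>R v) = r *\<^sub>R proj_quadric p v"
  "proj_quadric p (a *s v) = a *s proj_quadric p v"
  by (simp_all add: proj_quadric_def vec_eq_iff algebra_simps)

lemma hor_unitary:
  assumes "c * cnj c = 1"
  shows "hor (c *s p) v = hor p v" "proj_quadric (c *s p) v = proj_quadric p v"
proof -
  have "cnj c * c = 1" using assms by (simp add: mult.commute)
  then have [simp]: "cnj c * (c * x) = x" "c * (cnj c * x) = x" for x
    using assms by (simp_all flip: mult.assoc)
  show "hor (c *s p) v = hor p v" "proj_quadric (c *s p) v = proj_quadric p v"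
    by (simp_all add: hor_def proj_quadric_def vec_eq_iff algebra_simps)
qed

section \<open>Metric, Kaehler form and mean curvature along a horizontal lift\<close>

locale horizontal_quadric_map =
  fixes S :: "complex set" and F :: "complex \<Rightarrow> complex^4"
  assumes open_S: "open S" and smooth: "smooth_on S F"
    and norm: "z \<in> S \<Longrightarrow> herm (F z) (F z) = -1"
    and isotropic: "z \<in> S \<Longrightarrow> bil (F z) (F z) = 0"
    and horizontal: "z \<in> S \<Longrightarrow> herm (dz F z) (F z) = 0" "z \<in> S \<Longrightarrow> herm (dzbar F z) (F z) = 0"
begin

lemmas smooth_dz = smooth_on_wirtinger(1)[OF open_S smooth]
lemmas smooth_dzbar = smooth_on_wirtinger(2)[OF open_S smooth]
lemmas dir_F = dir_wirtinger[OF smooth]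

lemma bil_F:
  assumes "z \<in> S"
  shows "bil (dz F z) (F z) = 0" "bil (dzbar F z) (F z) = 0"
  using wirtinger_bil_const[OF open_S smooth smooth assms isotropic]
  by (simp_all add: bil_commute eq_neg_iff_add_eq_0 flip: mult_2)

lemma herm_dir: "z \<in> S \<Longrightarrow> herm (dir F X z) (F z) = 0"
  by (simp add: dir_F horizontal)

lemma herm_dir_vcnj: "z \<in> S \<Longrightarrow> herm (dir F X z) (vcnj (F z)) = 0"
  by (simp add: dir_F herm_def bil_F)

lemma tangent_F: "z \<in> S \<Longrightarrow> tangent F X z = dir F X z"
  by (simp add: tangent_def hor_def herm_dir)

lemma ind_metric_F:
  assumes "z \<in> S"
  shows "ind_metric F X Y z = Re (X * cnj Y * herm (dz F z) (dz F z) + X * Y * herm (dz F z) (dzbar F z)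
    + cnj X * cnj Y * herm (dzbar F z) (dz F z) + cnj X * Y * herm (dzbar F z) (dzbar F z))"
  unfolding ind_metric_def tangent_F[OF assms] dir_F[OF assms]
  by (simp add: algebra_simps)

lemma kaehler_pullback_F:
  assumes "z \<in> S"
  shows "kaehler_pullback F X Y z = Re (\<i> * (X * cnj Y * herm (dz F z) (dz F z) + X * Y * herm (dz F z) (dzbar F z)
    + cnj X * cnj Y * herm (dzbar F z) (dz F z) + cnj X * Y * herm (dzbar F z) (dzbar F z)))"
  unfolding kaehler_pullback_def tangent_F[OF assms] dir_F[OF assms]
  by (simp add: algebra_simps)

lemma cnj_herm_self: "herm v v = complex_of_real (Re (herm v v))"
  using cnj_herm[of v v] by (simp add: complex_eq_iff)

text \<open>The sum of the squares of \<open>dz F\<close> and \<open>dzbar F\<close> is the trace of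
  the metric, their difference is the Kaehler form, and their mutual product is the trace-free part
  of the metric. So the Lagrangian and the conformal condition together say that this pair is
  orthogonal with equal squares.\<close>

lemma lagrangian_conformalI:
  assumes "z \<in> S" "herm (dz F z) (dz F z) = of_real r" "herm (dzbar F z) (dzbar F z) = of_real r"
    "herm (dz F z) (dzbar F z) = 0"
  shows "ind_metric F X Y z = 2 * r * (X \<bullet> Y)" "kaehler_pullback F X Y z = 0"
proof -
  have "herm (dzbar F z) (dz F z) = 0" using assms(4) cnj_herm[of "dz F z" "dzbar F z"] by simp
  then show "ind_metric F X Y z = 2 * r * (X \<bullet> Y)" "kaehler_pullback F X Y z = 0"
    unfolding ind_metric_F[OF assms(1)] kaehler_pullback_F[OF assms(1)] assms
    by (simp_all add: inner_complex_def algebra_simps)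
qed

lemma lagrangian_conformalD:
  assumes "z \<in> S" "\<And>X Y. ind_metric F X Y z = 2 * r * (X \<bullet> Y)" "kaehler_pullback F 1 \<i> z = 0"
  shows "herm (dz F z) (dz F z) = of_real r" "herm (dzbar F z) (dzbar F z) = of_real r"
    "herm (dz F z) (dzbar F z) = 0"
proof -
  define p q c where "p = Re (herm (dz F z) (dz F z))" and "q = Re (herm (dzbar F z) (dzbar F z))"
    and "c = herm (dz F z) (dzbar F z)"
  have p: "herm (dz F z) (dz F z) = of_real p" and q: "herm (dzbar F z) (dzbar F z) = of_real q"
    using cnj_herm_self by (simp_all add: p_def q_def)
  have c: "herm (dzbar F z) (dz F z) = cnj c" by (simp add: c_def cnj_herm)
  have k: "kaehler_pullback F 1 \<i> z = p - q"
    unfolding kaehler_pullback_F[OF assms(1)] p q c c_def[symmetric] by simp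
  have i: "ind_metric F 1 1 z = p + q + 2 * Re c" "ind_metric F \<i> \<i> z = p + q - 2 * Re c"
    "ind_metric F 1 \<i> z = - 2 * Im c"
    unfolding ind_metric_F[OF assms(1)] p q c c_def[symmetric] by simp_all
  have "p = r" "q = r" "Re c = 0" "Im c = 0"
    using k i assms(3) assms(2)[of 1 1] assms(2)[of \<i> \<i>] assms(2)[of 1 \<i>] by auto
  then show "herm (dz F z) (dz F z) = of_real r" "herm (dzbar F z) (dzbar F z) = of_real r"
    "herm (dz F z) (dzbar F z) = 0"
    using p q c_def by (simp_all add: complex_eq_iff)
qed

text \<open>Obtained by differentiating horizontality and tangency to the quadric. These are the two
  components of the Laplacian that \<open>proj_quadric\<close> removes.\<close>

lemma herm_dz_dzbar:
  assumes "z \<in> S"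
  shows "herm (dz (dzbar F) z) (F z) = - herm (dz F z) (dz F z)"
    "herm (dz (dzbar F) z) (vcnj (F z)) = - beta F z"
  using wirtinger_herm_const(2)[OF open_S smooth_dz smooth assms horizontal(1)]
    wirtinger_bil_const(2)[OF open_S smooth_dz smooth assms bil_F(1)]
  by (simp_all add: wirtinger_commute[OF open_S smooth assms] herm_def beta_def)

lemma proj_quadric_dz_dzbar:
  assumes "z \<in> S"
  shows "proj_quadric (F z) (dz (dzbar F) z) =
    dz (dzbar F) z - herm (dz F z) (dz F z) *s F z - beta F z *s vcnj (F z)"
  by (simp add: proj_quadric_def herm_dz_dzbar[OF assms] vec_eq_iff)

lemma second_ff_F:
  assumes "z \<in> S"
  shows "second_ff F X X z = normal_part F (proj_quadric (F z) (dir (dir F X) X z)) z"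
  using dir_cong[OF open_S assms tangent_F] by (simp add: second_ff_def cov_deriv_def herm_dir[OF assms])

text \<open>The two frame directions have the same length, so only the sum of the second derivatives
  matters, and this is \<open>4 dz dzbar\<close>; the factors 1/2 and 1/\<rho> leave
  2/\<rho>.\<close>

lemma mean_curvature_F:
  assumes "z \<in> S" "ind_metric F 1 1 z = \<rho>" "ind_metric F \<i> \<i> z = \<rho>"
  shows "mean_curvature_vector F z = (2 / \<rho>) *\<^sub>R normal_part F (proj_quadric (F z) (dz (dzbar F) z)) z"
proof -
  have "mean_curvature_vector F z = (1 / (2 * \<rho>)) *\<^sub>R normal_part F
      (proj_quadric (F z) (dir (dir F 1) 1 z + dir (dir F \<i>) \<i> z)) z"
    using assms(2,3) by (simp add: mean_curvature_vector_def second_ff_F[OF assms(1)] algebra_simps complex_eq_iff)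
  also have "dir (dir F 1) 1 z + dir (dir F \<i>) \<i> z = 4 *\<^sub>R dz (dzbar F) z"
    by (simp add: dir_laplacian[OF open_S smooth assms(1)] scaleR_vector_smult)
  finally show ?thesis by simp
qed

text \<open>Differentiating the assumed orthogonality relates the two tangential products by
  \<open>s = - cnj t\<close>; against a real tangent vector they contribute
  \<open>Re (cnj X * t + X * s)\<close>, which then cancels. Hence minimality is the vanishing of
  the whole projected Laplacian, not just of its normal part.\<close>

lemma herm_proj_laplacian:
  assumes "z \<in> S" "\<And>w. w \<in> S \<Longrightarrow> herm (dz F w) (dzbar F w) = 0"
  shows "Re (herm (proj_quadric (F z) (dz (dzbar F) z)) (dir F X z)) = 0"
proof -
  define s t where "s = herm (dz (dzbar F) z) (dzbar F z)" and "t = herm (dz (dzbar F) z) (dz F z)"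
  have "s = - cnj t"
    using wirtinger_herm_const(2)[OF open_S smooth_dz smooth_dzbar assms]
    by (simp add: s_def t_def cnj_herm wirtinger_commute[OF open_S smooth assms(1)])
  moreover have "herm (F z) (dz F z) = 0" "herm (F z) (dzbar F z) = 0"
    using horizontal[OF assms(1)] cnj_herm by (metis complex_cnj_zero)+
  moreover have "herm (vcnj (F z)) (dz F z) = 0" "herm (vcnj (F z)) (dzbar F z) = 0"
    using bil_F[OF assms(1)] by (simp_all add: herm_def bil_commute)
  ultimately show ?thesis
    by (simp add: proj_quadric_dz_dzbar[OF assms(1)] dir_F[OF assms(1)] flip: s_def t_def)
qed

lemma normal_part_laplacian:
  assumes "z \<in> S" "\<And>w. w \<in> S \<Longrightarrow> herm (dz F w) (dzbar F w) = 0"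
  shows "normal_part F (proj_quadric (F z) (dz (dzbar F) z)) z = proj_quadric (F z) (dz (dzbar F) z)"
  by (simp add: normal_part_def tangent_F[OF assms(1)] herm_proj_laplacian[OF assms])

end

text \<open>A local lift differs from a horizontal one by a unitary factor \<open>c\<close>. Its derivative enters the covariant
  derivative only through terms that cancel.\<close>

lemma (in horizontal_quadric_map) local_lift_factor:
  assumes "local_lift S f U G" "\<And>z. z \<in> S \<Longrightarrow> f z = cline (F z)"
  obtains c where "smooth_on U c" "\<And>z. z \<in> U \<Longrightarrow> c z * cnj (c z) = 1" "\<And>z. z \<in> U \<Longrightarrow> G z = c z *s F z"
proof -
  have U: "open U" "U \<subseteq> S" "smooth_on U G" and G: "\<And>z. z \<in> U \<Longrightarrow> herm (G z) (G z) = -1 \<and> cline (G z) = cline (F z)"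
    using assms(1) assms(2)[symmetric] by (auto simp: local_lift_def dest: subsetD)
  \<comment> \<open>The coefficient of \<open>G z\<close> along \<open>F z\<close>; the sign
    compensates \<open>herm (F z) (F z) = -1\<close>. Writing it as a product shows its
    smoothness.\<close>
  define c where "c z = (-1) * herm (G z) (F z)" for z
  have eq: "G z = c z *s F z" "c z * cnj (c z) = 1" if "z \<in> U" for z
  proof -
    have "G z \<in> cline (F z)"
    proof -
      have "G z = 1 *s G z" by simp
      then have "G z \<in> cline (G z)" unfolding cline_def by blast
      with G[OF that] show ?thesis by simp
    qed
    then obtain a where a: "G z = a *s F z" by (auto simp: cline_def)
    have n: "herm (F z) (F z) = -1" using norm U(2) that by blast
    have "c z = a" by (simp add: c_def a n)
    then show "G z = c z *s F z" by (simp add: a)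
    show "c z * cnj (c z) = 1" using G[OF that] n by (simp add: a \<open>c z = a\<close> mult.commute)
  qed
  have "smooth_on U c" unfolding c_def
    using U by (intro smooth_on_linear[OF U(1) bounded_linear_mult_right] smooth_on_herm)
      (auto intro: smooth_on_subset[OF smooth])
  then show ?thesis using that eq by blast
qed

text \<open>Tangent vectors and the mean curvature vector are multiplied by the unitary factor, and
  real products do not see it; thus statements about all local lifts can be checked on
  \<open>F\<close> alone.\<close>

lemma (in horizontal_quadric_map) local_lift_invariance:
  assumes "local_lift S f U G" "\<And>z. z \<in> S \<Longrightarrow> f z = cline (F z)" "z \<in> U"
  obtains c where "c \<noteq> 0" "\<And>X. tangent G X z = c *s tangent F X z"
    "\<And>X Y. ind_metric G X Y z = ind_metric F X Y z"
    "\<And>X Y. kaehler_pullback G X Y z = kaehler_pullback F X Y z"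
    "mean_curvature_vector G z = c *s mean_curvature_vector F z"
proof -
  have U: "open U" "U \<subseteq> S" using assms(1) by (auto simp: local_lift_def)
  obtain c where c: "smooth_on U c" "\<And>z. z \<in> U \<Longrightarrow> c z * cnj (c z) = 1" "\<And>z. z \<in> U \<Longrightarrow> G z = c z *s F z"
    using local_lift_factor[OF assms(1,2)] by blast
  have zS: "z \<in> S" using U assms(3) by blast
  have smU: "smooth_on U F" using smooth_on_subset[OF smooth U(2)] .
  have dirG: "dir G X w = dir c X w *s F w + c w *s dir F X w" if "w \<in> U" for X w
    using dir_smult[OF c(1) smU that] dir_cong[OF U(1) that c(3)] by simp
  have tan: "tangent G X w = c w *s dir F X w" if "w \<in> U" for X w
  proof -
    have "w \<in> S" using that U by blast
    then show ?thesis
      by (simp add: tangent_def c(3)[OF that] hor_unitary[OF c(2)[OF that]] dirG[OF that])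
        (simp add: hor_def herm_dir norm vec_eq_iff)
  qed
  have "c z * cnj (c z) = 1" "cnj (c z) * c z = 1"
    using c(2)[OF assms(3)] by (simp_all add: mult.commute)
  then have [simp]: "cnj (c z) * (c z * x) = x" "c z * (cnj (c z) * x) = x" for x
    by (simp_all flip: mult.assoc)
  have herm_tan: "herm (tangent G X z) (c z *s v) = herm (tangent F X z) v"
    "herm (c z *s v) (tangent G X z) = herm v (tangent F X z)" for X v
    by (simp_all add: tan[OF assms(3)] tangent_F[OF zS])
  have tanz: "tangent G X z = c z *s tangent F X z" for X by (simp add: tan[OF assms(3)] tangent_F[OF zS])
  have ind: "ind_metric G X Y z = ind_metric F X Y z" for X Y
    by (simp add: ind_metric_def tanz)
  have kae: "kaehler_pullback G X Y z = kaehler_pullback F X Y z" for X Y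
  proof -
    have "herm (\<i> *s (c z *s v)) (c z *s w) = (c z * cnj (c z)) * herm (\<i> *s v) w" for v w
      by (simp only: herm_simps mult_ac)
    then show ?thesis by (simp add: kaehler_pullback_def tanz \<open>c z * cnj (c z) = 1\<close> del: herm_simps)
  qed
  have cov: "cov_deriv G X (tangent G X) z = c z *s cov_deriv F X (tangent F X) z" for X
  proof -
    have proj: "proj_quadric (F z) (dir F X z) = dir F X z"
      by (simp add: proj_quadric_def herm_dir[OF zS] herm_dir_vcnj[OF zS])
    have 1: "dir (tangent G X) X z = dir c X z *s dir F X z + c z *s dir (dir F X) X z"
      using dir_smult[OF c(1) smooth_on_dir[OF smU] assms(3)] dir_cong[OF U(1) assms(3) tan] by simp
    have 2: "dir (tangent F X) X z = dir (dir F X) X z"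
      using dir_cong[OF open_S zS tangent_F] .
    \<comment> \<open>Multiplied by \<open>tangent G X z\<close>, which is \<open>c\<close> times
      the derivative of \<open>F\<close>, this is exactly the negative of the term with
      \<open>dir c X z\<close> in equation 1.\<close>
    have 3: "herm (dir G X z) (G z) = - (dir c X z * cnj (c z))"
      by (simp add: dirG[OF assms(3)] c(3)[OF assms(3)] herm_dir[OF zS] norm[OF zS])
    show ?thesis unfolding cov_deriv_def 1 2 3
      by (simp add: c(3)[OF assms(3)] hor_unitary[OF c(2)[OF assms(3)]] proj herm_dir[OF zS] tan[OF assms(3)] vec_eq_iff \<open>cnj (c z) * c z = 1\<close>)
  qed
  have nrm: "normal_part G (c z *s v) z = c z *s normal_part F v z" for v
    by (simp add: normal_part_def herm_tan ind tanz scaleR_vector_smult vec_eq_iff algebra_simps)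
  have "mean_curvature_vector G z = c z *s mean_curvature_vector F z"
    by (simp add: mean_curvature_vector_def second_ff_def cov nrm ind scaleR_vector_smult vec_eq_iff algebra_simps)
  moreover have "c z \<noteq> 0" using c(2)[OF assms(3)] by auto
  ultimately show ?thesis using that[of "c z"] tanz ind kae by blast
qed

text \<open>All conditions are verified for \<open>F\<close> and carried to an arbitrary local lift
  by the invariance; positivity of \<open>r\<close> makes the map an immersion.\<close>

lemma (in horizontal_quadric_map) minimal_lagrangianI:
  assumes f: "\<And>z. z \<in> S \<Longrightarrow> f z = cline (F z)" "f ` S \<subseteq> Q"
    and r: "\<And>z. z \<in> S \<Longrightarrow> r z > 0"
    and conf: "\<And>z. z \<in> S \<Longrightarrow> herm (dz F z) (dz F z) = of_real (r z)"
      "\<And>z. z \<in> S \<Longrightarrow> herm (dzbar F z) (dzbar F z) = of_real (r z)"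
      "\<And>z. z \<in> S \<Longrightarrow> herm (dz F z) (dzbar F z) = 0"
    and lap: "\<And>z. z \<in> S \<Longrightarrow> proj_quadric (F z) (dz (dzbar F) z) = 0"
  shows "minimal_lagrangian S Q f" "has_metric S f (\<lambda>z. 2 * r z)"
proof -
  have lift: "local_lift S f S F"
    using f(1) norm open_S smooth by (simp add: local_lift_def)
  have U: "U \<subseteq> S" if "local_lift S f U G" for U G using that by (simp add: local_lift_def)
  have "has_metric S f (\<lambda>z. 2 * r z)"
    unfolding has_metric_def
  proof (intro allI impI ballI)
    fix U G z X Y assume *: "local_lift S f U G" "z \<in> U"
    show "ind_metric G X Y z = 2 * r z * (X \<bullet> Y)"
    proof (rule local_lift_invariance[OF *(1) f(1) *(2)])
      assume "\<And>X Y. ind_metric G X Y z = ind_metric F X Y z"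
      then show ?thesis using lagrangian_conformalI(1)[OF _ conf] U[OF *(1)] *(2) by auto
    qed
  qed
  moreover have "minimal_lagrangian S Q f"
    unfolding minimal_lagrangian_def
  proof (intro conjI allI impI ballI)
    show "smooth_map S f" unfolding smooth_map_def using lift by blast
    show "f ` S \<subseteq> Q" by fact
    fix U G z assume *: "local_lift S f U G" "z \<in> U"
    then have z: "z \<in> S" using U by blast
    note ind = lagrangian_conformalI(1)[OF z conf[OF z]]
    note kae = lagrangian_conformalI(2)[OF z conf[OF z]]
    obtain c where c: "c \<noteq> 0" "\<And>X. tangent G X z = c *s tangent F X z"
      "\<And>X Y. ind_metric G X Y z = ind_metric F X Y z"
      "\<And>X Y. kaehler_pullback G X Y z = kaehler_pullback F X Y z"
      "mean_curvature_vector G z = c *s mean_curvature_vector F z"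
      using local_lift_invariance[OF *(1) f(1) *(2)] by blast
    show "ind_metric G 1 1 z = ind_metric G \<i> \<i> z" "ind_metric G 1 \<i> z = 0"
      by (simp_all add: c(3) ind inner_complex_def)
    show "kaehler_pullback G X Y z = 0" for X Y by (simp add: c(4) kae)
    have "mean_curvature_vector F z = 0"
      using mean_curvature_F[OF z refl] ind[of 1 1] ind[of \<i> \<i>] lap[OF z]
      by (simp add: normal_part_def)
    then show "mean_curvature_vector G z = 0" by (simp add: c(5))
    fix X :: complex assume "X \<noteq> 0"
    have "ind_metric G X X z \<noteq> 0" using r[OF z] \<open>X \<noteq> 0\<close> by (simp add: c(3) ind)
    then show "tangent G X z \<noteq> 0" by (auto simp: ind_metric_def)
  qed
  ultimately show "minimal_lagrangian S Q f" "has_metric S f (\<lambda>z. 2 * r z)" by blast+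
qed

section \<open>Topology of projective space and the components of the quadric\<close>

lemma topspace_CP3_top: "topspace CP3_top = CP3"
proof -
  have "cline z \<in> CP3" if "z \<noteq> 0" for z using that by (auto simp: CP3_def)
  then have "{z. z \<noteq> 0 \<and> cline z \<in> CP3} = - {0}" by auto
  then have "openin CP3_top CP3" by (simp add: openin_CP3_top open_Compl)
  then show ?thesis
    by (metis openin_CP3_top openin_subset openin_topspace subset_antisym)
qed

lemma quadric_dualI:
  assumes "herm p p = -1" "bil p p = 0"
  shows "cline p \<in> quadric_dual"
  using assms unfolding quadric_dual_def CH31_def by auto

text \<open>In the quotient topology a map with a continuous lift is continuous, so the image is
  connected and lies in the component of any one of its points.\<close>

lemma image_in_component:
  assumes "open D" "connected D" "D \<noteq> {}" "continuous_on D F"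
    "\<And>z. z \<in> D \<Longrightarrow> herm (F z) (F z) = -1" "\<And>z. z \<in> D \<Longrightarrow> bil (F z) (F z) = 0"
    "\<And>z. z \<in> D \<Longrightarrow> f z = cline (F z)"
  shows "\<exists>Q \<in> Q2star_components. f ` D \<subseteq> Q"
proof -
  have nz: "F z \<noteq> 0" if "z \<in> D" for z using assms(5)[OF that] by auto
  have fq: "f z \<in> quadric_dual" if "z \<in> D" for z using quadric_dualI assms(5-7) that by metis
  have "continuous_map (top_of_set D) CP3_top f"
    unfolding continuous_map topspace_CP3_top
  proof (intro conjI allI impI)
    show "f ` topspace (top_of_set D) \<subseteq> CP3" using assms(7) nz by (auto simp: CP3_def)
    fix U assume "openin CP3_top U"
    then have "open {z. z \<noteq> 0 \<and> cline z \<in> U}" by (simp add: openin_CP3_top)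
    from continuous_openin_preimage_gen[OF assms(4) this]
    have "openin (top_of_set D) (D \<inter> F -` {z. z \<noteq> 0 \<and> cline z \<in> U})" .
    also have "D \<inter> F -` {z. z \<noteq> 0 \<and> cline z \<in> U} = {x \<in> topspace (top_of_set D). f x \<in> U}"
      using assms(7) nz by auto
    finally show "openin (top_of_set D) {x \<in> topspace (top_of_set D). f x \<in> U}" .
  qed
  then have "continuous_map (top_of_set D) (subtopology CP3_top quadric_dual) f"
    using fq by (auto simp: continuous_map_in_subtopology)
  then have "connectedin (subtopology CP3_top quadric_dual) (f ` D)"
    using assms(2) by (intro connectedin_continuous_map_image[of "top_of_set D"]) (simp_all add: connectedin_subtopology)
  moreover obtain z where "z \<in> D" using assms(3) by blast
  then have "f z \<in> topspace (subtopology CP3_top quadric_dual)"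
    using fq nz assms(7) by (auto simp: topspace_CP3_top CP3_def)
  then obtain C where "C \<in> Q2star_components" "f z \<in> C"
    unfolding Q2star_components_def Union_connected_components_of[symmetric] by blast
  moreover have "\<not> disjnt C (f ` D)" using \<open>f z \<in> C\<close> \<open>z \<in> D\<close> by (auto simp: disjnt_def)
  ultimately show ?thesis
    unfolding Q2star_components_def by (meson connected_components_of_maximal)
qed

section \<open>From maximal surfaces to minimal Lagrangian surfaces\<close>

lemma dir_cvec:
  assumes "smooth_on S g" "z \<in> S"
  shows "dir (\<lambda>w. cvec (g w)) X z = cvec (dir g X z)"
  using dir_eq[OF bounded_linear.has_derivative[OF bounded_linear_cvec smooth_on_has_derivative[OF assms]]] .

lemma vcnj_wirtinger_cvec:
  assumes "open S" "smooth_on S g" "z \<in> S"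
  shows "vcnj (dz (\<lambda>w. cvec (g w)) z) = dzbar (\<lambda>w. cvec (g w)) z"
    "vcnj (dzbar (\<lambda>w. cvec (g w)) z) = dz (\<lambda>w. cvec (g w)) z"
  using wirtinger_vcnj[OF smooth_on_cvec[OF assms(1,2)] assms(3)] by simp_all

lemma bil_dir_cvec:
  assumes "open S" "smooth_on S g" "z \<in> S"
  defines "P \<equiv> dz (\<lambda>w. cvec (g w)) z" and "P' \<equiv> dzbar (\<lambda>w. cvec (g w)) z"
  shows "complex_of_real (bil (dir g X z) (dir g Y z)) =
    X * Y * bil P P + (X * cnj Y + cnj X * Y) * bil P P' + cnj X * cnj Y * bil P' P'"
proof -
  have "complex_of_real (bil (dir g X z) (dir g Y z)) = bil (dir (\<lambda>w. cvec (g w)) X z) (dir (\<lambda>w. cvec (g w)) Y z)"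
    by (simp add: dir_cvec[OF assms(2,3)])
  then show ?thesis
    unfolding dir_wirtinger[OF smooth_on_cvec[OF assms(1,2)] assms(3)] P_def P'_def
    by (simp add: algebra_simps bil_commute)
qed

lemma laplacian_cvec:
  assumes "open S" "smooth_on S g" "z \<in> S"
  shows "4 *s dz (dzbar (\<lambda>w. cvec (g w))) z = cvec (dir (dir g 1) 1 z + dir (dir g \<i>) \<i> z)"
proof -
  have "dir (dir (\<lambda>w. cvec (g w)) X) X z = cvec (dir (dir g X) X z)" for X
  proof -
    have "dir (dir (\<lambda>w. cvec (g w)) X) X z = dir (\<lambda>w. cvec (dir g X w)) X z"
      by (rule dir_cong[OF assms(1,3)]) (rule dir_cvec[OF assms(2)])
    then show ?thesis by (simp add: dir_cvec[OF smooth_on_dir[OF assms(2)] assms(3)])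
  qed
  then show ?thesis
    using dir_laplacian[OF assms(1) smooth_on_cvec[OF assms(1,2)] assms(3)]
    by (simp add: linear_add[OF bounded_linear.linear[OF bounded_linear_cvec]])
qed

lemma bil_sqrt_half:
  "bil (complex_of_real (1 / sqrt 2) *s v) (complex_of_real (1 / sqrt 2) *s w) = bil v w / 2"
  "vcnj (complex_of_real (1 / sqrt 2) *s v) = complex_of_real (1 / sqrt 2) *s vcnj v"
proof -
  have "(1 / sqrt 2) * (1 / sqrt 2) = 1 / (2::real)" by simp
  then have *: "complex_of_real (1 / sqrt 2) * complex_of_real (1 / sqrt 2) = 1 / 2"
    unfolding of_real_mult[symmetric] by simp
  have "bil (c *s v) (c *s w) = (c * c) * bil v w" for c by simp
  from this[of "complex_of_real (1 / sqrt 2)"]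
  show "bil (complex_of_real (1 / sqrt 2) *s v) (complex_of_real (1 / sqrt 2) *s w) = bil v w / 2"
    unfolding * by simp
qed (simp only: vcnj_simps complex_cnj_complex_of_real)

section \<open>The moving frame of a maximal surface\<close>

locale AdS_maximal =
  fixes D :: "complex set" and g N :: "complex \<Rightarrow> real^4" and E :: "complex \<Rightarrow> real"
  assumes open_D: "open D" and maximal: "maximal_surface D g N"
    and E: "z \<in> D \<Longrightarrow> E z > 0" and metric: "AdS_has_metric D g (\<lambda>z. 2 * E z)"
begin

definition p :: "complex \<Rightarrow> complex^4" where "p = (\<lambda>w. cvec (g w))"
definition n :: "complex \<Rightarrow> complex^4" where "n = (\<lambda>w. cvec (N w))"

abbreviation Q :: "complex \<Rightarrow> complex" where "Q \<equiv> hopf g N"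

lemma smooth_g: "smooth_on D g" and smooth_N: "smooth_on D N"
  using maximal by (auto simp: maximal_surface_def unit_normal_def)

lemma smooth_p: "smooth_on D p" and smooth_n: "smooth_on D n"
  unfolding p_def n_def using smooth_g smooth_N open_D by (auto intro: smooth_on_cvec)

lemmas smooth_pz = smooth_on_wirtinger[OF open_D smooth_p]
lemmas smooth_nz = smooth_on_wirtinger[OF open_D smooth_n]
lemmas vcnj_p = vcnj_wirtinger_cvec[OF open_D smooth_g, folded p_def]
lemmas vcnj_n = vcnj_wirtinger_cvec[OF open_D smooth_N, folded n_def]
lemmas commute_p = wirtinger_commute[OF open_D smooth_p]
lemmas commute_n = wirtinger_commute[OF open_D smooth_n]

lemma bil_pn:
  assumes "z \<in> D"
  shows "bil (p z) (p z) = -1" "bil (p z) (n z) = 0" "bil (n z) (p z) = 0" "bil (n z) (n z) = -1"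
  using maximal assms
  by (auto simp: maximal_surface_def unit_normal_def AdS_def AdS_tangent_def p_def n_def image_subset_iff
      bil_commute[of "N z" "g z"])

lemma bil_pz_n:
  assumes "z \<in> D"
  shows "bil (dz p z) (n z) = 0" "bil (dzbar p z) (n z) = 0"
proof -
  have "bil (dir p X z) (n z) = 0" for X
    using maximal assms by (simp add: p_def n_def dir_cvec[OF smooth_g] maximal_surface_def unit_normal_def)
  then show "bil (dz p z) (n z) = 0" "bil (dzbar p z) (n z) = 0"
    by (simp_all add: dz_def dzbar_def)
qed

lemma bil_pz_pz:
  assumes "z \<in> D"
  shows "bil (dz p z) (dz p z) = 0" "bil (dzbar p z) (dzbar p z) = 0"
    "bil (dz p z) (dzbar p z) = of_real (E z)" "bil (dzbar p z) (dz p z) = of_real (E z)"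
proof -
  define A B where "A = bil (dz p z) (dz p z)" and "B = bil (dz p z) (dzbar p z)"
  have A': "bil (dzbar p z) (dzbar p z) = cnj A"
    unfolding A_def bil_vcnj_vcnj[symmetric] vcnj_p[OF assms] ..
  have *: "complex_of_real (2 * E z * (X \<bullet> Y)) = X * Y * A + (X * cnj Y + cnj X * Y) * B + cnj X * cnj Y * cnj A" for X Y
    using bil_dir_cvec[OF open_D smooth_g assms, folded p_def, of X Y] metric assms
    by (simp add: AdS_has_metric_def A' flip: A_def B_def)
  have "A = 0" "B = of_real (E z)"
    using *[of 1 1] *[of \<i> \<i>] *[of 1 \<i>] by (auto simp: complex_eq_iff inner_complex_def)
  then show "bil (dz p z) (dz p z) = 0" "bil (dzbar p z) (dzbar p z) = 0"
    "bil (dz p z) (dzbar p z) = of_real (E z)" "bil (dzbar p z) (dz p z) = of_real (E z)"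
    using A' by (simp_all add: A_def B_def bil_commute)
qed

lemma bil_pz_p:
  assumes "z \<in> D"
  shows "bil (dz p z) (p z) = 0" "bil (dzbar p z) (p z) = 0" "bil (p z) (dz p z) = 0" "bil (p z) (dzbar p z) = 0"
  using wirtinger_bil_const[OF open_D smooth_p smooth_p assms bil_pn(1)]
  by (simp_all add: bil_commute eq_neg_iff_add_eq_0 flip: mult_2)

lemma bil_pzz_n:
  assumes "z \<in> D"
  shows "bil (dz (dzbar p) z) (n z) = 0"
proof -
  have "AdS_mean_curvature g N z = 0"
    using maximal assms by (simp add: maximal_surface_def)
  then have "(\<Sum>X\<in>{1, \<i>}. bil (dir (dir g X) X z) (N z) / bil (dir g X z) (dir g X z)) = 0"
    by (simp add: AdS_mean_curvature_def)
  moreover have "bil (dir g X z) (dir g X z) = 2 * E z * (X \<bullet> X)" for X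
    using metric assms by (simp add: AdS_has_metric_def)
  ultimately have "bil (dir (dir g 1) 1 z) (N z) / (2 * E z) + bil (dir (dir g \<i>) \<i> z) (N z) / (2 * E z) = 0"
    by (simp add: complex_eq_iff inner_complex_def)
  then have "bil (dir (dir g 1) 1 z + dir (dir g \<i>) \<i> z) (N z) = 0"
    using E[OF assms] by (simp add: add_divide_distrib[symmetric])
  moreover have "4 * bil (dz (dzbar p) z) (n z) = bil (4 *s dz (dzbar p) z) (n z)" by simp
  ultimately show ?thesis
    unfolding p_def laplacian_cvec[OF open_D smooth_g assms] by (simp add: n_def del: bil_simps)
qed

lemma frame_expansion:
  assumes "z \<in> D"
  shows "v = - bil v (p z) *s p z - bil v (n z) *s n z
    + (bil v (dzbar p z) / E z) *s dz p z + (bil v (dz p z) / E z) *s dzbar p z"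
proof -
  have E0: "E z \<noteq> 0" using E[OF assms] by simp
  have "v = bil v (- p z) *s p z + bil v (- n z) *s n z
      + bil v ((1 / E z) *s dzbar p z) *s dz p z + bil v ((1 / E z) *s dz p z) *s dzbar p z"
    by (rule bil_dual_basis4)
      (simp_all add: bil_pn[OF assms] bil_pz_n[OF assms] bil_pz_pz[OF assms] bil_pz_p[OF assms] E0
        bil_commute[of "n z" "dz p z"] bil_commute[of "n z" "dzbar p z"])
  then show ?thesis by (simp add: mult.commute divide_inverse)
qed

lemma hopf_eq: "hopf g N z = bil (dz (dz p) z) (n z)"
  by (simp add: hopf_def p_def n_def)

text \<open>The Weingarten equations. Pairing with \<open>p\<close> and \<open>n\<close> gives 0
  since both stay unit and orthogonal, and pairing with \<open>dzbar p\<close> gives 0 by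
  maximality, so only the Hopf coefficient survives.\<close>

lemma nz:
  assumes "z \<in> D"
  shows "dz n z = - (Q z / E z) *s dzbar p z" "dzbar n z = - (cnj (Q z) / E z) *s dz p z"
proof -
  note 1 = wirtinger_bil_const(1)[OF open_D smooth_n smooth_p assms bil_pn(3)]
  note 2 = wirtinger_bil_const(1)[OF open_D smooth_n smooth_n assms bil_pn(4)]
  note 3 = wirtinger_bil_const(1)[OF open_D smooth_pz(1) smooth_n assms bil_pz_n(1)]
  note 4 = wirtinger_bil_const(1)[OF open_D smooth_pz(2) smooth_n assms bil_pz_n(2)]
  have "bil (dz n z) (p z) = 0" using 1 bil_pz_n[OF assms] by (simp add: bil_commute)
  moreover have "bil (dz n z) (n z) = 0" using 2 by (simp add: bil_commute eq_neg_iff_add_eq_0 flip: mult_2)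
  moreover have "bil (dz n z) (dz p z) = - Q z" using 3 by (simp add: bil_commute hopf_eq)
  moreover have "bil (dz n z) (dzbar p z) = 0" using 4 bil_pzz_n[OF assms] by (simp add: bil_commute)
  ultimately show *: "dz n z = - (Q z / E z) *s dzbar p z"
    using frame_expansion[OF assms, of "dz n z"] by simp
  have "dzbar n z = vcnj (dz n z)" by (simp add: vcnj_n[OF assms])
  then show "dzbar n z = - (cnj (Q z) / E z) *s dz p z" unfolding * by (simp add: vcnj_p[OF assms])
qed

lemma bil_nz:
  assumes "z \<in> D"
  shows "bil (dz n z) (dz p z) = - Q z" "bil (dz p z) (dz n z) = - Q z"
    "bil (dzbar n z) (dzbar p z) = - cnj (Q z)" "bil (dzbar p z) (dzbar n z) = - cnj (Q z)"
    "bil (dz n z) (dzbar p z) = 0" "bil (dzbar p z) (dz n z) = 0"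
    "bil (dzbar n z) (dz p z) = 0" "bil (dz p z) (dzbar n z) = 0"
    "bil (dz n z) (p z) = 0" "bil (dzbar n z) (p z) = 0" "bil (dz n z) (n z) = 0" "bil (dzbar n z) (n z) = 0"
    "bil (dz n z) (dz n z) = 0" "bil (dzbar n z) (dzbar n z) = 0"
    "bil (dz n z) (dzbar n z) = of_real ((cmod (Q z))\<^sup>2 / E z)"
    "bil (dzbar n z) (dz n z) = of_real ((cmod (Q z))\<^sup>2 / E z)"
  using E[OF assms]
  by (simp_all add: nz[OF assms] bil_pz_pz[OF assms] bil_pz_p[OF assms] bil_pz_n[OF assms]
      complex_norm_square mult.commute del: of_real_power)

text \<open>Differentiating the two conformality relations kills the tangential components and
  maximality kills the normal one; what remains is the part forced by
  \<open>bil p p = -1\<close>.\<close>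

lemma pzz:
  assumes "z \<in> D"
  shows "dz (dzbar p) z = of_real (E z) *s p z"
proof -
  note 1 = wirtinger_bil_const(1)[OF open_D smooth_pz(2) smooth_p assms bil_pz_p(2)]
  note 2 = wirtinger_bil_const(1)[OF open_D smooth_pz(2) smooth_pz(2) assms bil_pz_pz(2)]
  note 3 = wirtinger_bil_const(2)[OF open_D smooth_pz(1) smooth_pz(1) assms bil_pz_pz(1)]
  have "bil (dz (dzbar p) z) (dzbar p z) = 0" using 2 by (simp add: bil_commute eq_neg_iff_add_eq_0 flip: mult_2)
  moreover have "bil (dz (dzbar p) z) (dz p z) = 0"
    using 3 by (simp add: bil_commute commute_p[OF assms] eq_neg_iff_add_eq_0 flip: mult_2)
  ultimately show ?thesis
    using frame_expansion[OF assms, of "dz (dzbar p) z"] 1 by (simp add: bil_pzz_n[OF assms] bil_pz_pz[OF assms])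
qed

text \<open>The tangential components come from differentiating the vanishing products of
  derivatives of \<open>n\<close> and \<open>p\<close> that are left by the Weingarten equations. In
  this way the Hopf coefficient itself is never differentiated and its holomorphy does not have to
  be proved first.\<close>

lemma nzz:
  assumes "z \<in> D"
  shows "dz (dzbar n) z = of_real ((cmod (Q z))\<^sup>2 / E z) *s n z"
proof -
  note 1 = wirtinger_bil_const(1)[OF open_D smooth_nz(2) smooth_p assms bil_nz(10)]
  note 2 = wirtinger_bil_const(1)[OF open_D smooth_nz(2) smooth_n assms bil_nz(12)]
  note 3 = wirtinger_bil_const(1)[OF open_D smooth_nz(2) smooth_pz(1) assms bil_nz(7)]
  note 4 = wirtinger_bil_const(2)[OF open_D smooth_nz(1) smooth_pz(2) assms bil_nz(5)]
  note 5 = wirtinger_bil_const(1)[OF open_D smooth_pz(1) smooth_pz(1) assms bil_pz_pz(1)]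
  note 6 = wirtinger_bil_const(2)[OF open_D smooth_pz(2) smooth_pz(2) assms bil_pz_pz(2)]
  have pp: "bil (dz p z) (dz (dz p) z) = 0" "bil (dzbar p z) (dzbar (dzbar p) z) = 0"
    using 5 6 by (simp_all add: bil_commute eq_neg_iff_add_eq_0 flip: mult_2)
  have "bil (dz (dzbar n) z) (dz p z) = 0" using 3 pp by (simp add: nz[OF assms])
  moreover have "bil (dz (dzbar n) z) (dzbar p z) = 0"
    using 4 pp by (simp add: nz[OF assms] commute_n[OF assms])
  moreover have "bil (dz (dzbar n) z) (p z) = 0" using 1 by (simp add: bil_nz[OF assms])
  moreover have "bil (dz (dzbar n) z) (n z) = - of_real ((cmod (Q z))\<^sup>2 / E z)" using 2 by (simp add: bil_nz[OF assms])
  ultimately show ?thesis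
    using frame_expansion[OF assms, of "dz (dzbar n) z"] by simp
qed

section \<open>The horizontal lift built from a maximal surface and its normal\<close>

definition lift :: "complex \<Rightarrow> complex^4" where
  "lift = (\<lambda>z. complex_of_real (1 / sqrt 2) *s (p z + \<i> *s n z))"

lemma smooth_in: "smooth_on D (\<lambda>z. \<i> *s n z)"
  by (intro smooth_on_const_smult open_D smooth_n)

lemma smooth_sum: "smooth_on D (\<lambda>z. p z + \<i> *s n z)"
  by (intro smooth_on_add smooth_in smooth_p open_D)

lemma smooth_lift: "smooth_on D lift"
  unfolding lift_def by (intro smooth_on_const_smult smooth_sum open_D)

lemma wirtinger_lift:
  assumes "z \<in> D"
  shows "dz lift z = complex_of_real (1 / sqrt 2) *s (dz p z + \<i> *s dz n z)"
    "dzbar lift z = complex_of_real (1 / sqrt 2) *s (dzbar p z + \<i> *s dzbar n z)"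
  by (simp_all only: lift_def wirtinger_const_smult[OF smooth_sum assms] wirtinger_add[OF smooth_p smooth_in assms]
      wirtinger_const_smult[OF smooth_n assms])

lemma laplacian_lift:
  assumes "z \<in> D"
  shows "dz (dzbar lift) z = complex_of_real (1 / sqrt 2) *s (dz (dzbar p) z + \<i> *s dz (dzbar n) z)"
proof -
  have sm: "smooth_on D (\<lambda>z. \<i> *s dzbar n z)"
    by (intro smooth_on_const_smult open_D smooth_nz)
  have sm': "smooth_on D (\<lambda>z. dzbar p z + \<i> *s dzbar n z)"
    by (intro smooth_on_add smooth_pz sm open_D)
  have "dz (dzbar lift) z = dz (\<lambda>z. complex_of_real (1 / sqrt 2) *s (dzbar p z + \<i> *s dzbar n z)) z"
    by (rule wirtinger_cong[OF open_D assms]) (rule wirtinger_lift)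
  then show ?thesis
    by (simp only: wirtinger_const_smult[OF sm' assms] wirtinger_add[OF smooth_pz(2) sm assms]
      wirtinger_const_smult[OF smooth_nz(2) assms])
qed

lemma vcnj_pn: "vcnj (p z) = p z" "vcnj (n z) = n z"
  by (simp_all add: p_def n_def)

lemma horizontal_lift_map: "horizontal_quadric_map D lift"
proof (unfold_locales, fact open_D, fact smooth_lift)
  fix z assume z: "z \<in> D"
  show "herm (lift z) (lift z) = -1" "bil (lift z) (lift z) = 0"
    unfolding lift_def herm_def bil_sqrt_half by (simp_all add: vcnj_pn bil_pn[OF z])
  show "herm (dz lift z) (lift z) = 0" "herm (dzbar lift z) (lift z) = 0"
    unfolding wirtinger_lift[OF z] unfolding lift_def herm_def bil_sqrt_half
    by (simp_all add: vcnj_pn bil_pz_p[OF z] bil_pz_n[OF z] bil_nz[OF z])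
qed

lemma conformal_lift:
  assumes "z \<in> D"
  shows "herm (dz lift z) (dz lift z) = of_real ((E z + (cmod (Q z))\<^sup>2 / E z) / 2)"
    "herm (dzbar lift z) (dzbar lift z) = of_real ((E z + (cmod (Q z))\<^sup>2 / E z) / 2)"
    "herm (dz lift z) (dzbar lift z) = 0"
    "alpha lift z = - \<i> * Q z"
  unfolding alpha_def wirtinger_lift[OF assms] herm_def bil_sqrt_half
  by (simp_all add: vcnj_p[OF assms] vcnj_n[OF assms] bil_pz_pz[OF assms] bil_nz[OF assms] algebra_simps)

text \<open>The Laplacian of the lift is a combination of \<open>p\<close> and \<open>n\<close>,
  which span the same complex plane as the lift and its conjugate, and this plane is the kernel of
  the projection.\<close>

lemma proj_laplacian_lift:
  assumes "z \<in> D"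
  shows "proj_quadric (lift z) (dz (dzbar lift) z) = 0"
proof -
  interpret L: horizontal_quadric_map D lift by (rule horizontal_lift_map)
  have 1: "proj_quadric (lift z) (lift z) = 0" "proj_quadric (lift z) (vcnj (lift z)) = 0"
  proof -
    have "herm (lift z) (vcnj (lift z)) = 0" "herm (vcnj (lift z)) (lift z) = 0"
      using L.isotropic[OF assms] by (simp_all add: herm_def)
    moreover have "herm (vcnj (lift z)) (vcnj (lift z)) = -1"
      using L.norm[OF assms] by (simp add: herm_def bil_commute[of "vcnj (lift z)" "lift z"])
    ultimately show "proj_quadric (lift z) (lift z) = 0" "proj_quadric (lift z) (vcnj (lift z)) = 0"
      using L.norm[OF assms] by (simp_all add: proj_quadric_def vec_eq_iff)
  qed
  define c where "c = complex_of_real (1 / sqrt 2)"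
  have c: "c \<noteq> 0" "cnj c = c" by (simp_all add: c_def)
  have l: "lift z = c *s (p z + \<i> *s n z)" by (simp add: lift_def c_def)
  have l': "vcnj (lift z) = c *s (p z + (- \<i>) *s n z)"
    unfolding l by (simp only: vcnj_simps vcnj_pn c complex_cnj_i)
  define x y where "x = proj_quadric (lift z) (p z)" and "y = proj_quadric (lift z) (n z)"
  have "proj_quadric P (c *s (p z + \<i> *s n z)) = c *s (proj_quadric P (p z) + \<i> *s proj_quadric P (n z))" for P
    by (simp only: proj_quadric_simps)
  from this[of "lift z", folded l] have "c *s (x + \<i> *s y) = 0"
    using 1(1) by (simp only: x_def y_def)
  moreover have "c *s (x + (- \<i>) *s y) = 0"
    using 1(2) unfolding l' x_def y_def by (simp only: proj_quadric_simps)
  ultimately have "x + \<i> *s y = 0" "x + (- \<i>) *s y = 0" using c(1) by (simp_all only: vector_mul_eq_0) simp_all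
  then have "x $ k + \<i> * y $ k = 0" "x $ k - \<i> * y $ k = 0" for k
    by (simp_all add: vec_eq_iff)
  note xy = this
  have "x $ k = 0 \<and> y $ k = 0" for k
  proof -
    have "2 * x $ k = (x $ k + \<i> * y $ k) + (x $ k - \<i> * y $ k)" by (simp only: mult_2) simp
    then have "x $ k = 0" unfolding xy by simp
    with xy(1)[of k] show ?thesis by simp
  qed
  then have pn: "proj_quadric (lift z) (p z) = 0" "proj_quadric (lift z) (n z) = 0"
    by (simp_all add: vec_eq_iff flip: x_def y_def)
  show ?thesis
    by (simp add: laplacian_lift[OF assms] pzz[OF assms] nzz[OF assms] pn)
qed

end

lemma cline_smult:
  assumes "c \<noteq> 0"
  shows "cline (c *s v) = cline v"
proof
  show "cline (c *s v) \<subseteq> cline v" by (auto simp: cline_def)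
  have "a *s v = (a / c) *s (c *s v)" for a using assms by simp
  then show "cline v \<subseteq> cline (c *s v)" unfolding cline_def by blast
qed

lemma cline_self: "v \<in> cline v"
  using exI[of "\<lambda>c. v = c *s v" 1] by (simp add: cline_def)

lemma horizontal_liftI:
  assumes "horizontal_quadric_map S F" "\<And>z. z \<in> S \<Longrightarrow> f z = cline (F z)"
    "\<And>z. z \<in> S \<Longrightarrow> G z = F z"
  shows "horizontal_lift S f G"
proof -
  interpret horizontal_quadric_map S F by fact
  have "dz G z = dz F z" "dzbar G z = dzbar F z" if "z \<in> S" for z
    using wirtinger_cong[OF open_S that assms(3)] by simp_all
  moreover have "smooth_on S G" using smooth smooth_on_cong[of S G F] open_S assms(3) by metis
  ultimately show ?thesis
    using assms(2,3) norm horizontal by (simp add: horizontal_lift_def herm_def)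
qed

lemma maximal_surface_lift:
  assumes "open D" "D \<noteq> {}" "connected D"
    and "maximal_surface D g N" "AdS_has_metric D g (\<lambda>z. 2 * exp (u z))"
    and f: "\<And>z. z \<in> D \<Longrightarrow> f z = cline (cvec (g z) + \<i> *s cvec (N z))"
    and F: "\<And>z. z \<in> D \<Longrightarrow> F z = complex_of_real (1 / sqrt 2) *s (cvec (g z) + \<i> *s cvec (N z))"
  shows "\<exists>Q \<in> Q2star_components. minimal_lagrangian D Q f" "horizontal_lift D f F"
    "\<And>z. z \<in> D \<Longrightarrow> alpha F z = - \<i> * hopf g N z"
    "has_metric D f (\<lambda>z. exp (u z) + (cmod (hopf g N z))\<^sup>2 * exp (- u z))"
proof -
  interpret M: AdS_maximal D g N "\<lambda>z. exp (u z)"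
    by unfold_locales (use assms in auto)
  interpret L: horizontal_quadric_map D M.lift by (rule M.horizontal_lift_map)
  have eq: "F z = M.lift z" if "z \<in> D" for z
    using F[OF that] by (simp add: M.lift_def M.p_def M.n_def)
  have fl: "f z = cline (M.lift z)" if "z \<in> D" for z
    unfolding M.lift_def M.p_def M.n_def by (subst cline_smult) (simp_all add: f[OF that])
  have pos: "(exp (u z) + (cmod (hopf g N z))\<^sup>2 / exp (u z)) / 2 > 0" for z
    by (simp add: add_pos_nonneg)
  obtain Q where Q: "Q \<in> Q2star_components" "f ` D \<subseteq> Q"
    using image_in_component[OF assms(1,3,2) smooth_on_continuous[OF L.smooth] L.norm L.isotropic, of f] fl by auto
  note ml = L.minimal_lagrangianI[OF fl Q(2) pos M.conformal_lift(1-3) M.proj_laplacian_lift]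
  show "\<exists>Q \<in> Q2star_components. minimal_lagrangian D Q f" using ml(1) Q(1) by blast
  show "horizontal_lift D f F" by (rule horizontal_liftI[OF M.horizontal_lift_map fl eq])
  show "alpha F z = - \<i> * hopf g N z" if "z \<in> D" for z
    using M.conformal_lift(4)[OF that] wirtinger_cong[OF assms(1) that eq] by (simp add: alpha_def)
  show "has_metric D f (\<lambda>z. exp (u z) + (cmod (hopf g N z))\<^sup>2 * exp (- u z))"
  proof -
    have "2 * ((exp (u z) + x / exp (u z)) / 2) = exp (u z) + x * exp (- u z)" for x z
      by (simp only: exp_minus divide_inverse) simp
    with ml(2) show ?thesis by (simp only:)
  qed
qed

section \<open>Existence of horizontal lifts\<close>

lemma smooth_on_wirtinger_scalar:
  assumes "open S" "smooth_on S f"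
  shows "smooth_on S (wz f)" "smooth_on S (wzbar f)"
proof -
  have d: "smooth_on S (dir f X)" for X using assms(2) by (rule smooth_on_dir)
  have "smooth_on S (\<lambda>z. (1/2) * (dir f 1 z + (- \<i>) * dir f \<i> z))"
    "smooth_on S (\<lambda>z. (1/2) * (dir f 1 z + \<i> * dir f \<i> z))"
    by (intro smooth_on_linear[OF assms(1) bounded_linear_mult_right] smooth_on_add assms(1) d)+
  then show "smooth_on S (wz f)" "smooth_on S (wzbar f)"
    by (simp_all add: wz_def[abs_def] wzbar_def[abs_def])
qed

text \<open>The two components of the quadric are distinguished by the sign of
  \<open>cmod (v$1 + \<i> * v$2) - cmod (v$1 - \<i> * v$2)\<close>.\<close>

lemma quadric_component_sign:
  assumes "herm v v = -1" "bil v v = 0"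
  shows "(cmod (v$1 + \<i> * v$2))\<^sup>2 \<noteq> (cmod (v$1 - \<i> * v$2))\<^sup>2"
proof
  define A B C D where "A = (cmod (v$1 + \<i> * v$2))\<^sup>2" and "B = (cmod (v$1 - \<i> * v$2))\<^sup>2"
    and "C = (cmod (v$3 + \<i> * v$4))\<^sup>2" and "D = (cmod (v$3 - \<i> * v$4))\<^sup>2"
  assume "(cmod (v$1 + \<i> * v$2))\<^sup>2 = (cmod (v$1 - \<i> * v$2))\<^sup>2"
  then have AB: "A = B" by (simp add: A_def B_def)
  have pos: "A \<ge> 0" "C \<ge> 0" "D \<ge> 0" by (simp_all add: A_def C_def D_def)
  \<comment> \<open>By this parallelogram law the norm condition reads
    \<open>A + B = C + D + 2\<close>, while isotropy factors and reads \<open>A * B = C * D\<close>.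
    So \<open>A = B\<close> would give \<open>4 C D = (C + D + 2)\<^sup>2\<close>, against the
    inequality of arithmetic and geometric means.\<close>
  have par: "(cmod (a + \<i> * b))\<^sup>2 + (cmod (a - \<i> * b))\<^sup>2 = 2 * ((cmod a)\<^sup>2 + (cmod b)\<^sup>2)" for a b
    unfolding cmod_power2 by (simp add: power2_eq_square algebra_simps)
  have "Re (herm v v) = - (cmod (v$1))\<^sup>2 - (cmod (v$2))\<^sup>2 + (cmod (v$3))\<^sup>2 + (cmod (v$4))\<^sup>2"
    unfolding cmod_power2 by (simp add: herm_def bil_def vcnj_def power2_eq_square)
  then have sum: "A + B = C + D + 2" using assms(1) by (simp add: A_def B_def C_def D_def par)
  have "(v$1 + \<i> * v$2) * (v$1 - \<i> * v$2) = (v$3 + \<i> * v$4) * (v$3 - \<i> * v$4)"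
    using assms(2) by (simp add: bil_def algebra_simps)
  then have "cmod (v$1 + \<i> * v$2) * cmod (v$1 - \<i> * v$2) = cmod (v$3 + \<i> * v$4) * cmod (v$3 - \<i> * v$4)"
    by (metis norm_mult)
  then have "A * B = C * D" unfolding A_def B_def C_def D_def by (metis power_mult_distrib)
  moreover have "C + D + 2 = 2 * B" using sum AB by simp
  ultimately have "4 * (C * D) = (C + D + 2)\<^sup>2" by (simp add: AB power2_eq_square)
  moreover have "4 * (C * D) \<le> (C + D)\<^sup>2" using zero_le_power2[of "C - D"] by (simp add: power2_eq_square algebra_simps)
  moreover have "(C + D)\<^sup>2 < (C + D + 2)\<^sup>2" using pos by (intro power_strict_mono) auto
  ultimately show False by linarith
qed

section \<open>Gluing local lifts by fixing their phase\<close>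

lemma cline_quadric_dualD:
  assumes "cline v \<in> quadric_dual"
  shows "bil v v = 0"
proof -
  obtain w where "cline v = cline w" "bil w w = 0" using assms by (auto simp: quadric_dual_def)
  then show ?thesis using cline_self[of v] by (auto simp: cline_def)
qed

lemma component_quadric_dual: "Q \<in> Q2star_components \<Longrightarrow> Q \<subseteq> quadric_dual"
  unfolding Q2star_components_def using connected_components_of_subset by fastforce

text \<open>Rotates \<open>v\<close> so that \<open>v1 + s v2\<close> becomes its own modulus. Where
  this number is nonzero, it selects one of the unit representatives of a line; the values of
  interest are \<open>s = \<i>\<close> and \<open>s = - \<i>\<close>.\<close>

definition phase_normalize :: "complex \<Rightarrow> complex^4 \<Rightarrow> complex^4" where
  "phase_normalize s v = (cnj (v$1 + s * v$2) * inverse (of_real (cmod (v$1 + s * v$2)))) *s v"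

lemma phase_normalize_unitary:
  assumes "c * cnj c = 1"
  shows "phase_normalize s (c *s v) = phase_normalize s v"
proof -
  have "(cmod c)\<^sup>2 = 1" using assms by (metis complex_norm_square of_real_eq_1_iff)
  then have "cmod c = 1" using norm_ge_zero[of c] by (simp add: power2_eq_1_iff)
  moreover have "(c *s v)$1 + s * (c *s v)$2 = c * (v$1 + s * v$2)" by (simp add: algebra_simps)
  moreover have "cnj c * c = 1" using assms by (simp add: mult.commute)
  ultimately show ?thesis
    unfolding phase_normalize_def vector_smult_assoc by (simp add: norm_mult mult_ac)
qed

lemma smooth_phase_normalize:
  fixes F :: "complex \<Rightarrow> complex^4"
  assumes "open U" "smooth_on U F" "\<And>z. z \<in> U \<Longrightarrow> F z $ 1 + s * F z $ 2 \<noteq> 0"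
  shows "smooth_on U (\<lambda>z. phase_normalize s (F z))"
proof -
  have nth: "bounded_linear (\<lambda>v::complex^4. v $ i)" for i
    by (rule bounded_linear_vec_nth)
  have w: "smooth_on U (\<lambda>z. F z $ 1 + s * F z $ 2)"
    by (intro smooth_on_add smooth_on_linear[OF assms(1) bounded_linear_mult_right] smooth_on_linear[OF assms(1) nth] assms)
  have cw: "smooth_on U (\<lambda>z. cnj (F z $ 1 + s * F z $ 2))"
    by (rule smooth_on_linear[OF assms(1) bounded_linear_cnj w])
  have sq: "smooth_on U (\<lambda>z. (F z $ 1 + s * F z $ 2) * cnj (F z $ 1 + s * F z $ 2))"
    by (rule smooth_on_bilinear[OF assms(1) bounded_bilinear_mult w cw])
  \<comment> \<open>The modulus is not holomorphic, but its inverse is the holomorphic function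
    \<open>inverse (csqrt t)\<close> applied to the smooth positive function
    \<open>t = w * cnj w\<close>.\<close>
  have "smooth_on U (\<lambda>z. inverse (csqrt ((F z $ 1 + s * F z $ 2) * cnj (F z $ 1 + s * F z $ 2))))"
  proof (rule smooth_on_holomorphic[OF assms(1) _ _ sq, where T = "- \<real>\<^sub>\<le>\<^sub>0" and \<phi> = "\<lambda>t. inverse (csqrt t)"])
    show "open (- \<real>\<^sub>\<le>\<^sub>0 :: complex set)" by (simp add: open_Compl)
    show "(\<lambda>t. inverse (csqrt t)) holomorphic_on - \<real>\<^sub>\<le>\<^sub>0"
      by (intro holomorphic_on_inverse holomorphic_on_csqrt) auto
    show "(\<lambda>z. (F z $ 1 + s * F z $ 2) * cnj (F z $ 1 + s * F z $ 2)) ` U \<subseteq> - \<real>\<^sub>\<le>\<^sub>0"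
    proof (clarsimp simp del: complex_cnj_add complex_cnj_mult)
      fix z assume "z \<in> U" "(F z $ 1 + s * F z $ 2) * cnj (F z $ 1 + s * F z $ 2) \<in> \<real>\<^sub>\<le>\<^sub>0"
      then show False
        using assms(3) unfolding complex_norm_square[symmetric]
        by (simp add: complex_nonpos_Reals_iff del: of_real_power)
    qed
  qed
  also have "(\<lambda>z. inverse (csqrt ((F z $ 1 + s * F z $ 2) * cnj (F z $ 1 + s * F z $ 2))))
      = (\<lambda>z. inverse (of_real (cmod (F z $ 1 + s * F z $ 2))))"
    unfolding complex_norm_square[symmetric] by (simp add: of_real_sqrt del: of_real_power)
  finally show ?thesis
    unfolding phase_normalize_def
    by (intro smooth_on_smult smooth_on_bilinear[OF assms(1) bounded_bilinear_mult] cw assms)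
qed

text \<open>By connectedness \<open>v1 + \<i> v2\<close> dominates \<open>v1 - \<i> v2\<close> in
  modulus at all points of the domain or at none; the dominating one has no zeros. Normalizing its
  phase makes local lifts agree on overlaps.\<close>

lemma global_lift:
  assumes "open D" "connected D" "smooth_map D f" "f ` D \<subseteq> quadric_dual"
  obtains G where "local_lift D f D G"
proof -
  have lifts: "\<exists>U F. z \<in> U \<and> local_lift D f U F" if "z \<in> D" for z
    using assms(3) that by (simp add: smooth_map_def)
  define A B where "A v = cmod (v$1 + \<i> * v$2)" and "B v = cmod (v$1 - \<i> * v$2)" for v :: "complex^4"
  have loc: "bil (F z) (F z) = 0" "herm (F z) (F z) = -1" "f z = cline (F z)" "z \<in> D"
    if "local_lift D f U F" "z \<in> U" for U F z
  proof -
    show *: "herm (F z) (F z) = -1" "f z = cline (F z)" "z \<in> D" using that by (auto simp: local_lift_def)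
    then have "cline (F z) \<in> quadric_dual" using assms(4) by (metis image_subset_iff)
    then show "bil (F z) (F z) = 0" by (rule cline_quadric_dualD)
  qed
  have AB: "A (F z) \<noteq> B (F z)" if "local_lift D f U F" "z \<in> U" for U F z
    using quadric_component_sign[OF loc(2,1)[OF that]] by (auto simp: A_def B_def)
  have scale: "A (c *s v) = cmod c * A v" "B (c *s v) = cmod c * B v" for c v
    by (simp_all add: A_def B_def algebra_simps flip: norm_mult)
  \<comment> \<open>Both moduli scale alike, so the comparison may be made on any nonzero
    representative of the line and \<open>T\<close> can be read off from every local lift.\<close>
  define T where "T = {z\<in>D. \<exists>v\<in>f z. A v > B v}"
  have T: "z \<in> T \<longleftrightarrow> A (F z) > B (F z)" if lift: "local_lift D f U F" and "z \<in> U" for U F z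
  proof
    assume "z \<in> T"
    then obtain c where "A (c *s F z) > B (c *s F z)" using loc(3)[OF lift \<open>z \<in> U\<close>] by (auto simp: T_def cline_def)
    then show "A (F z) > B (F z)" unfolding scale by (rule mult_left_less_imp_less) simp
  qed (use loc[OF lift \<open>z \<in> U\<close>] cline_self in \<open>auto simp: T_def\<close>)
  have cont: "continuous_on U (\<lambda>z. A (F z))" "continuous_on U (\<lambda>z. B (F z))" if "local_lift D f U F" for U F
  proof -
    have "continuous_on U F" using that by (auto intro: smooth_on_continuous simp: local_lift_def)
    then show "continuous_on U (\<lambda>z. A (F z))" "continuous_on U (\<lambda>z. B (F z))"
      unfolding A_def B_def by (intro continuous_intros; assumption)+
  qed
  have "open T" "open (D - T)"
  proof -
    have "\<exists>V. open V \<and> z \<in> V \<and> V \<subseteq> T" if zT: "z \<in> T" for z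
    proof -
      obtain U F where UF: "z \<in> U" "local_lift D f U F"
        using lifts[of z] zT by (auto simp: T_def)
      have U: "open U" using UF(2) by (simp add: local_lift_def)
      have "open (U \<inter> {z. A (F z) > B (F z)})"
        using continuous_open_preimage[OF continuous_on_diff[OF cont[OF UF(2)]] U open_greaterThan[of 0]]
        by (simp add: vimage_def)
      then show ?thesis using T[OF UF(2)] UF(1) that by (intro exI[of _ "U \<inter> {z. A (F z) > B (F z)}"]) auto
    qed
    then show "open T" by (subst open_subopen) blast
    have "\<exists>V. open V \<and> z \<in> V \<and> V \<subseteq> D - T" if zT: "z \<in> D - T" for z
    proof -
      obtain U F where UF: "z \<in> U" "local_lift D f U F"
        using lifts[of z] zT by auto
      have U: "open U" using UF(2) by (simp add: local_lift_def)
      have "open (U \<inter> {z. A (F z) < B (F z)})"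
        using continuous_open_preimage[OF continuous_on_diff[OF cont(2,1)[OF UF(2)]] U open_greaterThan[of 0]]
        by (simp add: vimage_def)
      moreover have "U \<inter> {z. A (F z) < B (F z)} \<subseteq> D - T"
        using T[OF UF(2)] loc(4)[OF UF(2)] by force
      moreover have "z \<in> {z. A (F z) < B (F z)}" using T[OF UF(2,1)] AB[OF UF(2,1)] that by auto
      ultimately show ?thesis using UF(1) by blast
    qed
    then show "open (D - T)" by (subst open_subopen) blast
  qed
  then have "T = {} \<or> D - T = {}"
    using connectedD[OF assms(2), of T "D - T"] by (auto simp: T_def)
  then have "\<exists>s. \<forall>U F z. local_lift D f U F \<and> z \<in> U \<longrightarrow> F z $ 1 + s * F z $ 2 \<noteq> 0"
  proof
    assume "T = {}"
    then have "B (F z) \<noteq> 0" if "local_lift D f U F" "z \<in> U" for U F z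
      using T[OF that] AB[OF that] by (auto simp: A_def B_def)
    then show ?thesis by (intro exI[of _ "-\<i>"]) (auto simp: B_def)
  next
    assume "D - T = {}"
    then have "A (F z) \<noteq> 0" if "local_lift D f U F" "z \<in> U" for U F z
      using T[OF that] loc(4)[OF that] norm_ge_zero[of "F z $ 1 - \<i> * F z $ 2"] by (auto simp: B_def)
    then show ?thesis by (intro exI[of _ "\<i>"]) (auto simp: A_def)
  qed
  then obtain s where s: "\<And>U F z. local_lift D f U F \<Longrightarrow> z \<in> U \<Longrightarrow> F z $ 1 + s * F z $ 2 \<noteq> 0" by blast
  \<comment> \<open>The representative is an arbitrary choice without any regularity; phase
    normalization erases it, so locally \<open>G\<close> is the normalization of a smooth
    lift.\<close>
  define G where "G z = phase_normalize s (SOME v. v \<in> f z \<and> herm v v = -1)" for z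
  have G: "G z = phase_normalize s (F z)" if "local_lift D f U F" "z \<in> U" for U F z
  proof -
    define v where "v = (SOME v. v \<in> f z \<and> herm v v = -1)"
    have "F z \<in> f z \<and> herm (F z) (F z) = -1" using loc[OF that] cline_self by auto
    then have v: "v \<in> f z \<and> herm v v = -1" unfolding v_def by (rule someI)
    then have "v \<in> cline (F z)" using loc(3)[OF that] by simp
    then obtain c where c: "v = c *s F z" by (auto simp: cline_def)
    have "c * cnj c = 1" using v loc(2)[OF that] by (simp add: c mult.commute)
    then show ?thesis using phase_normalize_unitary c by (simp add: G_def flip: v_def)
  qed
  have "smooth_on D G"
  proof (rule smooth_on_local)
    fix z assume "z \<in> D"
    then obtain U F where UF: "z \<in> U" "local_lift D f U F" using lifts by blast
    then have U: "open U" "smooth_on U F" by (auto simp: local_lift_def)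
    have "smooth_on U (\<lambda>z. phase_normalize s (F z))" by (rule smooth_phase_normalize[OF U s[OF UF(2)]])
    then have "smooth_on U G" using smooth_on_cong[of U G] U(1) G[OF UF(2)] by metis
    then show "\<exists>U. open U \<and> z \<in> U \<and> smooth_on U G" using U UF by blast
  qed
  moreover have "herm (G z) (G z) = -1 \<and> f z = cline (G z)" if "z \<in> D" for z
  proof -
    obtain U F where UF: "z \<in> U" "local_lift D f U F" using lifts \<open>z \<in> D\<close> by blast
    define w where "w = F z $ 1 + s * F z $ 2"
    define c where "c = cnj w * inverse (of_real (cmod w))"
    have "w \<noteq> 0" using s[OF UF(2,1)] by (simp add: w_def)
    then have c: "c \<noteq> 0" "cmod c = 1" by (simp_all add: c_def norm_mult norm_inverse)
    have "G z = c *s F z" using G[OF UF(2,1)] by (simp add: phase_normalize_def c_def w_def)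
    moreover have "c * cnj c = 1" using c(2) by (simp flip: complex_norm_square)
    then have "cnj c * c = 1" by (simp add: mult.commute)
    ultimately show ?thesis using loc[OF UF(2,1)] cline_smult[OF c(1)] by simp
  qed
  ultimately have "local_lift D f D G" using assms(1) by (simp add: local_lift_def)
  then show ?thesis by (rule that)
qed


lemma wirtinger_exp:
  assumes "(\<Theta> has_derivative (\<lambda>X. X * a + cnj X * b)) (at z)"
  shows "wz (\<lambda>w. exp (\<i> * \<Theta> w)) z = exp (\<i> * \<Theta> z) * (\<i> * a)"
    "wzbar (\<lambda>w. exp (\<i> * \<Theta> w)) z = exp (\<i> * \<Theta> z) * (\<i> * b)"
proof -
  have "(exp has_derivative (*) (exp (\<i> * \<Theta> z))) (at (\<i> * \<Theta> z))"
    using DERIV_exp[of "\<i> * \<Theta> z"] by (simp add: has_field_derivative_def)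
  from has_derivative_compose[OF has_derivative_mult_right[OF assms] this]
  have "((\<lambda>w. exp (\<i> * \<Theta> w)) has_derivative
      (\<lambda>X. X * (exp (\<i> * \<Theta> z) * (\<i> * a)) + cnj X * (exp (\<i> * \<Theta> z) * (\<i> * b)))) (at z)"
    by (rule has_derivative_eq_rhs) (simp add: fun_eq_iff algebra_simps)
  from wirtinger_scalar_eqI[OF this] show "wz (\<lambda>w. exp (\<i> * \<Theta> w)) z = exp (\<i> * \<Theta> z) * (\<i> * a)"
    "wzbar (\<lambda>w. exp (\<i> * \<Theta> w)) z = exp (\<i> * \<Theta> z) * (\<i> * b)" .
qed

text \<open>The connection form \<open>herm (dG) G\<close> of a lift \<open>G\<close> is closed because the surface is Lagrangian;
  a primitive of it is the phase that makes the lift horizontal.\<close>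

lemma horizontal_lift_exists:
  assumes "open D" "simply_connected D" and lift: "local_lift D f D G"
    and kaehler: "\<And>z. z \<in> D \<Longrightarrow> kaehler_pullback G 1 \<i> z = 0"
  shows "\<exists>H. horizontal_lift D f H"
proof -
  have G: "smooth_on D G" "\<And>z. z \<in> D \<Longrightarrow> herm (G z) (G z) = -1" "\<And>z. z \<in> D \<Longrightarrow> f z = cline (G z)"
    using lift by (auto simp: local_lift_def)
  note smz = smooth_on_wirtinger[OF assms(1) G(1)]
  define h k where "h z = herm (dz G z) (G z)" and "k z = herm (dzbar G z) (G z)" for z
  have smh: "smooth_on D h" "smooth_on D k"
    unfolding h_def k_def by (intro smooth_on_herm assms(1) smz G(1))+
  have hk: "h z = - cnj (k z)" "k z = - cnj (h z)" if "z \<in> D" for z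
    using wirtinger_herm_const[OF assms(1) G(1,1) that G(2)] by (simp_all add: h_def k_def cnj_herm)
  have lagr: "herm (dz G z) (dz G z) = herm (dzbar G z) (dzbar G z)" if "z \<in> D" for z
  proof -
    have hor: "herm (hor (G z) v) (hor (G z) w) = herm v w + herm v (G z) * cnj (herm w (G z))" for v w
      by (simp add: hor_def G(2)[OF that] cnj_herm algebra_simps)
    define p q c where "p = herm (dz G z) (dz G z)" and "q = herm (dzbar G z) (dzbar G z)" and "c = herm (dz G z) (dzbar G z)"
    have c: "herm (dzbar G z) (dz G z) = cnj c" by (simp add: c_def cnj_herm)
    have real: "Im p = 0" "Im q = 0"
      using cnj_herm[of "dz G z" "dz G z"] cnj_herm[of "dzbar G z" "dzbar G z"] by (simp_all add: p_def q_def complex_eq_iff)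
    have "kaehler_pullback G 1 \<i> z = - Im (herm (tangent G 1 z) (tangent G \<i> z))"
      by (simp add: kaehler_pullback_def)
    also have "herm (tangent G 1 z) (tangent G \<i> z) =
        (p + \<i> * \<i> * q) * (- \<i>) + \<i> * (c - cnj c) + (h z + k z) * cnj (\<i> * h z - \<i> * k z)"
      unfolding tangent_def hor dir_wirtinger[OF G(1) that]
      by (simp add: algebra_simps p_def q_def h_def k_def flip: c_def c)
    \<comment> \<open>Both the mixed term and the vertical term are real: the first is
      \<open>\<i>\<close> times an imaginary number, and by \<open>h = - cnj k\<close> the second is
      a product of two imaginary numbers.\<close>
    also have "Im \<dots> = - Re p + Re q"
      using real by (simp add: hk(1)[OF that] algebra_simps)
    finally show ?thesis using kaehler[OF that] real by (simp add: complex_eq_iff p_def q_def)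
  qed
  \<comment> \<open>If a real phase has differential \<open>Re (W * v)\<close>, its
    \<open>z\<close>-derivative is \<open>W / 2\<close>, and multiplying \<open>G\<close> by the
    corresponding unitary factor changes \<open>h\<close> to \<open>h - \<i> * W / 2\<close>. This
    is the \<open>W\<close> for which the result is 0.\<close>
  define W where "W z = (-2 * \<i>) * h z" for z
  have smW: "smooth_on D W"
    unfolding W_def by (intro smooth_on_linear[OF assms(1) bounded_linear_mult_right] smh)
  have W': "wzbar W z = (-2 * \<i>) * wzbar h z" if "z \<in> D" for z
  proof -
    have "(W has_derivative (\<lambda>X. (-2 * \<i>) * (X * wz h z + cnj X * wzbar h z))) (at z)"
      unfolding W_def by (rule has_derivative_mult_right[OF has_derivative_wirtinger_scalar[OF smh(1) that]])
    then have "(W has_derivative (\<lambda>X. X * ((-2 * \<i>) * wz h z) + cnj X * ((-2 * \<i>) * wzbar h z))) (at z)"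
      by (rule has_derivative_eq_rhs) (simp add: fun_eq_iff algebra_simps)
    then show ?thesis by (rule wirtinger_scalar_eqI)
  qed
  \<comment> \<open>The Lagrangian condition makes \<open>wzbar h\<close> and \<open>wz k\<close>
    the same number \<open>m\<close>; together with \<open>k = - cnj h\<close> this gives
    \<open>m = - cnj m\<close>, and the factor \<open>-2 * \<i>\<close> turns an imaginary number
    into a real one.\<close>
  have realW: "wzbar W z = of_real (Re (wzbar W z))" if "z \<in> D" for z
  proof -
    define m where "m = herm (dz (dzbar G) z) (G z) + herm (dz G z) (dz G z)"
    have "wzbar h z = m"
      unfolding h_def m_def wirtinger_herm(2)[OF assms(1) smz(1) G(1) that] wirtinger_commute[OF assms(1) G(1) that] ..
    moreover have "wz k z = m"
      unfolding k_def m_def wirtinger_herm(1)[OF assms(1) smz(2) G(1) that] lagr[OF that] ..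
    moreover have "wz k z = - cnj (wzbar h z)"
    proof -
      have "wz k z = wz (\<lambda>w. - cnj (h w)) z" by (rule wirtinger_scalar_cong[OF assms(1) that hk(2)])
      also have "((\<lambda>w. - cnj (h w)) has_derivative (\<lambda>X. X * (- cnj (wzbar h z)) + cnj X * (- cnj (wz h z)))) (at z)"
        by (rule has_derivative_eq_rhs[OF has_derivative_minus[OF
          bounded_linear.has_derivative[OF bounded_linear_cnj has_derivative_wirtinger_scalar[OF smh(1) that]]]])
          (simp add: fun_eq_iff algebra_simps)
      then have "wz (\<lambda>w. - cnj (h w)) z = - cnj (wzbar h z)" by (rule wirtinger_scalar_eqI)
      finally show ?thesis .
    qed
    ultimately have "Re (wzbar h z) = 0" by (simp add: complex_eq_iff)
    then show ?thesis by (simp add: W'[OF that] complex_eq_iff)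
  qed
  have "\<exists>\<theta>. \<forall>z\<in>D. (\<theta> has_derivative (\<lambda>v. Re (W z * v))) (at z)"
  proof (rule closed_form_primitive[OF assms(1,2)])
    show "(W has_derivative (\<lambda>v. wz W z * v + of_real (Re (wzbar W z)) * cnj v)) (at z)" if "z \<in> D" for z
      using has_derivative_wirtinger_scalar[OF smW that] realW[OF that] by (simp add: mult.commute)
    show "continuous_on D (wz W)" "continuous_on D (\<lambda>z. Re (wzbar W z))"
      using smooth_on_wirtinger_scalar[OF assms(1) smW, THEN smooth_on_continuous] by (auto intro: continuous_on_Re)
  qed
  then obtain \<theta> where \<theta>: "\<And>z. z \<in> D \<Longrightarrow> (\<theta> has_derivative (\<lambda>v. Re (W z * v))) (at z)" by blast
  define \<Theta> where "\<Theta> z = complex_of_real (\<theta> z)" for z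
  have d\<Theta>: "(\<Theta> has_derivative (\<lambda>v. complex_of_real (Re (W z * v)))) (at z)" if "z \<in> D" for z
    unfolding \<Theta>_def using bounded_linear.has_derivative[OF bounded_linear_of_real \<theta>[OF that]] .
  have sm\<Theta>: "smooth_on D \<Theta>"
  proof (rule smooth_onI[OF assms(1) d\<Theta>])
    show "smooth_on D (\<lambda>z. complex_of_real (Re (W z * v)))" for v
      by (rule smooth_on_linear[OF assms(1) bounded_linear_compose[OF bounded_linear_of_real
        bounded_linear_compose[OF bounded_linear_Re bounded_linear_mult_left]] smW])
  qed
  define e where "e = (\<lambda>z. exp (\<i> * \<Theta> z))"
  have sme: "smooth_on D e"
    unfolding e_def
    by (rule smooth_on_holomorphic[OF assms(1) open_UNIV _ sm\<Theta>]) (auto intro!: holomorphic_intros)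
  have de: "wz e z = e z * (\<i> * (W z / 2))" "wzbar e z = e z * (\<i> * (cnj (W z) / 2))" if "z \<in> D" for z
  proof -
    have "(\<Theta> has_derivative (\<lambda>X. X * (W z / 2) + cnj X * (cnj (W z) / 2))) (at z)"
      by (rule has_derivative_eq_rhs[OF d\<Theta>[OF that]]) (simp add: fun_eq_iff complex_eq_iff field_simps)
    from wirtinger_exp[OF this]
    show "wz e z = e z * (\<i> * (W z / 2))" "wzbar e z = e z * (\<i> * (cnj (W z) / 2))" by (simp_all add: e_def)
  qed
  have unit: "cmod (e z) = 1" for z by (simp add: e_def \<Theta>_def)
  then have unit': "e z * cnj (e z) = 1" for z using complex_norm_square[of "e z"] by simp
  define H where "H = (\<lambda>z. e z *s G z)"
  have "smooth_on D H" unfolding H_def by (intro smooth_on_smult assms(1) sme G(1))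
  moreover have "herm (H z) (H z) = -1" "f z = cline (H z)" if "z \<in> D" for z
  proof -
    have "herm (H z) (H z) = (e z * cnj (e z)) * herm (G z) (G z)" unfolding H_def by (simp only: herm_simps mult_ac)
    then show "herm (H z) (H z) = -1" by (simp add: unit' G(2)[OF that])
    have "e z \<noteq> 0" using unit[of z] by auto
    then show "f z = cline (H z)" by (simp add: H_def cline_smult G(3)[OF that])
  qed
  moreover have "herm (dz H z) (H z) = 0" "herm (dzbar H z) (H z) = 0" if "z \<in> D" for z
  proof -
    have "herm (dz H z) (H z) = (e z * cnj (e z)) * (- (\<i> * (W z / 2)) + h z)"
      unfolding H_def wirtinger_smult[OF sme G(1) that] de[OF that] h_def
      by (simp add: G(2)[OF that] algebra_simps)
    then show "herm (dz H z) (H z) = 0" by (simp add: W_def)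
    have "herm (dzbar H z) (H z) = (e z * cnj (e z)) * (- (\<i> * (cnj (W z) / 2)) + k z)"
      unfolding H_def wirtinger_smult[OF sme G(1) that] de[OF that] k_def
      by (simp add: G(2)[OF that] algebra_simps)
    then show "herm (dzbar H z) (H z) = 0" by (simp add: W_def hk(2)[OF that])
  qed
  ultimately have "horizontal_lift D f H" by (simp add: horizontal_lift_def herm_def)
  then show ?thesis by blast
qed

section \<open>From minimal Lagrangian surfaces to maximal surfaces\<close>

lemma horizontal_liftD:
  assumes "open S" "horizontal_lift S f F" "f ` S \<subseteq> quadric_dual"
  shows "horizontal_quadric_map S F" "\<And>z. z \<in> S \<Longrightarrow> f z = cline (F z)"
proof -
  show f: "f z = cline (F z)" if "z \<in> S" for z using assms(2) that by (simp add: horizontal_lift_def)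
  have "bil (F z) (F z) = 0" if "z \<in> S" for z
    using assms(3) f[OF that] cline_quadric_dualD[of "F z"] that by auto
  then show "horizontal_quadric_map S F"
    using assms(1,2) by unfold_locales (auto simp: horizontal_lift_def herm_def)
qed

text \<open>\<open>alpha\<close> and \<open>beta\<close> are bilinear rather than Hermitian, so a
  unitary factor acts through its square; hence the half angle in the normalization.\<close>

lemma horizontal_lift_rotate:
  assumes "open S" "horizontal_lift S f F" "cmod c = 1"
  shows "horizontal_lift S f (\<lambda>z. c *s F z)"
    "\<And>z. z \<in> S \<Longrightarrow> alpha (\<lambda>z. c *s F z) z = c\<^sup>2 * alpha F z"
    "\<And>z. z \<in> S \<Longrightarrow> beta (\<lambda>z. c *s F z) z = c\<^sup>2 * beta F z"
    "\<And>z. z \<in> S \<Longrightarrow> bil (dzbar (\<lambda>z. c *s F z) z) (dzbar (\<lambda>z. c *s F z) z) = c\<^sup>2 * bil (dzbar F z) (dzbar F z)"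
proof -
  have F: "smooth_on S F" "\<And>z. z \<in> S \<Longrightarrow> herm (F z) (F z) = -1" "\<And>z. z \<in> S \<Longrightarrow> f z = cline (F z)"
    "\<And>z. z \<in> S \<Longrightarrow> bil (dz F z) (vcnj (F z)) = 0" "\<And>z. z \<in> S \<Longrightarrow> bil (dzbar F z) (vcnj (F z)) = 0"
    using assms(2) by (auto simp: horizontal_lift_def)
  note w = wirtinger_const_smult[OF F(1)]
  have c: "c * cnj c = 1" using complex_norm_square[of c] assms(3) by simp
  have "c \<noteq> 0" using assms(3) by auto
  have "herm (c *s F z) (c *s F z) = -1" if "z \<in> S" for z
  proof -
    have "herm (c *s F z) (c *s F z) = (c * cnj c) * herm (F z) (F z)" by (simp only: herm_simps mult_ac)
    then show ?thesis by (simp add: c F(2)[OF that])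
  qed
  moreover have "smooth_on S (\<lambda>z. c *s F z)" by (intro smooth_on_const_smult assms(1) F(1))
  ultimately show "horizontal_lift S f (\<lambda>z. c *s F z)"
    using F(3-5) \<open>c \<noteq> 0\<close> by (simp add: horizontal_lift_def w cline_smult)
  show "alpha (\<lambda>z. c *s F z) z = c\<^sup>2 * alpha F z" "beta (\<lambda>z. c *s F z) z = c\<^sup>2 * beta F z"
    "bil (dzbar (\<lambda>z. c *s F z) z) (dzbar (\<lambda>z. c *s F z) z) = c\<^sup>2 * bil (dzbar F z) (dzbar F z)" if "z \<in> S" for z
    by (simp_all add: alpha_def beta_def w[OF that] power2_eq_square)
qed

lemma holomorphic_on_wirtinger:
  assumes "open S" "smooth_on S f" "\<And>z. z \<in> S \<Longrightarrow> wzbar f z = 0"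
  shows "f holomorphic_on S"
proof -
  have "(f has_field_derivative wz f z) (at z)" if "z \<in> S" for z
    using has_derivative_wirtinger_scalar[OF assms(2) that] assms(3)[OF that]
    by (simp add: has_field_derivative_def mult.commute[of _ "wz f z"])
  then show ?thesis using holomorphic_on_open[OF assms(1)] by blast
qed

section \<open>Structure equations of a minimal Lagrangian surface\<close>

locale minimal_lagrangian_map = horizontal_quadric_map +
  fixes r :: "complex \<Rightarrow> real"
  assumes r_pos: "z \<in> S \<Longrightarrow> r z > 0"
    and conf: "z \<in> S \<Longrightarrow> herm (dz F z) (dz F z) = of_real (r z)"
      "z \<in> S \<Longrightarrow> herm (dzbar F z) (dzbar F z) = of_real (r z)"
      "z \<in> S \<Longrightarrow> herm (dz F z) (dzbar F z) = 0"
    and minimal: "z \<in> S \<Longrightarrow> proj_quadric (F z) (dz (dzbar F) z) = 0"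

lemma minimal_lagrangian_mapI:
  assumes "open D" "minimal_lagrangian D Q f" "has_metric D f (\<lambda>z. 2 * r z)" "\<And>z. z \<in> D \<Longrightarrow> r z > 0"
    and "open S" "S \<subseteq> D" "horizontal_quadric_map S F" "\<And>z. z \<in> S \<Longrightarrow> f z = cline (F z)"
  shows "minimal_lagrangian_map S F r"
proof -
  interpret horizontal_quadric_map S F by fact
  have lift: "local_lift D f S F"
    using assms(5,6,8) smooth norm by (simp add: local_lift_def)
  have metric: "ind_metric F X Y z = 2 * r z * (X \<bullet> Y)" if "z \<in> S" for X Y z
    using assms(3) lift that by (auto simp: has_metric_def)
  have kaehler: "kaehler_pullback F 1 \<i> z = 0" and mean: "mean_curvature_vector F z = 0" if "z \<in> S" for z
    using assms(2) lift that by (auto simp: minimal_lagrangian_def)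
  note conf = lagrangian_conformalD[OF _ metric kaehler]
  have "proj_quadric (F z) (dz (dzbar F) z) = 0" if "z \<in> S" for z
  proof -
    have pos: "r z > 0" using assms(4,6) that by blast
    have "(2 / (2 * r z)) *\<^sub>R proj_quadric (F z) (dz (dzbar F) z) = 0"
      using mean_curvature_F[OF that, of "2 * r z"] metric[OF that, of 1 1] metric[OF that, of \<i> \<i>]
        mean[OF that] normal_part_laplacian[OF that conf(3)] by simp
    then show ?thesis using pos by simp
  qed
  then show ?thesis
    using assms(4,6) conf by unfold_locales auto
qed

context minimal_lagrangian_map
begin

text \<open>Its conjugate is the \<open>alpha\<close> of the conjugate lift, because
  \<open>dz\<close> of \<open>vcnj F\<close> is \<open>vcnj (dzbar F)\<close>.\<close>

definition gam :: "complex \<Rightarrow> complex" where "gam z = bil (dzbar F z) (dzbar F z)"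

lemma conf': "z \<in> S \<Longrightarrow> herm (dzbar F z) (dz F z) = 0"
  using conf(3) cnj_herm[of "dz F z" "dzbar F z"] by simp

lemma herm_F:
  assumes "z \<in> S"
  shows "herm (F z) (dz F z) = 0" "herm (F z) (dzbar F z) = 0"
  using horizontal[OF assms] cnj_herm[of _ "F z"] by (metis complex_cnj_zero)+

lemma laplacian:
  assumes "z \<in> S"
  shows "dz (dzbar F) z = of_real (r z) *s F z + beta F z *s vcnj (F z)"
  using minimal[OF assms] unfolding proj_quadric_dz_dzbar[OF assms] conf(1)[OF assms]
  by (simp add: algebra_simps)

lemma laplacian':
  assumes "z \<in> S"
  shows "dzbar (dz F) z = of_real (r z) *s F z + beta F z *s vcnj (F z)"
  using laplacian[OF assms] by (simp add: wirtinger_commute[OF open_S smooth assms])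

lemma frame_expansion:
  assumes "z \<in> S"
  shows "v = - herm v (F z) *s F z - bil v (F z) *s vcnj (F z)
    + (herm v (dz F z) / r z) *s dz F z + (herm v (dzbar F z) / r z) *s dzbar F z"
proof -
  have r0: "r z \<noteq> 0" using r_pos[OF assms] by simp
  have [simp]: "bil (F z) (vcnj (F z)) = -1" "bil (vcnj (F z)) (F z) = -1" "bil (F z) (F z) = 0"
    "bil (F z) (vcnj (dz F z)) = 0" "bil (F z) (vcnj (dzbar F z)) = 0"
    "bil (dz F z) (vcnj (F z)) = 0" "bil (dzbar F z) (vcnj (F z)) = 0"
    "bil (dz F z) (F z) = 0" "bil (dzbar F z) (F z) = 0" "bil (F z) (dz F z) = 0" "bil (F z) (dzbar F z) = 0"
    "bil (dz F z) (vcnj (dz F z)) = of_real (r z)" "bil (dzbar F z) (vcnj (dzbar F z)) = of_real (r z)"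
    "bil (dz F z) (vcnj (dzbar F z)) = 0" "bil (dzbar F z) (vcnj (dz F z)) = 0"
    using norm[OF assms] isotropic[OF assms] horizontal[OF assms] herm_F[OF assms] bil_F[OF assms]
      conf[OF assms] conf'[OF assms]
    by (simp_all add: herm_def bil_commute[of "vcnj (F z)" "F z"] bil_commute[of "F z" "dz F z"]
        bil_commute[of "F z" "dzbar F z"])
  have "v = bil v (- vcnj (F z)) *s F z + bil v (- F z) *s vcnj (F z)
      + bil v ((1 / r z) *s vcnj (dz F z)) *s dz F z + bil v ((1 / r z) *s vcnj (dzbar F z)) *s dzbar F z"
    by (rule bil_dual_basis4) (simp_all add: r0)
  then show ?thesis by (simp add: herm_def mult.commute divide_inverse)
qed

lemma vcnj_frame:
  assumes "z \<in> S"
  shows "vcnj (dz F z) = (cnj (alpha F z) / r z) *s dz F z + (cnj (beta F z) / r z) *s dzbar F z"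
    "vcnj (dzbar F z) = (cnj (beta F z) / r z) *s dz F z + (cnj (gam z) / r z) *s dzbar F z"
proof -
  have "herm (vcnj v) w = cnj (bil v w)" for v w by (simp add: herm_def)
  moreover have "bil (vcnj v) (F z) = cnj (herm v (F z))" for v by (metis bil_vcnj_vcnj herm_def vcnj_simps(5))
  ultimately show "vcnj (dz F z) = (cnj (alpha F z) / r z) *s dz F z + (cnj (beta F z) / r z) *s dzbar F z"
    "vcnj (dzbar F z) = (cnj (beta F z) / r z) *s dz F z + (cnj (gam z) / r z) *s dzbar F z"
    using frame_expansion[OF assms, of "vcnj (dz F z)"] frame_expansion[OF assms, of "vcnj (dzbar F z)"]
    by (simp_all add: bil_F[OF assms] horizontal[OF assms] alpha_def beta_def gam_def bil_commute[of "dzbar F z" "dz F z"])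
qed

text \<open>The frame \<open>dz F\<close>, \<open>dzbar F\<close> and its conjugate are orthogonal
  bases of the same plane with equal squares \<open>r\<close>. Hence the symmetric matrix with rows
  (\<open>alpha\<close>, \<open>beta\<close>) and (\<open>beta\<close>, \<open>gam\<close>), divided
  by \<open>r\<close>, is unitary; these are the entries of that statement.\<close>

lemma alpha_beta_gam_relations:
  assumes "z \<in> S"
  shows "cnj (alpha F z) * alpha F z + cnj (beta F z) * beta F z = (of_real (r z))\<^sup>2"
    "cnj (beta F z) * beta F z + cnj (gam z) * gam z = (of_real (r z))\<^sup>2"
    "cnj (beta F z) * alpha F z + cnj (gam z) * beta F z = 0"
proof -
  have r0: "r z \<noteq> 0" using r_pos[OF assms] by simp
  have 1: "bil (vcnj (dz F z)) (dz F z) = of_real (r z)" "bil (vcnj (dzbar F z)) (dzbar F z) = of_real (r z)"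
    "bil (vcnj (dzbar F z)) (dz F z) = 0"
    using conf[OF assms] by (simp_all add: herm_def bil_commute)
  have 2: "bil (dzbar F z) (dz F z) = beta F z" by (simp add: beta_def bil_commute)
  show "cnj (alpha F z) * alpha F z + cnj (beta F z) * beta F z = (of_real (r z))\<^sup>2"
    using 1(1) r0 unfolding vcnj_frame(1)[OF assms]
    by (simp add: 2 divide_simps power2_eq_square flip: alpha_def)
  show "cnj (beta F z) * beta F z + cnj (gam z) * gam z = (of_real (r z))\<^sup>2"
    using 1(2) r0 unfolding vcnj_frame(2)[OF assms]
    by (simp add: divide_simps power2_eq_square flip: gam_def beta_def)
  show "cnj (beta F z) * alpha F z + cnj (gam z) * beta F z = 0"
    using 1(3) r0 unfolding vcnj_frame(2)[OF assms]
    by (simp add: 2 divide_simps flip: alpha_def)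
qed

lemma cmod_relations:
  assumes "z \<in> S"
  shows "(cmod (alpha F z))\<^sup>2 + (cmod (beta F z))\<^sup>2 = (r z)\<^sup>2" "cmod (gam z) = cmod (alpha F z)"
proof -
  have sq: "cnj x * x = of_real ((cmod x)\<^sup>2)" for x unfolding complex_norm_square by (simp add: mult.commute)
  have "complex_of_real ((cmod (alpha F z))\<^sup>2 + (cmod (beta F z))\<^sup>2) = of_real ((r z)\<^sup>2)"
    using alpha_beta_gam_relations(1)[OF assms] by (simp only: sq of_real_add of_real_power)
  then show 1: "(cmod (alpha F z))\<^sup>2 + (cmod (beta F z))\<^sup>2 = (r z)\<^sup>2" by (simp only: of_real_eq_iff)
  have "complex_of_real ((cmod (beta F z))\<^sup>2 + (cmod (gam z))\<^sup>2) = of_real ((r z)\<^sup>2)"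
    using alpha_beta_gam_relations(2)[OF assms] by (simp only: sq of_real_add of_real_power)
  then have "(cmod (beta F z))\<^sup>2 + (cmod (gam z))\<^sup>2 = (r z)\<^sup>2" by (simp only: of_real_eq_iff)
  with 1 have "(cmod (gam z))\<^sup>2 = (cmod (alpha F z))\<^sup>2" by linarith
  then show "cmod (gam z) = cmod (alpha F z)" by (rule power2_eq_imp_eq) simp_all
qed

text \<open>By minimality \<open>dzbar (dz F)\<close> is a combination of \<open>F\<close> and its
  conjugate, and \<open>dz F\<close> is orthogonal to both.\<close>

lemma holomorphic_alpha: "alpha F holomorphic_on S"
proof (rule holomorphic_on_wirtinger[OF open_S])
  show "smooth_on S (alpha F)"
    unfolding alpha_def[abs_def] by (intro smooth_on_bil open_S smooth_dz)
  show "wzbar (alpha F) z = 0" if "z \<in> S" for z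
    unfolding alpha_def[abs_def] wirtinger_bil(2)[OF smooth_dz smooth_dz that] laplacian'[OF that]
    using bil_F(1)[OF that] horizontal(1)[OF that] by (simp add: herm_def bil_commute)
qed

lemma holomorphic_cnj_gam: "(\<lambda>z. cnj (gam z)) holomorphic_on S"
proof (rule holomorphic_on_wirtinger[OF open_S])
  have sm: "smooth_on S gam"
    unfolding gam_def[abs_def] by (intro smooth_on_bil open_S smooth_dzbar)
  then show "smooth_on S (\<lambda>z. cnj (gam z))" by (rule smooth_on_linear[OF open_S bounded_linear_cnj])
  show "wzbar (\<lambda>z. cnj (gam z)) z = 0" if "z \<in> S" for z
    unfolding wirtinger_cnj(2)[OF sm that]
    unfolding gam_def[abs_def] wirtinger_bil(1)[OF smooth_dzbar smooth_dzbar that] laplacian[OF that]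
    using bil_F(2)[OF that] horizontal(2)[OF that] by (simp add: herm_def bil_commute)
qed

lemma smooth_beta: "smooth_on S (beta F)"
  unfolding beta_def[abs_def] by (intro smooth_on_bil open_S smooth_dz smooth_dzbar)

text \<open>Both derivatives of \<open>beta\<close> are computed by expanding one factor in the conjugate frame.\<close>

lemma beta_log_derivative:
  assumes "z \<in> S"
  shows "cnj (beta F z) * wz (beta F) z = beta F z * cnj (wzbar (beta F) z)"
proof -
  define zz bb where "zz = dz (dz F) z" and "bb = dzbar (dzbar F) z"
  define \<sigma> \<psi> where "\<sigma> = herm zz (dz F z)" and "\<psi> = herm zz (dzbar F z)"
  have r0: "r z \<noteq> 0" using r_pos[OF assms] by simp
  have lap: "herm (dz F z) (dzbar (dz F) z) = 0" "herm (dz (dzbar F) z) (dzbar F z) = 0"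
    using herm_F[OF assms] horizontal[OF assms] bil_F[OF assms] unfolding laplacian[OF assms] laplacian'[OF assms]
    by (simp_all add: herm_def bil_commute[of "F z" "dzbar F z"])
  have bb1: "herm bb (dz F z) = - cnj \<psi>"
    using wirtinger_herm_const(1)[OF open_S smooth_dz smooth_dzbar assms conf(3)]
    by (simp add: \<psi>_def zz_def bb_def cnj_herm)
  \<comment> \<open>The previous relation differentiates the orthogonality of \<open>dz F\<close>
    and \<open>dzbar F\<close>; this one differentiates the equality of their squares, so that no
    derivative of \<open>r\<close> has to be formed.\<close>
  have bb2: "herm bb (dzbar F z) = cnj \<sigma>"
  proof -
    have "wz (\<lambda>w. herm (dz F w) (dz F w)) z = wz (\<lambda>w. herm (dzbar F w) (dzbar F w)) z"
      by (rule wirtinger_scalar_cong[OF open_S assms]) (simp add: conf)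
    then have "\<sigma> = herm (dzbar F z) bb"
      unfolding wirtinger_herm[OF open_S smooth_dz smooth_dz assms] wirtinger_herm[OF open_S smooth_dzbar smooth_dzbar assms]
      by (simp add: lap \<sigma>_def zz_def bb_def)
    then show ?thesis by (simp add: cnj_herm)
  qed
  have lap0: "bil (dz F z) (dz (dzbar F) z) = 0" "bil (dzbar (dz F) z) (dzbar F z) = 0"
    using bil_F[OF assms] horizontal[OF assms] unfolding laplacian[OF assms] laplacian'[OF assms]
    by (simp_all add: herm_def bil_commute[of "F z" "dzbar F z"] bil_commute[of "vcnj (F z)" "dzbar F z"])
  have Fz: "dz F z = (alpha F z / r z) *s vcnj (dz F z) + (beta F z / r z) *s vcnj (dzbar F z)"
    using arg_cong[OF vcnj_frame(1)[OF assms], of vcnj] by simp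
  have Fb: "dzbar F z = (beta F z / r z) *s vcnj (dz F z) + (gam z / r z) *s vcnj (dzbar F z)"
    using arg_cong[OF vcnj_frame(2)[OF assms], of vcnj] by simp
  have "wz (beta F) z = bil zz (dzbar F z)"
    unfolding beta_def[abs_def] wirtinger_bil[OF smooth_dz smooth_dzbar assms] by (simp add: lap0 zz_def)
  also have "\<dots> = bil zz ((beta F z / r z) *s vcnj (dz F z) + (gam z / r z) *s vcnj (dzbar F z))"
    using Fb by (rule arg_cong)
  finally have wz: "of_real (r z) * wz (beta F) z = beta F z * \<sigma> + gam z * \<psi>"
    using r0 by (simp add: \<sigma>_def \<psi>_def herm_def field_simps)
  have "wzbar (beta F) z = bil bb (dz F z)"
    unfolding beta_def[abs_def] wirtinger_bil[OF smooth_dz smooth_dzbar assms] by (simp add: lap0 bb_def bil_commute[of "dz F z" "dzbar (dzbar F) z"])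
  also have "\<dots> = bil bb ((alpha F z / r z) *s vcnj (dz F z) + (beta F z / r z) *s vcnj (dzbar F z))"
    using Fz by (rule arg_cong)
  also have "\<dots> = (alpha F z / r z) * herm bb (dz F z) + (beta F z / r z) * herm bb (dzbar F z)"
    by (simp add: herm_def)
  finally have wzb: "of_real (r z) * wzbar (beta F) z = - alpha F z * cnj \<psi> + beta F z * cnj \<sigma>"
    using r0 by (simp add: bb1 bb2 field_simps)
  have "of_real (r z) * (cnj (beta F z) * wz (beta F) z) = cnj (beta F z) * (of_real (r z) * wz (beta F) z)"
    by (simp add: mult_ac)
  also have "\<dots> = cnj (beta F z) * beta F z * \<sigma> + \<psi> * (cnj (beta F z) * gam z)"
    unfolding wz by (simp add: algebra_simps)
  \<comment> \<open>The off-diagonal unitarity relation trades \<open>gam\<close> for the conjugate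
    of \<open>alpha\<close>; after that the two expressions containing \<psi> agree.\<close>
  also have "cnj (beta F z) * gam z = - (beta F z * cnj (alpha F z))"
    using arg_cong[OF alpha_beta_gam_relations(3)[OF assms], of cnj] by (simp add: mult_ac eq_neg_iff_add_eq_0 add.commute)
  also have "cnj (beta F z) * beta F z * \<sigma> + \<psi> * - (beta F z * cnj (alpha F z)) = beta F z * cnj (- alpha F z * cnj \<psi> + beta F z * cnj \<sigma>)"
    by (simp add: algebra_simps)
  also have "\<dots> = of_real (r z) * (beta F z * cnj (wzbar (beta F) z))"
    unfolding wzb[symmetric] by (simp add: mult_ac)
  finally show ?thesis using r0 by simp
qed

text \<open>The preceding identity says that both Wirtinger derivatives of
  \<open>beta / cnj beta\<close> vanish. This quotient is the square of the phase and avoids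
  differentiating a modulus.\<close>

lemma beta_phase:
  assumes "connected S" "\<And>z. z \<in> S \<Longrightarrow> beta F z \<noteq> 0"
  shows "\<exists>\<phi>. \<forall>z\<in>S. beta F z = cis \<phi> * complex_of_real (cmod (beta F z))"
proof (cases "S = {}")
  case False
  then obtain z0 where z0: "z0 \<in> S" by blast
  define q where "q z = beta F z / cnj (beta F z)" for z
  have "(q has_field_derivative 0) (at z)" if "z \<in> S" for z
  proof -
    note db = has_derivative_wirtinger_scalar[OF smooth_beta that]
    define b a b' where "b = beta F z" and "a = wz (beta F) z" and "b' = wzbar (beta F) z"
    have rel: "cnj b * a = b * cnj b'" "b * cnj a = cnj b * b'"
      using beta_log_derivative[OF that]
        arg_cong[OF beta_log_derivative[OF that], of cnj, unfolded complex_cnj_mult complex_cnj_cnj]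
      by (simp_all only: a_def b_def b'_def)
    have b0: "b \<noteq> 0" using assms(2)[OF that] by (simp add: b_def)
    have cb: "((\<lambda>w. cnj (beta F w)) has_derivative (\<lambda>X. cnj (X * a + cnj X * b'))) (at z)"
      using bounded_linear.has_derivative[OF bounded_linear_cnj db] by (simp add: a_def b'_def)
    have "(q has_derivative (\<lambda>X. (- b * (inverse (cnj b) * cnj (X * a + cnj X * b') * inverse (cnj b))
        + (X * a + cnj X * b') / cnj b))) (at z)"
      unfolding q_def
      by (rule has_derivative_eq_rhs[OF has_derivative_divide[OF db cb]]) (use b0 in \<open>auto simp: fun_eq_iff a_def b_def b'_def\<close>)
    moreover have "- b * (inverse (cnj b) * cnj (X * a + cnj X * b') * inverse (cnj b)) + (X * a + cnj X * b') / cnj b = 0" for X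
    proof -
      have "b * cnj (X * a + cnj X * b') = cnj b * (X * a + cnj X * b')"
        using rel by (simp add: algebra_simps)
      then show ?thesis using b0 by (simp add: field_simps)
    qed
    ultimately show ?thesis by (simp add: has_field_derivative_def flip: lambda_zero)
  qed
  then have "q constant_on S" by (rule has_field_derivative_0_imp_constant_on[OF _ assms(1) open_S])
  then obtain C where C: "\<And>z. z \<in> S \<Longrightarrow> q z = C" by (auto simp: constant_on_def)
  define v where "v z = beta F z / of_real (cmod (beta F z))" for z
  have "(v z)\<^sup>2 = C" if "z \<in> S" for z
  proof -
    have "(v z)\<^sup>2 = (beta F z)\<^sup>2 / of_real ((cmod (beta F z))\<^sup>2)" by (simp add: v_def power_divide)
    also have "\<dots> = q z" unfolding complex_norm_square using assms(2)[OF that] by (simp add: q_def power2_eq_square)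
    finally show ?thesis using C[OF that] by simp
  qed
  then have "(v z)\<^sup>2 = (v z0)\<^sup>2" if "z \<in> S" for z using that z0 by simp
  \<comment> \<open>The phase has constant square, hence at most two values, and a continuous
    function with finite range on a connected set is constant.\<close>
  then have "v ` S \<subseteq> {v z0, - v z0}" unfolding power2_eq_iff by blast
  then have "finite (v ` S)" using finite_subset by blast
  moreover have "continuous_on S v"
    unfolding v_def using smooth_on_continuous[OF smooth_beta] assms(2) by (auto intro!: continuous_intros)
  ultimately have "v constant_on S" using continuous_finite_range_constant[OF assms(1)] by blast
  then have v: "v z = v z0" if "z \<in> S" for z using that z0 by (auto simp: constant_on_def)
  have "v z0 = cis (Arg (v z0))"
    using assms(2)[OF z0] rcis_cmod_Arg[of "v z0"] by (simp add: v_def norm_divide rcis_def)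
  moreover have "beta F z = v z * of_real (cmod (beta F z))" if "z \<in> S" for z
    using assms(2)[OF that] by (simp add: v_def)
  ultimately show ?thesis using v by metis
qed simp

end

section \<open>Real and imaginary parts of the lift\<close>

context minimal_lagrangian_map
begin

text \<open>Since \<open>F\<close> is isotropic with Hermitian square -1, its real and imaginary
  parts each have square -1/2; the factor \<open>sqrt 2\<close> places them in anti-de Sitter
  space.\<close>

definition re_part :: "complex \<Rightarrow> real^4" where "re_part z = sqrt 2 *\<^sub>R (\<chi> i. Re (F z $ i))"
definition im_part :: "complex \<Rightarrow> real^4" where "im_part z = sqrt 2 *\<^sub>R (\<chi> i. Im (F z $ i))"

definition p :: "complex \<Rightarrow> complex^4" where "p = (\<lambda>z. cvec (re_part z))"
definition n :: "complex \<Rightarrow> complex^4" where "n = (\<lambda>z. cvec (im_part z))"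

lemma cvec_parts: "cvec (re_part z) = p z" "cvec (im_part z) = n z"
  by (simp_all add: p_def n_def)

lemma p_eq: "p = (\<lambda>z. complex_of_real (1 / sqrt 2) *s (F z + vcnj (F z)))"
  and n_eq: "n = (\<lambda>z. complex_of_real (1 / sqrt 2) *s ((- \<i>) *s (F z + (-1) *s vcnj (F z))))"
proof -
  have "sqrt 2 * x = 2 * x / sqrt 2" for x by (simp add: field_simps)
  then show "p = (\<lambda>z. complex_of_real (1 / sqrt 2) *s (F z + vcnj (F z)))"
    "n = (\<lambda>z. complex_of_real (1 / sqrt 2) *s ((- \<i>) *s (F z + (-1) *s vcnj (F z))))"
    by (auto simp: p_def n_def re_part_def im_part_def cvec_def vcnj_def fun_eq_iff vec_eq_iff complex_eq_iff)
qed

lemma smooth_parts: "smooth_on S re_part" "smooth_on S im_part"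
proof -
  have "bounded_linear (\<lambda>v::complex^4. sqrt 2 *\<^sub>R (\<chi> i. Re (v $ i)) :: real^4)"
    "bounded_linear (\<lambda>v::complex^4. sqrt 2 *\<^sub>R (\<chi> i. Im (v $ i)) :: real^4)"
    by (simp_all add: linear_conv_bounded_linear[symmetric] linear_iff vec_eq_iff algebra_simps)
  then show "smooth_on S re_part" "smooth_on S im_part"
    unfolding re_part_def[abs_def] im_part_def[abs_def]
    using smooth_on_linear[OF open_S _ smooth] by blast+
qed

lemmas smooth_vF = smooth_on_vcnj[OF open_S smooth]

lemma smooth_sums: "smooth_on S (\<lambda>z. F z + vcnj (F z))" "smooth_on S (\<lambda>z. (-1) *s vcnj (F z))"
  "smooth_on S (\<lambda>z. F z + (-1) *s vcnj (F z))" "smooth_on S (\<lambda>z. (- \<i>) *s (F z + (-1) *s vcnj (F z)))"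
  by (intro smooth_on_add smooth_on_const_smult smooth_vF smooth open_S)+

lemma wirtinger_p:
  assumes "z \<in> S"
  shows "dz p z = complex_of_real (1 / sqrt 2) *s (dz F z + vcnj (dzbar F z))"
    "dzbar p z = complex_of_real (1 / sqrt 2) *s (dzbar F z + vcnj (dz F z))"
  by (simp_all only: p_eq wirtinger_const_smult[OF smooth_sums(1) assms] wirtinger_add[OF smooth smooth_vF assms]
      wirtinger_vcnj[OF smooth assms])

lemma wirtinger_n:
  assumes "z \<in> S"
  shows "dz n z = complex_of_real (1 / sqrt 2) *s ((- \<i>) *s (dz F z + (-1) *s vcnj (dzbar F z)))"
    "dzbar n z = complex_of_real (1 / sqrt 2) *s ((- \<i>) *s (dzbar F z + (-1) *s vcnj (dz F z)))"
  by (simp_all only: n_eq wirtinger_const_smult[OF smooth_sums(4) assms] wirtinger_const_smult[OF smooth_sums(3) assms]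
      wirtinger_add[OF smooth smooth_sums(2) assms] wirtinger_const_smult[OF smooth_vF assms] wirtinger_vcnj[OF smooth assms])

lemma laplacian_p:
  assumes "z \<in> S"
  shows "dz (dzbar p) z = complex_of_real (1 / sqrt 2) *s (dz (dzbar F) z + vcnj (dz (dzbar F) z))"
proof -
  have v: "smooth_on S (\<lambda>z. vcnj (dz F z))" by (intro smooth_on_vcnj open_S smooth_dz)
  have s: "smooth_on S (\<lambda>z. dzbar F z + vcnj (dz F z))" by (intro smooth_on_add open_S smooth_dzbar v)
  have "dz (dzbar p) z = dz (\<lambda>z. complex_of_real (1 / sqrt 2) *s (dzbar F z + vcnj (dz F z))) z"
    by (rule wirtinger_cong[OF open_S assms]) (rule wirtinger_p)
  then show ?thesis
    by (simp only: wirtinger_const_smult[OF s assms] wirtinger_add[OF smooth_dzbar v assms]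
        wirtinger_vcnj[OF smooth_dz assms] wirtinger_commute[OF open_S smooth assms])
qed

lemmas frame_products = bil_F horizontal[unfolded herm_def] norm[unfolded herm_def] isotropic
  conf[unfolded herm_def] conf'[unfolded herm_def]

lemma frame_products':
  assumes "z \<in> S"
  shows "bil (vcnj (F z)) (F z) = -1" "bil (vcnj (dz F z)) (dz F z) = r z" "bil (vcnj (dzbar F z)) (dzbar F z) = r z"
    "bil (F z) (dz F z) = 0" "bil (F z) (dzbar F z) = 0"
    "bil (vcnj (dz F z)) (dzbar F z) = 0" "bil (vcnj (dzbar F z)) (dz F z) = 0"
    "bil (vcnj (F z)) (dz F z) = 0" "bil (vcnj (F z)) (dzbar F z) = 0"
    "bil (vcnj (dz F z)) (F z) = 0" "bil (vcnj (dzbar F z)) (F z) = 0"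
    "bil (F z) (vcnj (dz F z)) = 0" "bil (F z) (vcnj (dzbar F z)) = 0"
  using frame_products[OF assms] herm_F[OF assms, unfolded herm_def]
  by (simp_all add: bil_commute[of "vcnj _"] bil_commute[of "F z" "dz F z"] bil_commute[of "F z" "dzbar F z"])

lemma bil_pn:
  assumes "z \<in> S"
  shows "bil (p z) (p z) = -1" "bil (n z) (n z) = -1" "bil (p z) (n z) = 0"
  unfolding p_eq n_eq bil_sqrt_half
  by (simp_all add: frame_products[OF assms] frame_products'[OF assms])

lemma parts_AdS:
  assumes "z \<in> S"
  shows "bil (re_part z) (re_part z) = -1" "bil (im_part z) (im_part z) = -1" "bil (re_part z) (im_part z) = 0"
proof -
  have "complex_of_real (bil (re_part z) (re_part z)) = of_real (-1)"
    "complex_of_real (bil (im_part z) (im_part z)) = of_real (-1)"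
    "complex_of_real (bil (re_part z) (im_part z)) = of_real 0"
    using bil_pn[OF assms] by (simp_all add: p_def n_def)
  then show "bil (re_part z) (re_part z) = -1" "bil (im_part z) (im_part z) = -1" "bil (re_part z) (im_part z) = 0"
    unfolding of_real_eq_iff .
qed

lemma bil_dp_n:
  assumes "z \<in> S"
  shows "bil (dz p z) (n z) = 0" "bil (dzbar p z) (n z) = 0" "bil (dz n z) (p z) = 0" "bil (dzbar n z) (p z) = 0"
  unfolding wirtinger_p[OF assms] wirtinger_n[OF assms] unfolding p_eq n_eq bil_sqrt_half
  by (simp_all add: frame_products[OF assms] frame_products'[OF assms])

lemma f_parts:
  assumes "f z = cline (F z)"
  shows "f z = cline (cvec (re_part z) + \<i> *s cvec (im_part z))"
proof -
  have "cvec (re_part z) + \<i> *s cvec (im_part z) = p z + \<i> *s n z" by (simp add: p_def n_def)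
  also have "\<dots> = (2 * complex_of_real (1 / sqrt 2)) *s F z"
    by (simp add: p_eq n_eq vec_eq_iff algebra_simps)
  finally show ?thesis using assms by (simp only:) (subst cline_smult; simp)
qed

text \<open>The products of \<open>dz p\<close> and of \<open>dz n\<close> with themselves are plus
  and minus half of \<open>alpha + cnj gam\<close>, so both parts are conformal exactly when this
  sum vanishes. Reality of \<open>beta\<close> makes the Laplacian of \<open>p\<close> a multiple of
  \<open>p\<close>, which gives maximality, and its sign makes the metric factor
  \<open>r + b\<close> positive.\<close>

lemma maximal_pair_parts:
  assumes f: "\<And>z. z \<in> S \<Longrightarrow> f z = cline (F z)" and r: "r = (\<lambda>z. exp (u z))"
    and beta: "\<And>z. z \<in> S \<Longrightarrow> beta F z = of_real (b z)" "\<And>z. z \<in> S \<Longrightarrow> b z \<ge> 0"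
    and gam: "\<And>z. z \<in> S \<Longrightarrow> cnj (gam z) = - alpha F z"
  shows "maximal_pair S f u (alpha F) re_part im_part"
proof -
  have b: "b z = sqrt (exp (2 * u z) - (cmod (alpha F z))\<^sup>2)" if "z \<in> S" for z
  proof -
    have "(b z)\<^sup>2 = exp (2 * u z) - (cmod (alpha F z))\<^sup>2"
      using cmod_relations(1)[OF that] beta[OF that] by (simp add: r exp_double)
    then show ?thesis using beta(2)[OF that] by (metis real_sqrt_unique)
  qed
  have gam': "gam z = - cnj (alpha F z)" if "z \<in> S" for z
    using arg_cong[OF gam[OF that], of cnj] by simp
  have basic: "bil (dz F z) (dz F z) = alpha F z" "bil (dz F z) (dzbar F z) = of_real (b z)"
    "bil (dzbar F z) (dz F z) = of_real (b z)" "bil (dzbar F z) (dzbar F z) = - cnj (alpha F z)" if "z \<in> S" for z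
    using beta(1)[OF that] gam'[OF that] by (simp_all add: alpha_def beta_def gam_def bil_commute[of "dzbar F z" "dz F z"])
  have pp: "bil (dz p z) (dz p z) = 0" "bil (dzbar p z) (dzbar p z) = 0" "bil (dz p z) (dzbar p z) = of_real (r z + b z)"
    "bil (dz n z) (dz n z) = 0" "bil (dzbar n z) (dzbar n z) = 0" "bil (dz n z) (dzbar n z) = of_real (r z - b z)"
    "bil (dz p z) (dz n z) = - \<i> * alpha F z" "bil (dz n z) (dz p z) = - \<i> * alpha F z" if "z \<in> S" for z
    unfolding wirtinger_p[OF that] wirtinger_n[OF that] bil_sqrt_half
    by (simp_all add: basic[OF that] frame_products[OF that] frame_products'[OF that],
        simp add: algebra_simps)
  have metric: "bil (dir re_part X z) (dir re_part Y z) = 2 * (r z + b z) * (X \<bullet> Y)"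
    "bil (dir im_part X z) (dir im_part Y z) = 2 * (r z - b z) * (X \<bullet> Y)" if "z \<in> S" for X Y z
  proof -
    have XY: "X * cnj Y + cnj X * Y = of_real (2 * (X \<bullet> Y))"
      by (simp add: complex_eq_iff inner_complex_def)
    have "complex_of_real (bil (dir re_part X z) (dir re_part Y z)) = of_real (2 * (r z + b z) * (X \<bullet> Y))"
      unfolding bil_dir_cvec[OF open_S smooth_parts(1) that, folded p_def] pp[OF that] XY by simp
    then show "bil (dir re_part X z) (dir re_part Y z) = 2 * (r z + b z) * (X \<bullet> Y)"
      unfolding of_real_eq_iff .
    have "complex_of_real (bil (dir im_part X z) (dir im_part Y z)) = of_real (2 * (r z - b z) * (X \<bullet> Y))"
      unfolding bil_dir_cvec[OF open_S smooth_parts(2) that, folded n_def] pp[OF that] XY by simp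
    then show "bil (dir im_part X z) (dir im_part Y z) = 2 * (r z - b z) * (X \<bullet> Y)"
      unfolding of_real_eq_iff .
  qed
  have smp: "smooth_on S p" "smooth_on S n"
    unfolding p_def n_def by (intro smooth_on_cvec open_S smooth_parts)+
  note smp' = smooth_on_wirtinger[OF open_S smp(1)] smooth_on_wirtinger[OF open_S smp(2)]
  have normal: "bil (dir re_part X z) (im_part z) = 0" if "z \<in> S" for X z
  proof -
    have "complex_of_real (bil (dir re_part X z) (im_part z)) = bil (dir p X z) (n z)"
      by (simp add: p_def n_def dir_cvec[OF smooth_parts(1) that])
    also have "\<dots> = of_real 0" unfolding dir_wirtinger[OF smp(1) that] by (simp add: bil_dp_n[OF that])
    finally show ?thesis unfolding of_real_eq_iff .
  qed
  have mean: "AdS_mean_curvature re_part im_part z = 0" if "z \<in> S" for z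
  proof -
    have "dz (dzbar p) z = of_real (r z + b z) *s p z"
      unfolding laplacian_p[OF that] laplacian[OF that] beta(1)[OF that]
      by (simp add: p_eq vec_eq_iff algebra_simps add_divide_distrib)
    then have "complex_of_real (bil (dir (dir re_part 1) 1 z + dir (dir re_part \<i>) \<i> z) (im_part z)) = of_real 0"
      unfolding cvec_simps(2)[symmetric] laplacian_cvec[OF open_S smooth_parts(1) that, symmetric]
      by (simp add: bil_pn(3)[OF that, unfolded n_def] flip: p_def)
    then have "bil (dir (dir re_part 1) 1 z + dir (dir re_part \<i>) \<i> z) (im_part z) = 0"
      unfolding of_real_eq_iff .
    moreover have "bil (dir re_part 1 z) (dir re_part 1 z) = bil (dir re_part \<i> z) (dir re_part \<i> z)"
      by (simp add: metric[OF that] inner_complex_def)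
    ultimately show ?thesis
      by (simp add: AdS_mean_curvature_def complex_eq_iff flip: add_divide_distrib)
  qed
  \<comment> \<open>Both Hopf coefficients equal minus the symmetric product of \<open>dz p\<close>
    and \<open>dz n\<close>, by differentiating the orthogonality of each derivative to the other
    part; this is why they agree.\<close>
  have hopf: "hopf re_part im_part z = \<i> * alpha F z" "hopf im_part re_part z = \<i> * alpha F z" if "z \<in> S" for z
    using wirtinger_bil_const(1)[OF open_S smp'(1) smp(2) that bil_dp_n(1)]
      wirtinger_bil_const(1)[OF open_S smp'(3) smp(1) that bil_dp_n(3)]
    by (simp_all add: hopf_def pp[OF that] cvec_parts flip: p_def n_def)
  have rb: "r z + b z > 0" if "z \<in> S" for z using r_pos[OF that] beta(2)[OF that] by simp
  then have "bil (dir re_part X z) (dir re_part X z) > 0" if "z \<in> S" "X \<noteq> 0" for X z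
    using that by (simp only: metric) (intro mult_pos_pos; simp)
  moreover have "bil (dir re_part 1 z) (dir re_part 1 z) = bil (dir re_part \<i> z) (dir re_part \<i> z)"
    "bil (dir re_part 1 z) (dir re_part \<i> z) = 0" if "z \<in> S" for z
    by (simp_all add: metric[OF that] inner_complex_def)
  ultimately have "maximal_surface S re_part im_part"
    unfolding maximal_surface_def unit_normal_def
    using smooth_parts parts_AdS normal mean by (auto simp: AdS_def AdS_tangent_def)
  moreover have "AdS_has_metric S re_part (\<lambda>z. 2 * (exp (u z) + sqrt (exp (2 * u z) - (cmod (alpha F z))\<^sup>2)))"
    "AdS_has_metric S im_part (\<lambda>z. 2 * (exp (u z) - sqrt (exp (2 * u z) - (cmod (alpha F z))\<^sup>2)))"
    unfolding AdS_has_metric_def by (simp_all add: metric r flip: b)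
  moreover have "f z = cline (cvec (re_part z) + \<i> *s cvec (im_part z))" if "z \<in> S" for z
    using f[OF that] by (rule f_parts)
  ultimately show ?thesis
    unfolding maximal_pair_def
    using parts_AdS hopf by (simp add: T1minus_def AdS_def AdS_tangent_def)
qed

text \<open>With \<open>beta\<close> real, the off-diagonal unitarity relation becomes
  \<open>beta * (alpha + cnj gam) = 0\<close>. It can be divided on the nonempty open set where
  \<open>beta\<close> does not vanish, and analytic continuation does the rest.\<close>

lemma gam_alpha_of_beta_nonzero:
  assumes "connected S" "\<And>z. z \<in> S \<Longrightarrow> beta F z = of_real (b z)" "z0 \<in> S" "beta F z0 \<noteq> 0" "z \<in> S"
  shows "cnj (gam z) = - alpha F z"
proof -
  define T where "T = {z \<in> S. beta F z \<noteq> 0}"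
  have "open T"
  proof -
    have "open (S \<inter> beta F -` (- {0}))"
      by (rule continuous_open_preimage[OF smooth_on_continuous[OF smooth_beta] open_S]) (simp add: open_Compl)
    also have "S \<inter> beta F -` (- {0}) = T" by (auto simp: T_def)
    finally show ?thesis .
  qed
  have "cnj (gam w) = - alpha F w" if "w \<in> T" for w
  proof -
    have w: "w \<in> S" "of_real (b w) \<noteq> (0::complex)" using that assms(2) by (auto simp: T_def)
    have "of_real (b w) * (alpha F w + cnj (gam w)) = 0"
      using alpha_beta_gam_relations(3)[OF w(1)] by (simp add: assms(2)[OF w(1)] algebra_simps)
    then have "alpha F w + cnj (gam w) = 0" using w(2) by simp
    then show ?thesis by (simp add: eq_neg_iff_add_eq_0 add.commute)
  qed
  then show ?thesis
    using analytic_continuation_open[OF \<open>open T\<close> open_S _ assms(1) _ holomorphic_cnj_gam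
        holomorphic_on_minus[OF holomorphic_alpha] _ assms(5)] assms(3,4)
    by (auto simp: T_def)
qed

text \<open>Here the modulus of \<open>alpha\<close> is \<open>r > 0\<close>, so the quotient is
  holomorphic on all of \<open>S\<close>; being of modulus 1, it is constant by the maximum
  principle.\<close>

lemma gam_alpha_of_beta_zero:
  assumes "connected S" "\<And>z. z \<in> S \<Longrightarrow> beta F z = 0"
  shows "\<exists>c. cmod c = 1 \<and> (\<forall>z\<in>S. cnj (gam z) = c * alpha F z)"
proof (cases "S = {}")
  case True
  then show ?thesis by (intro exI[of _ 1]) simp
next
  case False
  then obtain z0 where z0: "z0 \<in> S" by blast
  have alpha0: "alpha F z \<noteq> 0" if "z \<in> S" for z
    using cmod_relations(1)[OF that] assms(2)[OF that] r_pos[OF that] by auto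
  define q where "q z = cnj (gam z) / alpha F z" for z
  have q1: "cmod (q z) = 1" if "z \<in> S" for z
    using cmod_relations(2)[OF that] alpha0[OF that] by (simp add: q_def norm_divide)
  have "q holomorphic_on S"
    unfolding q_def by (intro holomorphic_on_divide holomorphic_cnj_gam holomorphic_alpha alpha0)
  then have "q constant_on S"
    by (rule maximum_modulus_principle[OF _ open_S assms(1) open_S subset_refl z0]) (simp add: q1 z0)
  then have q: "q z = q z0" if "z \<in> S" for z using that z0 by (auto simp: constant_on_def)
  have "cnj (gam z) = q z0 * alpha F z" if "z \<in> S" for z
    unfolding q[OF that, symmetric] using alpha0[OF that] by (simp add: q_def)
  then show ?thesis using q1[OF z0] by blast
qed

end

section \<open>Normalized lifts and the existence of the pair\<close>

lemma normalized_liftE: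
  assumes "open S" "normalized_lift S f F"
  obtains b where "horizontal_lift S f F" "\<And>z. z \<in> S \<Longrightarrow> beta F z = of_real (b z)" "\<And>z. z \<in> S \<Longrightarrow> b z \<ge> 0"
proof -
  obtain H \<phi> where H: "horizontal_lift S f H"
    "\<And>z. z \<in> S \<Longrightarrow> beta H z = cis \<phi> * complex_of_real (cmod (beta H z))"
    and F: "F = (\<lambda>z. cis (- \<phi> / 2) *s H z)"
    using assms(2) by (auto simp: normalized_lift_def)
  have unit: "cmod (cis (- \<phi> / 2)) = 1" by simp
  have "(cis (- \<phi> / 2))\<^sup>2 * cis \<phi> = 1" by (simp add: power2_eq_square cis_mult)
  note one = this
  have "beta F z = of_real (cmod (beta H z))" if "z \<in> S" for z
  proof -
    have "beta F z = (cis (- \<phi> / 2))\<^sup>2 * beta H z"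
      unfolding F by (rule horizontal_lift_rotate(3)[OF assms(1) H(1) unit that])
    also have "\<dots> = (cis (- \<phi> / 2))\<^sup>2 * (cis \<phi> * complex_of_real (cmod (beta H z)))"
      by (rule arg_cong[OF H(2)[OF that]])
    finally show ?thesis unfolding mult.assoc[symmetric] one by simp
  qed
  moreover have "horizontal_lift S f F"
    unfolding F by (rule horizontal_lift_rotate(1)[OF assms(1) H(1) unit])
  ultimately show ?thesis using that by auto
qed

lemma maximal_pair_of_normalized_lift:
  assumes "open D" "minimal_lagrangian D Q f" "Q \<in> Q2star_components" "has_metric D f (\<lambda>z. 2 * exp (u z))"
    and "open S" "connected S" "S \<subseteq> D" "normalized_lift S f F" "z0 \<in> S" "beta F z0 \<noteq> 0"
  shows "\<exists>g N. maximal_pair S f u (alpha F) g N"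
proof -
  obtain b where F: "horizontal_lift S f F" "\<And>z. z \<in> S \<Longrightarrow> beta F z = of_real (b z)" "\<And>z. z \<in> S \<Longrightarrow> b z \<ge> 0"
    using normalized_liftE[OF assms(5,8)] by blast
  have "f ` S \<subseteq> quadric_dual"
    using assms(2,7) component_quadric_dual[OF assms(3)] by (auto simp: minimal_lagrangian_def)
  note F' = horizontal_liftD[OF assms(5) F(1) this]
  interpret minimal_lagrangian_map S F "\<lambda>z. exp (u z)"
    by (rule minimal_lagrangian_mapI[OF assms(1,2,4) _ assms(5,7) F']) simp_all
  show ?thesis
    using maximal_pair_parts[OF F'(2) refl F(2,3) gam_alpha_of_beta_nonzero[OF assms(6) F(2) assms(9,10)]] by blast
qed

text \<open>If \<open>beta\<close> vanishes identically, every angle satisfies the normalization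
  condition. This freedom is what allows the lift to be rotated until
  \<open>alpha + cnj gam = 0\<close>; otherwise the given phase already leads to this
  relation.\<close>

lemma normalized_pair_exists:
  assumes "open D" "minimal_lagrangian D Q f" "Q \<in> Q2star_components" "has_metric D f (\<lambda>z. 2 * exp (u z))"
    and "open S" "connected S" "S \<subseteq> D" and H: "horizontal_lift S f H"
    and phase: "(\<forall>z\<in>S. beta H z \<noteq> 0) \<or> (\<exists>\<phi>. \<forall>z\<in>S. beta H z = cis \<phi> * complex_of_real (cmod (beta H z)))"
  shows "\<exists>F g N. normalized_lift S f F \<and> maximal_pair S f u (alpha F) g N"
proof -
  have fS: "f ` S \<subseteq> quadric_dual"
    using assms(2,7) component_quadric_dual[OF assms(3)] by (auto simp: minimal_lagrangian_def)
  note H' = horizontal_liftD[OF assms(5) H fS]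
  interpret H: minimal_lagrangian_map S H "\<lambda>z. exp (u z)"
    by (rule minimal_lagrangian_mapI[OF assms(1,2,4) _ assms(5,7) H']) simp_all
  obtain \<phi> where \<phi>: "\<And>z. z \<in> S \<Longrightarrow> beta H z = cis \<phi> * complex_of_real (cmod (beta H z))"
    using phase H.beta_phase[OF assms(6)] by blast
  show ?thesis
  proof (cases "\<exists>z\<in>S. beta H z \<noteq> 0")
    case True
    then obtain z0 where z0: "z0 \<in> S" "beta H z0 \<noteq> 0" by blast
    define F where "F = (\<lambda>z. cis (- \<phi> / 2) *s H z)"
    have norm: "normalized_lift S f F"
      unfolding normalized_lift_def F_def using H \<phi> by blast
    have "beta F z0 \<noteq> 0"
      unfolding F_def using z0 by (simp add: horizontal_lift_rotate(3)[OF assms(5) H])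
    with maximal_pair_of_normalized_lift[OF assms(1-7) norm z0(1)] norm show ?thesis by blast
  next
    case False
    then have beta0: "beta H z = 0" if "z \<in> S" for z using that by blast
    obtain c where c: "cmod c = 1" "\<And>z. z \<in> S \<Longrightarrow> cnj (H.gam z) = c * alpha H z"
      using H.gam_alpha_of_beta_zero[OF assms(6) beta0] by blast
    define \<psi> where "\<psi> = Arg (- c)"
    have "- c = cis \<psi>" using c(1) rcis_cmod_Arg[of "- c"] by (simp add: \<psi>_def rcis_def)
    then have c': "c = - cis \<psi>" by (metis minus_minus)
    \<comment> \<open>Rotation by \<open>e\<close> multiplies \<open>alpha\<close> by
      \<open>e\<^sup>2\<close> and \<open>cnj gam\<close> by its conjugate, so
      \<open>cnj gam = - alpha\<close> after rotation requires \<open>c\<close> to be minus the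
      fourth power of \<open>e\<close>, hence a quarter of the angle of \<open>- c\<close>. The
      angle \<phi>' presents this rotation as a normalization, which halves and negates it.\<close>
    define e \<phi>' where "e = cis (\<psi> / 4)" and "\<phi>' = - (\<psi> / 2)"
    define F where "F = (\<lambda>z. cis (- \<phi>' / 2) *s H z)"
    have F_eq: "F = (\<lambda>z. e *s H z)" by (simp add: F_def e_def \<phi>'_def)
    have e: "cmod e = 1" by (simp add: e_def)
    have e2: "e\<^sup>2 = cis (\<psi> / 2)" by (simp add: e_def power2_eq_square cis_mult)
    then have "cnj (e\<^sup>2) * c = - (e\<^sup>2)" by (simp add: c' cis_cnj cis_mult)
    note rotate = horizontal_lift_rotate[OF assms(5) H e, folded F_eq]
    have norm: "normalized_lift S f F"
      unfolding normalized_lift_def F_def using H beta0 by (intro exI[of _ H] exI[of _ \<phi>']) simp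
    note F' = horizontal_liftD[OF assms(5) rotate(1) fS]
    interpret L: minimal_lagrangian_map S F "\<lambda>z. exp (u z)"
      by (rule minimal_lagrangian_mapI[OF assms(1,2,4) _ assms(5,7) F']) simp_all
    have gam: "cnj (L.gam z) = - alpha F z" if "z \<in> S" for z
    proof -
      have "cnj (L.gam z) = cnj (e\<^sup>2) * cnj (H.gam z)"
        by (simp add: L.gam_def H.gam_def rotate(4)[OF that])
      also have "\<dots> = (cnj (e\<^sup>2) * c) * alpha H z" by (simp add: c(2)[OF that])
      also have "\<dots> = - alpha F z" unfolding \<open>cnj (e\<^sup>2) * c = - (e\<^sup>2)\<close> by (simp add: rotate(2)[OF that])
      finally show ?thesis .
    qed
    have "maximal_pair S f u (alpha F) L.re_part L.im_part"
      by (rule L.maximal_pair_parts[OF F'(2) refl _ _ gam, of "\<lambda>_. 0"]) (simp_all add: rotate(3) beta0)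
    with norm show ?thesis by blast
  qed
qed

text \<open>The converse consists of two claims because the phase is not determined when
  \<open>beta\<close> vanishes identically: then some normalized lift yields a pair, while for
  \<open>beta\<close> not identically zero on the region every normalized lift does.\<close>

theorem theorem1p7:
  fixes D :: "complex set"
  assumes "open D" and "D \<noteq> {}" and "connected D" and "simply_connected D"
  shows
    "(\<forall>(f_max :: complex \<Rightarrow> real^4) (N :: complex \<Rightarrow> real^4) (u_hat :: complex \<Rightarrow> real) (Q :: complex \<Rightarrow> complex)
        (f :: complex \<Rightarrow> (complex^4) set) (F :: complex \<Rightarrow> complex^4).
        maximal_surface D f_max N \<longrightarrow>
        AdS_has_metric D f_max (\<lambda>z. 2 * exp (u_hat z)) \<longrightarrow>
        (\<forall>z\<in>D. Q z = hopf f_max N z) \<longrightarrow>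
        (\<forall>z\<in>D. f z = cline (cvec (f_max z) + \<i> *s cvec (N z))) \<longrightarrow>
        (\<forall>z\<in>D. F z = complex_of_real (1 / sqrt 2) *s (cvec (f_max z) + \<i> *s cvec (N z))) \<longrightarrow>
          (\<exists>Q2star \<in> Q2star_components. minimal_lagrangian D Q2star f) \<and>
          horizontal_lift D f F \<and>
          (\<forall>z\<in>D. alpha F z = - \<i> * Q z) \<and>
          has_metric D f (\<lambda>z. exp (u_hat z) + (cmod (Q z))\<^sup>2 * exp (- u_hat z)))
     \<and>
     (\<forall>(Q2star :: (complex^4) set set) (f :: complex \<Rightarrow> (complex^4) set) (u :: complex \<Rightarrow> real).
        Q2star \<in> Q2star_components \<longrightarrow>
        minimal_lagrangian D Q2star f \<longrightarrow>
        has_metric D f (\<lambda>z. 2 * exp (u z)) \<longrightarrow>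
          (\<exists>H. horizontal_lift D f H \<and>
             (\<forall>S. open S \<and> connected S \<and> S \<noteq> {} \<and> S \<subseteq> D \<and>
                  ((\<forall>z\<in>S. beta H z \<noteq> 0) \<or>
                   (\<exists>\<phi>. \<forall>z\<in>S. beta H z = cis \<phi> * complex_of_real (cmod (beta H z)))) \<longrightarrow>
                (\<exists>F f_max N. normalized_lift S f F \<and> maximal_pair S f u (alpha F) f_max N))) \<and>
          (\<forall>S F. open S \<and> connected S \<and> S \<noteq> {} \<and> S \<subseteq> D \<and>
                  normalized_lift S f F \<and> (\<exists>z\<in>S. beta F z \<noteq> 0) \<longrightarrow>
                (\<exists>f_max N. maximal_pair S f u (alpha F) f_max N)))"
proof (intro conjI allI impI)
  fix f_max N :: "complex \<Rightarrow> real^4" and u_hat :: "complex \<Rightarrow> real" and Q :: "complex \<Rightarrow> complex"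
    and f :: "complex \<Rightarrow> (complex^4) set" and F :: "complex \<Rightarrow> complex^4"
  assume *: "maximal_surface D f_max N" "AdS_has_metric D f_max (\<lambda>z. 2 * exp (u_hat z))"
    and Q: "\<forall>z\<in>D. Q z = hopf f_max N z"
    and f: "\<forall>z\<in>D. f z = cline (cvec (f_max z) + \<i> *s cvec (N z))"
    and F: "\<forall>z\<in>D. F z = complex_of_real (1 / sqrt 2) *s (cvec (f_max z) + \<i> *s cvec (N z))"
  note lift = maximal_surface_lift[OF assms(1-3) *, of f F]
  show "\<exists>Q2star \<in> Q2star_components. minimal_lagrangian D Q2star f" "horizontal_lift D f F"
    using lift(1,2) f F by blast+
  show "\<forall>z\<in>D. alpha F z = - \<i> * Q z" using lift(3) f F Q by simp
  have "has_metric D f (\<lambda>z. exp (u_hat z) + (cmod (hopf f_max N z))\<^sup>2 * exp (- u_hat z))"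
    using lift(4) f F by blast
  \<comment> \<open>Local lifts are defined on subsets of \<open>D\<close>, so the metric is tested
    only where \<open>Q\<close> and the Hopf coefficient agree.\<close>
  then show "has_metric D f (\<lambda>z. exp (u_hat z) + (cmod (Q z))\<^sup>2 * exp (- u_hat z))"
    using Q by (auto simp: has_metric_def local_lift_def subset_iff)
next
  fix Q2star :: "(complex^4) set set" and f :: "complex \<Rightarrow> (complex^4) set" and u :: "complex \<Rightarrow> real"
  assume *: "Q2star \<in> Q2star_components" "minimal_lagrangian D Q2star f" "has_metric D f (\<lambda>z. 2 * exp (u z))"
  have "smooth_map D f" "f ` D \<subseteq> quadric_dual"
    using *(2) component_quadric_dual[OF *(1)] by (auto simp: minimal_lagrangian_def)
  then obtain G where G: "local_lift D f D G" by (rule global_lift[OF assms(1,3)])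
  then have "kaehler_pullback G 1 \<i> z = 0" if "z \<in> D" for z
    using *(2) that by (simp add: minimal_lagrangian_def)
  then obtain H where H: "horizontal_lift D f H"
    using horizontal_lift_exists[OF assms(1,4) G] by blast
  have HS: "horizontal_lift S f H" if "S \<subseteq> D" for S
    using H smooth_on_subset[OF _ that] that by (auto simp: horizontal_lift_def)
  show "\<exists>H. horizontal_lift D f H \<and>
      (\<forall>S. open S \<and> connected S \<and> S \<noteq> {} \<and> S \<subseteq> D \<and>
         ((\<forall>z\<in>S. beta H z \<noteq> 0) \<or>
          (\<exists>\<phi>. \<forall>z\<in>S. beta H z = cis \<phi> * complex_of_real (cmod (beta H z)))) \<longrightarrow>
         (\<exists>F f_max N. normalized_lift S f F \<and> maximal_pair S f u (alpha F) f_max N))"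
    using H normalized_pair_exists[OF assms(1) *(2,1,3) _ _ _ HS] by (intro exI[of _ H]) simp
  fix S F
  assume "open S \<and> connected S \<and> S \<noteq> {} \<and> S \<subseteq> D \<and> normalized_lift S f F \<and> (\<exists>z\<in>S. beta F z \<noteq> 0)"
  then show "\<exists>f_max N. maximal_pair S f u (alpha F) f_max N"
    using maximal_pair_of_normalized_lift[OF assms(1) *(2,1,3)] by blast
qed

end
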